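(* Let $S$ and $V$ be finite dimensional subspaces of $H$ with $S\perp V$, $\dim S=r$, $\dim V=t$. Let $m\in\mathbb{N}$ be such that (after a suitable reordering of the basis $E$) $\{(T_n,L_n)\}_{n=1}^m$ is a basis of the real span of $\{(T_n,L_n)\}_{n\in\mathbb{N}}$ in $\mathcal{B}_S^h\oplus\mathcal{B}_V^h$, and let $p_m:\ell^1(\mathbb{R})\to\mathbb{R}^m$ be the projection $p_m(x_1,\dots,x_n,\dots)=(x_1,\dots,x_m)$. Then the following statements are equivalent. (1) $m_S\cap m_V\neq\emptyset$. (2) $p_m(m_S)\cap p_m(m_V)\neq\emptyset$. (3) There exists $(M,N)=(U_S^{-1}(X),U_V^{-1}(Y))\in M_r^+(\mathbb{C})\times M_t^+(\mathbb{C})$, with $X\in\mathcal{B}_S^+$ and $Y\in\mathcal{B}_V^+$, such that $X_{j,j}=Y_{j,j}$ for $j=1,\dots,m$. (4) $W\big(\{P_SE_jP_S\}_{j=1}^m\big)\cap W\big(\{P_VE_jP_V\}_{j=1}^m\big)\neq\{(0,\dots,0)\}$. (5) $W\big(\{U_S^{-1}(P_SE_jP_S)\}_{j=1}^m\big)\cap W\big(\{U_V^{-1}(P_VE_jP_V)\}_{j=1}^m\big)\neq\{(0,\dots,0)\}$. (6) The pair of subspaces $(S,V)$ forms a support. (7) If $R\in(\mathcal{B}_S^h\oplus\mathcal{B}_V^h)^\perp\cap\mathcal{K}(H)^h$, $\lambda\in\mathbb{R}_{>0}$ and $\|R\|\le\lambda$, then the compact operator $\lambda(P_S-P_V)+R$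 is minimal.
   Context: $H$ is a complex separable infinite dimensional Hilbert space with a fixed orthonormal basis $E=\{e_j\}_{j=1}^\infty$; $E_j=e_j\otimes e_j$ is the rank-one orthogonal projection onto $\mathrm{span}\{e_j\}$; $P_S$ is the orthogonal projection onto $S$; $X_{n,n}=\langle Xe_n,e_n\rangle$; $\|\cdot\|$ is the operator norm. $\mathcal{B}_1(H)$ denotes the trace-class operators and $\mathcal{K}(H)^h$ the self-adjoint compact operators on $H$. Moment: $\mathcal{D}_S=\{Y\in\mathcal{B}_1(H): P_SY=Y\ge 0,\ \operatorname{tr}(Y)=1\}$ and $m_S=\{(Y_{n,n})_{n\in\mathbb{N}}:Y\in\mathcal{D}_S\}\subset\ell^1(\mathbb{R})$. $\mathcal{B}_S=P_SB(H)P_S$; $\mathcal{B}_S^h$ is the real vector space of its self-adjoint elements, with inner product $\langle A,B\rangle=\operatorname{tr}(AB)$, and $\mathcal{B}_S^+$ is the set of its positive semidefinite elements; likewise for $V$. $M_r^+(\mathbb{C})$ is the set of positive semidefinite $r\times r$ matrices. $(\mathcal{B}_S^h\oplus\mathcal{B}_V^h)^\perp$ is the orthogonal complement with respect to the trace, that is, $R$ belongs to it when $\operatorname{tr}(RA)=0$ for every $A\in\mathcal{B}_S^h$ and every $A\in\mathcal{B}_V^h$. $T_n\in\mathcal{B}_S^h$ is the operator with $\operatorname{tr}(AT_n)=A_{n,n}$ for all $A\in\mathcal{B}_S^h$, and $L_n\in\mathcal{B}_V^h$ is the operator with $\operatorname{tr}(CL_n)=C_{n,n}$ for all $C\in\mathcal{B}_V^h$.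 Joint numerical range: for a finite or infinite (norm-bounded) sequence $\mathbf{A}=\{A_j\}$ of self-adjoint compact operators on a Hilbert space $K$, $W(\mathbf{A})=\{\{\operatorname{tr}(\rho A_j)\}_j:\rho\in\mathcal{B}_1(K),\ \rho\ge 0,\ \operatorname{tr}(\rho)=1\}$. In (4) $K=H$; in (5) $K=\mathbb{C}^r$ and $K=\mathbb{C}^t$ respectively. Fix orthonormal bases $\{s^l\}_{l=1}^r$ of $S$ and $\{v^l\}_{l=1}^t$ of $V$. $U_S:M_r(\mathbb{C})\to\mathcal{B}_S$ is the linear bijection defined as follows. Let $e_k\otimes e_j=e_ke_j^t$ be the matrix units of $M_r(\mathbb{C})$ (here $e_k$ denotes the standard basis of $\mathbb{R}^r$) and $(s^k\otimes s^j)(x)=\langle x,s^j\rangle s^k$. Put $W^{j,j}=\frac{1}{\sqrt{1+1/j}}\big(\frac1j\sum_{l=1}^je_l\otimes e_l-e_{j+1}\otimes e_{j+1}\big)$ for $1\le j\le r-1$, $W^{k,j}=\frac1{\sqrt2}(e_k\otimes e_j+e_j\otimes e_k)$ for $k<j$, $W^{k,j}=\frac{i}{\sqrt2}(e_k\otimes e_j-e_j\otimes e_k)$ for $j<k$, and let $V^{k,j}$ be given by the same formulas with $e_l$ replaced by $s^l$. Then $U_S(W^{k,j})=V^{k,j}$ and $U_S(I_r)=P_S$. $U_V:M_t(\mathbb{C})\to\mathcal{B}_V$ is defined in the same way using $\{v^l\}_{l=1}^t$. Support: $(S,V)$ forms a support if $m_S\cap m_V\ne\emptyset$, or equivalently if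 there exist orthonormal sets $\{a^i\}_{i=1}^r\subset S$ and $\{b^j\}_{j=1}^t\subset V$ and $\alpha_i,\beta_j\ge0$ with $\sum_i\alpha_i=\sum_j\beta_j=1$ and $\sum_i\alpha_i|a^i|^2=\sum_j\beta_j|b^j|^2$, where $|x|^2=(|\langle x,e_1\rangle|^2,|\langle x,e_2\rangle|^2,\dots)$. Minimal: an operator $A\in B(H)$ is minimal if $\|A\|\le\|A+D\|$ for every $D\in B(H)$ diagonal in the basis $E$.
   Formalization: As printed (3), (5), (7) break the equivalence; proved with (M,N)≠(0,0) in (3), "the intersection contains a nonzero vector" in (5), and the extra condition RP_S=RP_V=0 in (7) (trace-orthogonality alone fails, e.g. S=span(e1+e2), V=span(e1−e2), R=diag(1/2,−1/2,0,…), λ=1). *)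

theory Defs
  imports "HOL-Analysis.Bounded_Linear_Function" "Jordan_Normal_Form.Matrix"
begin

(* Both theories use the symbol for their scalar products; the real one is written "inner" here. *)
no_notation inner (infix "\<bullet>" 70)

section \<open>Complex Hilbert spaces\<close>

text \<open>
  A complex Hilbert space is presented as a real Hilbert space with a compatible complex structure:
  the real inner product is the real part of the complex one, so the norm, the topology and
  completeness are those of the existing classes.  The complex inner product is linear in its
  first argument.
\<close>

class complex_hilbert_space = real_inner + complete_space +
  fixes scaleC :: "complex \<Rightarrow> 'a \<Rightarrow> 'a" (infixr "*\<^sub>C" 75)
    and cinner :: "'a \<Rightarrow> 'a \<Rightarrow> complex"
  assumes scaleC_add_right: "a *\<^sub>C (x + y) = a *\<^sub>C x + a *\<^sub>C y"
    and scaleC_add_left: "(a + b) *\<^sub>C x = a *\<^sub>C x + b *\<^sub>C x"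
    and scaleC_scaleC: "a *\<^sub>C b *\<^sub>C x = (a * b) *\<^sub>C x"
    and scaleC_one: "1 *\<^sub>C x = x"
    and scaleC_of_real: "complex_of_real c *\<^sub>C x = c *\<^sub>R x"
    and cinner_commute: "cinner x y = cnj (cinner y x)"
    and cinner_add_left: "cinner (x + y) z = cinner x z + cinner y z"
    and cinner_scaleC_left: "cinner (a *\<^sub>C x) y = a * cinner x y"
    and inner_eq_Re_cinner: "inner x y = Re (cinner x y)"

global_interpretation complex_vector:
  vector_space "scaleC :: complex \<Rightarrow> 'a \<Rightarrow> 'a :: complex_hilbert_space"
  by unfold_locales (simp_all add: scaleC_add_right scaleC_add_left scaleC_scaleC scaleC_one)

definition orthonormal_on :: "'i set \<Rightarrow> ('i \<Rightarrow> 'a :: complex_hilbert_space) \<Rightarrow> bool" where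
  "orthonormal_on I b \<longleftrightarrow> (\<forall>i\<in>I. \<forall>j\<in>I. cinner (b i) (b j) = (if i = j then 1 else 0))"

text \<open>A Hilbert basis indexed by \<^typ>\<open>nat\<close>; the space is then separable and infinite dimensional.\<close>

definition hilbert_basis :: "(nat \<Rightarrow> 'a :: complex_hilbert_space) \<Rightarrow> bool" where
  "hilbert_basis E \<longleftrightarrow>
     orthonormal_on UNIV E \<and> closure (complex_vector.span (range E)) = UNIV"

definition orthonormal_basis_of ::
    "'a :: complex_hilbert_space set \<Rightarrow> nat \<Rightarrow> (nat \<Rightarrow> 'a) \<Rightarrow> bool" where
  "orthonormal_basis_of S r s \<longleftrightarrow>
     orthonormal_on {..<r} s \<and> complex_vector.span (s ` {..<r}) = S"


section \<open>Operators\<close>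

text \<open>
  The type \<^typ>\<open>'a \<Rightarrow>\<^sub>L 'a\<close> consists of the bounded real-linear maps; the algebra of
  bounded operators is the set of the complex-linear ones.
\<close>

definition bounded_ops :: "('a :: complex_hilbert_space \<Rightarrow>\<^sub>L 'a) set" where
  "bounded_ops = {A. \<forall>c x. blinfun_apply A (c *\<^sub>C x) = c *\<^sub>C blinfun_apply A x}"

definition self_adjoint :: "('a :: complex_hilbert_space \<Rightarrow>\<^sub>L 'a) \<Rightarrow> bool" where
  "self_adjoint A \<longleftrightarrow>
     A \<in> bounded_ops \<and> (\<forall>x y. cinner (blinfun_apply A x) y = cinner x (blinfun_apply A y))"

text \<open>In the order of \<^typ>\<open>complex\<close>, \<open>0 \<le> z\<close> says that \<open>z\<close> is real and nonnegative.\<close>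

definition positive_op :: "('a :: complex_hilbert_space \<Rightarrow>\<^sub>L 'a) \<Rightarrow> bool" where
  "positive_op A \<longleftrightarrow> A \<in> bounded_ops \<and> (\<forall>x. 0 \<le> cinner (blinfun_apply A x) x)"

definition compact_op :: "('a :: complex_hilbert_space \<Rightarrow>\<^sub>L 'a) \<Rightarrow> bool" where
  "compact_op A \<longleftrightarrow> A \<in> bounded_ops \<and> compact (closure (blinfun_apply A ` cball 0 1))"

definition scale_op ::
    "complex \<Rightarrow> ('a :: complex_hilbert_space \<Rightarrow>\<^sub>L 'a) \<Rightarrow> ('a \<Rightarrow>\<^sub>L 'a)" where
  "scale_op c A = Blinfun (\<lambda>x. c *\<^sub>C blinfun_apply A x)"

definition tensor_op ::
    "'a :: complex_hilbert_space \<Rightarrow> 'a \<Rightarrow> ('a \<Rightarrow>\<^sub>L 'a)" (infix "\<otimes>\<^sub>o" 72) where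
  "a \<otimes>\<^sub>o b = Blinfun (\<lambda>x. cinner x b *\<^sub>C a)"

text \<open>The orthogonal projection onto \<open>S\<close> (meaningful for closed subspaces).\<close>

definition proj :: "'a :: complex_hilbert_space set \<Rightarrow> ('a \<Rightarrow>\<^sub>L 'a)" where
  "proj S = Blinfun (\<lambda>x. THE y. y \<in> S \<and> (\<forall>z\<in>S. cinner (x - y) z = 0))"

definition entry ::
    "(nat \<Rightarrow> 'a :: complex_hilbert_space) \<Rightarrow> ('a \<Rightarrow>\<^sub>L 'a) \<Rightarrow> nat \<Rightarrow> complex" where
  "entry E A n = cinner (blinfun_apply A (E n)) (E n)"

definition trace :: "(nat \<Rightarrow> 'a :: complex_hilbert_space) \<Rightarrow> ('a \<Rightarrow>\<^sub>L 'a) \<Rightarrow> complex" where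
  "trace E A = (\<Sum>n. entry E A n)"

text \<open>
  The operator \<open>P\<close> below is the absolute value of \<open>A\<close>, the positive square root of
  \<open>A\<^sup>* A\<close>: the equation says \<open>P P = A\<^sup>* A\<close>.
\<close>

definition trace_class :: "(nat \<Rightarrow> 'a :: complex_hilbert_space) \<Rightarrow> ('a \<Rightarrow>\<^sub>L 'a) \<Rightarrow> bool" where
  "trace_class E A \<longleftrightarrow> A \<in> bounded_ops \<and>
     (\<exists>P. positive_op P \<and>
          (\<forall>x y. cinner (blinfun_apply P x) (blinfun_apply P y) =
                 cinner (blinfun_apply A x) (blinfun_apply A y)) \<and>
          summable (entry E P))"

definition diagonal_op :: "(nat \<Rightarrow> 'a :: complex_hilbert_space) \<Rightarrow> ('a \<Rightarrow>\<^sub>L 'a) \<Rightarrow> bool" where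
  "diagonal_op E D \<longleftrightarrow>
     D \<in> bounded_ops \<and> (\<forall>i j. i \<noteq> j \<longrightarrow> cinner (blinfun_apply D (E i)) (E j) = 0)"

definition minimal_op :: "(nat \<Rightarrow> 'a :: complex_hilbert_space) \<Rightarrow> ('a \<Rightarrow>\<^sub>L 'a) \<Rightarrow> bool" where
  "minimal_op E A \<longleftrightarrow> A \<in> bounded_ops \<and> (\<forall>D. diagonal_op E D \<longrightarrow> norm A \<le> norm (A + D))"


section \<open>The compression algebra of a subspace and its moment\<close>

definition compress :: "'a :: complex_hilbert_space set \<Rightarrow> ('a \<Rightarrow>\<^sub>L 'a) \<Rightarrow> ('a \<Rightarrow>\<^sub>L 'a)" where
  "compress S A = proj S o\<^sub>L A o\<^sub>L proj S"

definition ops_on :: "'a :: complex_hilbert_space set \<Rightarrow> ('a \<Rightarrow>\<^sub>L 'a) set" where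
  "ops_on S = compress S ` bounded_ops"

definition sa_ops_on :: "'a :: complex_hilbert_space set \<Rightarrow> ('a \<Rightarrow>\<^sub>L 'a) set" where
  "sa_ops_on S = {A \<in> ops_on S. self_adjoint A}"

definition pos_ops_on :: "'a :: complex_hilbert_space set \<Rightarrow> ('a \<Rightarrow>\<^sub>L 'a) set" where
  "pos_ops_on S = {A \<in> ops_on S. positive_op A}"

text \<open>The operator representing the \<open>n\<close>-th diagonal entry on \<^term>\<open>sa_ops_on S\<close>.\<close>

definition diag_rep ::
    "(nat \<Rightarrow> 'a :: complex_hilbert_space) \<Rightarrow> 'a set \<Rightarrow> nat \<Rightarrow> ('a \<Rightarrow>\<^sub>L 'a)" where
  "diag_rep E S n =
     (THE T. T \<in> sa_ops_on S \<and> (\<forall>A\<in>sa_ops_on S. trace E (A o\<^sub>L T) = entry E A n))"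

definition trace_orthogonal ::
    "(nat \<Rightarrow> 'a :: complex_hilbert_space) \<Rightarrow> 'a set \<Rightarrow> 'a set \<Rightarrow> ('a \<Rightarrow>\<^sub>L 'a) set" where
  "trace_orthogonal E S V =
     {R \<in> bounded_ops. (\<forall>A\<in>sa_ops_on S. trace E (R o\<^sub>L A) = 0) \<and>
                       (\<forall>A\<in>sa_ops_on V. trace E (R o\<^sub>L A) = 0)}"

definition density_ops ::
    "(nat \<Rightarrow> 'a :: complex_hilbert_space) \<Rightarrow> 'a set \<Rightarrow> ('a \<Rightarrow>\<^sub>L 'a) set" where
  "density_ops E S =
     {Y. trace_class E Y \<and> proj S o\<^sub>L Y = Y \<and> positive_op Y \<and> trace E Y = 1}"

definition moment ::
    "(nat \<Rightarrow> 'a :: complex_hilbert_space) \<Rightarrow> 'a set \<Rightarrow> (nat \<Rightarrow> real) set" where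
  "moment E S = {(\<lambda>n. Re (entry E Y n)) | Y. Y \<in> density_ops E S}"

text \<open>The projection of a sequence to its first \<open>m\<close> terms is the vector \<^term>\<open>vec m x\<close>.\<close>

definition first_terms :: "nat \<Rightarrow> (nat \<Rightarrow> real) \<Rightarrow> real vec" where
  "first_terms m x = vec m x"

definition forms_support ::
    "(nat \<Rightarrow> 'a :: complex_hilbert_space) \<Rightarrow> 'a set \<Rightarrow> 'a set \<Rightarrow> bool" where
  "forms_support E S V \<longleftrightarrow>
     (let r = complex_vector.dim S; t = complex_vector.dim V in
      \<exists>a b \<alpha> \<beta>.
        orthonormal_on {..<r} a \<and> a ` {..<r} \<subseteq> S \<and>
        orthonormal_on {..<t} b \<and> b ` {..<t} \<subseteq> V \<and>
        (\<forall>i<r. 0 \<le> (\<alpha> i :: real)) \<and> (\<forall>j<t. 0 \<le> (\<beta> j :: real)) \<and>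
        (\<Sum>i<r. \<alpha> i) = 1 \<and> (\<Sum>j<t. \<beta> j) = 1 \<and>
        (\<forall>n. (\<Sum>i<r. \<alpha> i * (cmod (cinner (a i) (E n)))\<^sup>2) =
             (\<Sum>j<t. \<beta> j * (cmod (cinner (b j) (E n)))\<^sup>2)))"


section \<open>Matrices\<close>

definition mat_trace :: "complex mat \<Rightarrow> complex" where
  "mat_trace M = (\<Sum>i<dim_row M. M $$ (i, i))"

definition psd_mats :: "nat \<Rightarrow> complex mat set" where
  "psd_mats r = {M \<in> carrier_mat r r. \<forall>v\<in>carrier_vec r. 0 \<le> (M *\<^sub>v v) \<bullet>c v}"

definition mat_unit :: "nat \<Rightarrow> nat \<Rightarrow> nat \<times> nat \<Rightarrow> complex" where
  "mat_unit k j = (\<lambda>p. if p = (k, j) then 1 else 0)"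

text \<open>
  Indices start at \<open>0\<close> here, so the number \<open>j\<close> of the one-based formula for the diagonal
  case is \<^term>\<open>Suc j\<close>; that case is used only for \<^prop>\<open>Suc j < r\<close>.
\<close>

definition basis_mat :: "nat \<Rightarrow> nat \<Rightarrow> nat \<Rightarrow> complex mat" where
  "basis_mat r k j =
     (if k = j then
        mat r r (\<lambda>p. 1 / complex_of_real (sqrt (1 + 1 / real (Suc j))) *
          (1 / of_nat (Suc j) * (\<Sum>l\<le>j. mat_unit l l p) - mat_unit (Suc j) (Suc j) p))
      else if k < j then
        mat r r (\<lambda>p. 1 / complex_of_real (sqrt 2) * (mat_unit k j p + mat_unit j k p))
      else
        mat r r (\<lambda>p. \<i> / complex_of_real (sqrt 2) * (mat_unit k j p - mat_unit j k p)))"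

definition basis_op ::
    "(nat \<Rightarrow> 'a :: complex_hilbert_space) \<Rightarrow> nat \<Rightarrow> nat \<Rightarrow> ('a \<Rightarrow>\<^sub>L 'a)" where
  "basis_op s k j =
     (if k = j then
        scale_op (1 / complex_of_real (sqrt (1 + 1 / real (Suc j))))
          (scale_op (1 / of_nat (Suc j)) (\<Sum>l\<le>j. s l \<otimes>\<^sub>o s l) - s (Suc j) \<otimes>\<^sub>o s (Suc j))
      else if k < j then
        scale_op (1 / complex_of_real (sqrt 2)) (s k \<otimes>\<^sub>o s j + s j \<otimes>\<^sub>o s k)
      else
        scale_op (\<i> / complex_of_real (sqrt 2)) (s k \<otimes>\<^sub>o s j - s j \<otimes>\<^sub>o s k))"

text \<open>
  The linear map from matrices to operators on \<open>S\<close> attached to an orthonormal basis \<open>s\<close> of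
  \<open>S\<close>.  The matrices named below form a basis of all matrices, so these conditions
  determine it on \<^term>\<open>carrier_mat r r\<close>.
\<close>

definition matrix_to_op ::
    "'a :: complex_hilbert_space set \<Rightarrow> nat \<Rightarrow> (nat \<Rightarrow> 'a) \<Rightarrow> (complex mat \<Rightarrow> ('a \<Rightarrow>\<^sub>L 'a)) \<Rightarrow> bool" where
  "matrix_to_op S r s U \<longleftrightarrow>
     (\<forall>M\<in>carrier_mat r r. \<forall>N\<in>carrier_mat r r. U (M + N) = U M + U N) \<and>
     (\<forall>c. \<forall>M\<in>carrier_mat r r. U (c \<cdot>\<^sub>m M) = scale_op c (U M)) \<and>
     (\<forall>j. Suc j < r \<longrightarrow> U (basis_mat r j j) = basis_op s j j) \<and>
     (\<forall>k<r. \<forall>j<r. k \<noteq> j \<longrightarrow> U (basis_mat r k j) = basis_op s k j) \<and>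
     U (1\<^sub>m r) = proj S"


section \<open>Joint numerical ranges\<close>

text \<open>The joint numerical range of \<open>A 0, \<dots>, A (m - 1)\<close>, for operators and for matrices.\<close>

definition joint_range ::
    "(nat \<Rightarrow> 'a :: complex_hilbert_space) \<Rightarrow> nat \<Rightarrow> (nat \<Rightarrow> ('a \<Rightarrow>\<^sub>L 'a)) \<Rightarrow> complex vec set" where
  "joint_range E m A =
     {vec m (\<lambda>j. trace E (\<rho> o\<^sub>L A j)) | \<rho>. trace_class E \<rho> \<and> positive_op \<rho> \<and> trace E \<rho> = 1}"

definition mat_joint_range :: "nat \<Rightarrow> nat \<Rightarrow> (nat \<Rightarrow> complex mat) \<Rightarrow> complex vec set" where
  "mat_joint_range r m A =
     {vec m (\<lambda>j. mat_trace (\<rho> * A j)) | \<rho>. \<rho> \<in> psd_mats r \<and> mat_trace \<rho> = 1}"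

end

theory Submission
  imports Defs
begin

text \<open>
  The bridge between the finitely many tested entries and the whole diagonal is
  \<open>diagonals_agree\<close>. The \<open>n\<close>-th diagonal entry of an operator on \<open>S\<close> is its trace pairing with the
  compression of \<open>E n \<otimes>\<^sub>o E n\<close>, and likewise on \<open>V\<close>. For fixed positive \<open>X\<close> on \<open>S\<close> and \<open>Y\<close> on \<open>V\<close>, the
  difference of their \<open>n\<close>-th entries is therefore one real-linear functional evaluated at the \<open>n\<close>-th
  pair of representing operators. Since the first \<open>m\<close> pairs span all of them, equality of the first
  \<open>m\<close> entries forces equality of the diagonals, hence of the traces. Two such operators that are not
  both zero can be normalised to density operators with the same diagonal. Thus the moments meet iff
  there are positive operators on \<open>S\<close> and \<open>V\<close>, not both zero, with equal first \<open>m\<close> entries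
  (\<open>moments_meet_iff_positive\<close>), and the conditions on truncated moments, matrices, joint numerical
  ranges and supports are reformulations of this. For the matrix versions, the prescribed values on
  the basis matrices force the map from matrices to operators to be the evident one
  (\<open>matrix_to_op_eq_mat_op\<close>), which preserves positivity and traces. For supports, a positive operator on
  a finite-dimensional subspace is diagonalised by \<open>spectral_theorem\<close>.

  Minimality is a duality statement. If density operators \<open>X\<close> on \<open>S\<close> and \<open>Y\<close> on \<open>V\<close> have the same diagonal,
  then \<open>X - Y\<close> annihilates every diagonal operator and pairs with \<open>l (P - Q) + R\<close> to \<open>2 l\<close>, where
  \<open>P\<close> and \<open>Q\<close> are the projections onto \<open>S\<close> and \<open>V\<close>; since the trace norm of \<open>X - Y\<close> is at most
  \<open>2\<close>, no diagonal perturbation brings the norm below \<open>l\<close> (\<open>minimal_if_support\<close>). If the moments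
  are disjoint, the truncated diagonals of density operators on \<open>S\<close> and \<open>V\<close> form disjoint compact
  convex sets. A separating functional is a diagonal operator \<open>D\<close> that is strictly negative on \<open>S\<close>
  and strictly positive on \<open>V\<close> (\<open>separating_diagonal\<close>), and adding a small multiple of it to \<open>P - Q\<close>
  lowers the norm (\<open>not_minimal_if_separated\<close>).
\<close>

section \<open>The complex inner product\<close>

lemma of_real_cmod_square: "(complex_of_real (cmod z))\<^sup>2 = z * cnj z"
  by (simp only: of_real_power[symmetric] complex_norm_square)

lemma cinner_zero_left [simp]: "cinner 0 (x :: 'a :: complex_hilbert_space) = 0"
  using cinner_add_left[of 0 0 x] by simp

lemma cinner_minus_left [simp]: "cinner (- x) y = - cinner (x :: 'a :: complex_hilbert_space) y"
  using cinner_add_left[of x "- x" y] by (simp add: eq_neg_iff_add_eq_0 add.commute)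

lemma cinner_diff_left: "cinner (x - y) z = cinner (x :: 'a :: complex_hilbert_space) z - cinner y z"
  using cinner_add_left[of x "- y" z] by simp

lemma cinner_add_right: "cinner x (y + z) = cinner x y + cinner (x :: 'a :: complex_hilbert_space) z"
  by (subst (1 2 3) cinner_commute) (simp add: cinner_add_left)

lemma cinner_zero_right [simp]: "cinner (x :: 'a :: complex_hilbert_space) 0 = 0"
  using cinner_add_right[of x 0 0] by simp

lemma cinner_minus_right [simp]: "cinner x (- y) = - cinner (x :: 'a :: complex_hilbert_space) y"
  using cinner_add_right[of x y "- y"] by (simp add: eq_neg_iff_add_eq_0 add.commute)

lemma cinner_diff_right: "cinner x (y - z) = cinner (x :: 'a :: complex_hilbert_space) y - cinner x z"
  using cinner_add_right[of x y "- z"] by simp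

lemma cinner_scaleC_right: "cinner x (a *\<^sub>C y) = cnj a * cinner (x :: 'a :: complex_hilbert_space) y"
  by (subst (1 2) cinner_commute) (simp add: cinner_scaleC_left)

lemma cinner_scaleR_left: "cinner (a *\<^sub>R x) y = of_real a * cinner (x :: 'a :: complex_hilbert_space) y"
  by (simp add: scaleC_of_real[symmetric] cinner_scaleC_left)

lemma cinner_scaleR_right: "cinner x (a *\<^sub>R y) = of_real a * cinner (x :: 'a :: complex_hilbert_space) y"
  by (simp add: scaleC_of_real[symmetric] cinner_scaleC_right)

lemma cinner_sum_left: "cinner (\<Sum>i\<in>I. f i) y = (\<Sum>i\<in>I. cinner (f i :: 'a :: complex_hilbert_space) y)"
  by (induction I rule: infinite_finite_induct) (auto simp: cinner_add_left)

lemma cinner_sum_right: "cinner y (\<Sum>i\<in>I. f i) = (\<Sum>i\<in>I. cinner y (f i :: 'a :: complex_hilbert_space))"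
  by (induction I rule: infinite_finite_induct) (auto simp: cinner_add_right)

lemmas cinner_simps = cinner_add_left cinner_add_right cinner_diff_left cinner_diff_right
  cinner_scaleC_left cinner_scaleC_right cinner_scaleR_left cinner_scaleR_right
  cinner_sum_left cinner_sum_right

lemma scaleC_zero [simp]: "c *\<^sub>C (0 :: 'a :: complex_hilbert_space) = 0"
  "0 *\<^sub>C (x :: 'a :: complex_hilbert_space) = 0"
  by simp_all

lemma scaleC_scaleR: "c *\<^sub>C (a *\<^sub>R x) = a *\<^sub>R (c *\<^sub>C (x :: 'a :: complex_hilbert_space))"
  by (simp add: scaleC_of_real[symmetric] scaleC_scaleC mult.commute)

lemma scaleC_sum: "c *\<^sub>C (\<Sum>i\<in>I. f i) = (\<Sum>i\<in>I. c *\<^sub>C (f i :: 'a :: complex_hilbert_space))"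
  by (induction I rule: infinite_finite_induct) (auto simp: scaleC_add_right)

lemma cinner_self: "cinner x x = complex_of_real ((norm (x :: 'a :: complex_hilbert_space))\<^sup>2)"
proof (rule complex_eqI)
  show "Re (cinner x x) = Re (complex_of_real ((norm x)\<^sup>2))"
    using inner_eq_Re_cinner[of x x] by (simp add: power2_norm_eq_inner)
  have "cnj (cinner x x) = cinner x x"
    by (metis cinner_commute)
  then have "Im (cinner x x) = 0"
    by (simp add: complex_eq_iff)
  then show "Im (cinner x x) = Im (complex_of_real ((norm x)\<^sup>2))" by simp
qed

lemma cinner_eq_zero_self [simp]: "cinner x x = 0 \<longleftrightarrow> (x :: 'a :: complex_hilbert_space) = 0"
  by (simp add: cinner_self)

lemma norm_scaleC: "norm (c *\<^sub>C x) = cmod c * norm (x :: 'a :: complex_hilbert_space)"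
proof -
  have "complex_of_real ((norm (c *\<^sub>C x))\<^sup>2) = complex_of_real ((cmod c * norm x)\<^sup>2)"
    unfolding cinner_self[symmetric] cinner_scaleC_left cinner_scaleC_right
    by (simp add: cinner_self power_mult_distrib of_real_cmod_square mult.commute)
  then have "(norm (c *\<^sub>C x))\<^sup>2 = (cmod c * norm x)\<^sup>2"
    by (simp only: of_real_eq_iff)
  then show ?thesis
    by (simp add: power2_eq_iff_nonneg)
qed

lemma cmod_cinner_le: "cmod (cinner x y) \<le> norm x * norm (y :: 'a :: complex_hilbert_space)"
proof -
  define z where "z = cinner x y"
  define u where "u = (if z = 0 then 1 else cnj z / cmod z)"
  have u: "cmod u = 1" "u * z = cmod z"
    by (auto simp: u_def norm_divide complex_norm_square[symmetric] power2_eq_square mult.commute[of "cnj z"])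
  have "cmod z = Re (cinner (u *\<^sub>C x) y)"
    by (simp add: cinner_scaleC_left z_def[symmetric] u)
  also have "\<dots> = inner (u *\<^sub>C x) y"
    by (simp add: inner_eq_Re_cinner)
  also have "\<dots> \<le> norm (u *\<^sub>C x) * norm y"
    by (rule norm_cauchy_schwarz)
  finally show ?thesis
    by (simp add: norm_scaleC u z_def)
qed

lemma bounded_linear_cinner_left: "bounded_linear (\<lambda>x. cinner x (y :: 'a :: complex_hilbert_space))"
  by (rule bounded_linear_intro[where K = "norm y"])
     (auto simp: cinner_simps cmod_cinner_le scaleR_conv_of_real)

lemma bounded_linear_scaleC: "bounded_linear (\<lambda>x :: 'a :: complex_hilbert_space. c *\<^sub>C x)"
  by (rule bounded_linear_intro[where K = "cmod c"])
     (auto simp: scaleC_add_right scaleC_scaleR norm_scaleC mult.commute)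

lemma bounded_linear_scaleC_left: "bounded_linear (\<lambda>c. c *\<^sub>C (x :: 'a :: complex_hilbert_space))"
  by (rule bounded_linear_intro[where K = "norm x"])
     (auto simp: scaleC_add_left scaleR_conv_of_real scaleC_of_real[symmetric] scaleC_scaleC norm_scaleC)

lemma cmod_cinner_commute: "cmod (cinner x y) = cmod (cinner y (x :: 'a :: complex_hilbert_space))"
  by (metis cinner_commute complex_mod_cnj)

lemma cinner_mult_cnj_self: "cinner x y * cinner y x = of_real ((cmod (cinner x (y :: 'a :: complex_hilbert_space)))\<^sup>2)"
  by (subst (2) cinner_commute) (simp add: of_real_cmod_square)

section \<open>Finite orthonormal families\<close>

lemma orthonormal_on_norm: "orthonormal_on I b \<Longrightarrow> i \<in> I \<Longrightarrow> norm (b i :: 'a :: complex_hilbert_space) = 1"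
  using cinner_self[of "b i"] unfolding orthonormal_on_def
  by (metis norm_ge_zero of_real_eq_1_iff power2_eq_1_iff le_minus_one_simps(3))

lemma orthonormal_on_cinner_sum:
  fixes b :: "nat \<Rightarrow> 'a :: complex_hilbert_space"
  assumes "orthonormal_on I b" "finite I" "j \<in> I"
  shows "cinner (\<Sum>i\<in>I. c i *\<^sub>C b i) (b j) = c j"
proof -
  have "cinner (\<Sum>i\<in>I. c i *\<^sub>C b i) (b j) = (\<Sum>i\<in>I. if i = j then c j else 0)"
    using assms unfolding orthonormal_on_def cinner_sum_left cinner_scaleC_left
    by (intro sum.cong) auto
  then show ?thesis using assms by simp
qed

lemma orthonormal_on_residual:
  fixes b :: "nat \<Rightarrow> 'a :: complex_hilbert_space"
  assumes "orthonormal_on I b" "finite I" "j \<in> I"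
  shows "cinner (x - (\<Sum>i\<in>I. cinner x (b i) *\<^sub>C b i)) (b j) = 0"
  using orthonormal_on_cinner_sum[OF assms, of "\<lambda>i. cinner x (b i)"] by (simp add: cinner_diff_left)

lemma cinner_zero_commute: "cinner x y = 0 \<longleftrightarrow> cinner y (x :: 'a :: complex_hilbert_space) = 0"
  by (metis cinner_commute complex_cnj_zero_iff)

lemma pythagoras:
  assumes "cinner x y = 0"
  shows "(norm (x + y))\<^sup>2 = (norm x)\<^sup>2 + (norm (y :: 'a :: complex_hilbert_space))\<^sup>2"
proof -
  have "inner x y = 0" using assms by (simp add: inner_eq_Re_cinner)
  then show ?thesis
    by (simp add: power2_norm_eq_inner inner_add_left inner_add_right inner_commute)
qed

text \<open>The residual of \<open>x\<close> is orthogonal to the difference of any two combinations, so the claim is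
  Pythagoras.\<close>

lemma orthonormal_best_approximation:
  fixes b :: "nat \<Rightarrow> 'a :: complex_hilbert_space"
  assumes "orthonormal_on I b" "finite I"
  shows "norm (x - (\<Sum>i\<in>I. cinner x (b i) *\<^sub>C b i)) \<le> norm (x - (\<Sum>i\<in>I. c i *\<^sub>C b i))"
proof -
  let ?p = "\<Sum>i\<in>I. cinner x (b i) *\<^sub>C b i" and ?y = "\<Sum>i\<in>I. c i *\<^sub>C b i"
  have "cinner (x - ?p) (?p - ?y) = 0"
    using orthonormal_on_residual[OF assms, of _ x]
    by (simp add: cinner_simps(4)[of "x - ?p"] cinner_sum_right cinner_scaleC_right)
  from pythagoras[OF this] have "(norm (x - ?y))\<^sup>2 \<ge> (norm (x - ?p))\<^sup>2"
    by simp
  then show ?thesis by (rule power2_le_imp_le) simp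
qed

lemma span_orthonormal_image:
  fixes b :: "nat \<Rightarrow> 'a :: complex_hilbert_space"
  assumes "x \<in> complex_vector.span (b ` I)" "finite I"
  shows "\<exists>c. x = (\<Sum>i\<in>I. c i *\<^sub>C b i)"
  using assms(1)
proof (induction rule: complex_vector.span_induct_alt)
  case base
  show ?case by (intro exI[of _ "\<lambda>_. 0"]) simp
next
  case (step a y z)
  then obtain i d where i: "i \<in> I" "y = b i" and d: "z = (\<Sum>i\<in>I. d i *\<^sub>C b i)" by auto
  have "a *\<^sub>C y + z = (\<Sum>k\<in>I. ((if k = i then a else 0) + d k) *\<^sub>C b k)"
    using i d assms(2) by (simp add: scaleC_add_left sum.distrib if_distrib[of "\<lambda>c. c *\<^sub>C _"] cong: if_cong)
  then show ?case by (intro exI[of _ "\<lambda>k. (if k = i then a else 0) + d k"])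
qed

lemma orthonormal_basis_expansion:
  fixes s :: "nat \<Rightarrow> 'a :: complex_hilbert_space"
  assumes "orthonormal_basis_of S r s" "x \<in> S"
  shows "(\<Sum>i<r. cinner x (s i) *\<^sub>C s i) = x"
proof -
  obtain c where c: "x = (\<Sum>i<r. c i *\<^sub>C s i)"
    using span_orthonormal_image[of x s "{..<r}"] assms by (auto simp: orthonormal_basis_of_def)
  have "cinner x (s i) = c i" if "i < r" for i
    using orthonormal_on_cinner_sum[of "{..<r}" s i c] assms that by (simp add: c orthonormal_basis_of_def)
  then show ?thesis using c by simp
qed

text \<open>Pairing a vanishing combination with one member of the family isolates its coefficient.\<close>

lemma orthonormal_on_independent:
  fixes a :: "nat \<Rightarrow> 'a :: complex_hilbert_space"
  assumes "orthonormal_on I a"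
  shows "inj_on a I" "complex_vector.independent (a ` I)"
proof -
  show inj: "inj_on a I"
  proof (rule inj_onI)
    fix i j assume "i \<in> I" "j \<in> I" "a i = a j"
    then show "i = j" using assms unfolding orthonormal_on_def by (metis zero_neq_one)
  qed
  show "complex_vector.independent (a ` I)"
    unfolding complex_vector.independent_explicit_finite_subsets
  proof (intro allI impI ballI)
    fix F u x assume F: "F \<subseteq> a ` I" "finite F" and 0: "(\<Sum>v\<in>F. u v *\<^sub>C v) = 0" and x: "x \<in> F"
    then obtain j where j: "j \<in> I" "x = a j" by auto
    have "cinner v x = (if v = x then 1 else 0)" if "v \<in> F" for v
    proof -
      obtain i where i: "i \<in> I" "v = a i" using \<open>v \<in> F\<close> F by auto
      then show ?thesis using assms j inj by (auto simp: orthonormal_on_def inj_on_def)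
    qed
    then have "cinner (\<Sum>v\<in>F. u v *\<^sub>C v) x = (\<Sum>v\<in>F. if v = x then u x else 0)"
      unfolding cinner_sum_left cinner_scaleC_left by (intro sum.cong) auto
    then show "u x = 0" using 0 x F by simp
  qed
qed

section \<open>Parseval's identity\<close>

text \<open>Every partial sum is the best approximation from the span of its basis vectors, and the union
  of these spans is dense.\<close>

lemma hilbert_basis_expansion:
  fixes E :: "nat \<Rightarrow> 'a :: complex_hilbert_space"
  assumes "hilbert_basis E"
  shows "(\<lambda>n. cinner x (E n) *\<^sub>C E n) sums x"
  unfolding sums_def LIMSEQ_iff
proof (intro allI impI)
  fix e :: real assume "e > 0"
  have on: "orthonormal_on {..<n} E" for n
    using assms by (auto simp: hilbert_basis_def orthonormal_on_def)
  have "x \<in> closure (complex_vector.span (range E))"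
    using assms by (simp add: hilbert_basis_def)
  then obtain y where y: "y \<in> complex_vector.span (range E)" "dist y x < e"
    using \<open>e > 0\<close> closure_approachable by blast
  obtain N c where N: "\<And>n. n \<ge> N \<Longrightarrow> y = (\<Sum>i<n. c i *\<^sub>C E i)"
  proof -
    obtain F u where F: "finite F" "F \<subseteq> range E" "y = (\<Sum>v\<in>F. u v *\<^sub>C v)"
      using y(1) unfolding complex_vector.span_explicit by auto
    obtain I where I: "finite I" "F = E ` I"
      using F finite_subset_image by metis
    have "y \<in> complex_vector.span (E ` I)"
      unfolding F(3) by (rule complex_vector.span_sum, rule complex_vector.span_scale,
          rule complex_vector.span_base) (use I in auto)
    then obtain c where c: "y = (\<Sum>i\<in>I. c i *\<^sub>C E i)"
      using span_orthonormal_image I(1) by blast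
    obtain N where N: "I \<subseteq> {..<N}"
      using I(1) finite_nat_iff_bounded by auto
    have "y = (\<Sum>i<n. (if i \<in> I then c i else 0) *\<^sub>C E i)" if "n \<ge> N" for n
      unfolding c using N that
      by (intro sum.mono_neutral_cong_left) auto
    then show ?thesis by (rule that)
  qed
  have "norm ((\<Sum>i<n. cinner x (E i) *\<^sub>C E i) - x) < e" if "n \<ge> N" for n
  proof -
    have "norm (x - (\<Sum>i<n. cinner x (E i) *\<^sub>C E i)) \<le> norm (x - y)"
      unfolding N[OF that] by (rule orthonormal_best_approximation[OF on]) simp
    then show ?thesis using y(2) by (simp add: dist_norm norm_minus_commute)
  qed
  then show "\<exists>N. \<forall>n\<ge>N. norm ((\<Sum>i<n. cinner x (E i) *\<^sub>C E i) - x) < e" by blast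
qed

lemma parseval:
  fixes E :: "nat \<Rightarrow> 'a :: complex_hilbert_space"
  assumes "hilbert_basis E"
  shows "(\<lambda>n. cinner x (E n) * cinner (E n) y) sums cinner x y"
  using bounded_linear.sums[OF bounded_linear_cinner_left hilbert_basis_expansion[OF assms, of x], of y]
  by (simp add: cinner_scaleC_left)

section \<open>Bounded operators\<close>

lemma bounded_opsD: "A \<in> bounded_ops \<Longrightarrow> blinfun_apply A (c *\<^sub>C x) = c *\<^sub>C blinfun_apply A x"
  by (simp add: bounded_ops_def)

lemma scale_op_apply: "blinfun_apply (scale_op c A) x = c *\<^sub>C blinfun_apply A x"
  unfolding scale_op_def
  by (subst bounded_linear_Blinfun_apply)
     (auto intro: bounded_linear_compose[OF bounded_linear_scaleC] blinfun.bounded_linear_right)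

lemma tensor_op_apply: "blinfun_apply (a \<otimes>\<^sub>o b) x = cinner x b *\<^sub>C a"
  unfolding tensor_op_def
  by (subst bounded_linear_Blinfun_apply)
     (auto intro: bounded_linear_compose[OF bounded_linear_scaleC_left] bounded_linear_cinner_left)

lemma blinfun_apply_sum: "blinfun_apply (\<Sum>i\<in>I. A i) x = (\<Sum>i\<in>I. blinfun_apply (A i) x)"
  by (rule blinfun.sum_left)

lemmas op_simps = scale_op_apply tensor_op_apply blinfun_apply_sum blinfun.add_left blinfun.diff_left
  blinfun.scaleR_left blinfun.minus_left

lemma bounded_ops_zero [simp]: "0 \<in> bounded_ops"
  by (simp add: bounded_ops_def)

lemma bounded_ops_add: "A \<in> bounded_ops \<Longrightarrow> B \<in> bounded_ops \<Longrightarrow> A + B \<in> bounded_ops"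
  by (simp add: bounded_ops_def op_simps scaleC_add_right)

lemma bounded_ops_diff: "A \<in> bounded_ops \<Longrightarrow> B \<in> bounded_ops \<Longrightarrow> A - B \<in> bounded_ops"
  by (simp add: bounded_ops_def op_simps complex_vector.scale_right_diff_distrib)

lemma bounded_ops_scaleR: "A \<in> bounded_ops \<Longrightarrow> a *\<^sub>R A \<in> bounded_ops"
  by (simp add: bounded_ops_def op_simps scaleC_scaleR)

lemma bounded_ops_compose: "A \<in> bounded_ops \<Longrightarrow> B \<in> bounded_ops \<Longrightarrow> A o\<^sub>L B \<in> bounded_ops"
  by (simp add: bounded_ops_def op_simps)

lemma bounded_ops_tensor: "a \<otimes>\<^sub>o b \<in> bounded_ops"
  by (simp add: bounded_ops_def op_simps cinner_scaleC_left scaleC_scaleC)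

lemma bounded_ops_apply_sum:
  "A \<in> bounded_ops \<Longrightarrow> blinfun_apply A (\<Sum>i\<in>I. c i *\<^sub>C f i) = (\<Sum>i\<in>I. c i *\<^sub>C blinfun_apply A (f i))"
  by (simp add: blinfun.sum_right bounded_opsD)

lemma complex_nonneg_iff: "0 \<le> (z :: complex) \<longleftrightarrow> 0 \<le> Re z \<and> Im z = 0"
  by (auto simp: less_eq_complex_def)

lemma positive_opD: "positive_op A \<Longrightarrow> 0 \<le> Re (cinner (blinfun_apply A x) x)"
  "positive_op A \<Longrightarrow> Im (cinner (blinfun_apply A x) x) = 0"
  "positive_op A \<Longrightarrow> A \<in> bounded_ops"
  by (auto simp: positive_op_def complex_nonneg_iff)

text \<open>The diagonal of a positive operator is real, so the sesquilinear form
  \<open>cinner (A x) y - cinner x (A y)\<close> vanishes on the diagonal; the vectors \<open>x + y\<close> and \<open>x + i y\<close> then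
  show that it vanishes everywhere.\<close>

lemma positive_op_self_adjoint:
  assumes "positive_op (A :: 'a :: complex_hilbert_space \<Rightarrow>\<^sub>L 'a)"
  shows "self_adjoint A"
  unfolding self_adjoint_def
proof (intro conjI allI)
  show A: "A \<in> bounded_ops" using assms by (simp add: positive_op_def)
  fix x y
  define B where "B x y = cinner (blinfun_apply A x) y - cinner x (blinfun_apply A y)" for x y
  have B0: "B x x = 0" for x
    using positive_opD(2)[OF assms, of x] cinner_commute[of x "blinfun_apply A x"]
    by (simp add: B_def complex_eq_iff)
  have add: "B (x + y) (x + y) = B x x + B x y + B y x + B y y" for x y
    by (simp add: B_def cinner_simps blinfun.add_right)
  have i1: "B x (\<i> *\<^sub>C y) = - \<i> * B x y" and i2: "B (\<i> *\<^sub>C y) x = \<i> * B y x" for x y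
    by (simp_all add: B_def cinner_simps bounded_opsD[OF A] algebra_simps)
  have "B x y + B y x = 0"
    using add[of x y] by (simp add: B0)
  moreover have "- \<i> * B x y + \<i> * B y x = 0"
    using add[of x "\<i> *\<^sub>C y"] by (simp only: B0 i1 i2) simp
  then have "\<i> * (B y x - B x y) = 0" by (simp add: algebra_simps)
  then have "B y x = B x y" by simp
  ultimately have "B x y = 0" by simp
  then show "cinner (blinfun_apply A x) y = cinner x (blinfun_apply A y)" by (simp add: B_def)
qed

lemma self_adjointD:
  "self_adjoint A \<Longrightarrow> cinner (blinfun_apply A x) y = cinner x (blinfun_apply A y)"
  "self_adjoint A \<Longrightarrow> A \<in> bounded_ops"
  by (auto simp: self_adjoint_def)

lemma self_adjoint_inner:
  "self_adjoint A \<Longrightarrow> inner (blinfun_apply A x) y = inner x (blinfun_apply A y)"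
  by (simp add: inner_eq_Re_cinner self_adjointD(1))

lemma self_adjoint_zero [simp]: "self_adjoint 0"
  by (simp add: self_adjoint_def)

lemma self_adjoint_add: "self_adjoint A \<Longrightarrow> self_adjoint B \<Longrightarrow> self_adjoint (A + B)"
  by (auto simp: self_adjoint_def op_simps cinner_simps bounded_ops_add)

lemma self_adjoint_diff: "self_adjoint A \<Longrightarrow> self_adjoint B \<Longrightarrow> self_adjoint (A - B)"
  by (auto simp: self_adjoint_def op_simps cinner_simps bounded_ops_diff)

lemma self_adjoint_scaleR: "self_adjoint A \<Longrightarrow> self_adjoint (a *\<^sub>R A)"
  by (auto simp: self_adjoint_def op_simps cinner_simps bounded_ops_scaleR)

lemma self_adjoint_sum: "(\<And>i. i \<in> I \<Longrightarrow> self_adjoint (A i)) \<Longrightarrow> self_adjoint (\<Sum>i\<in>I. A i)"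
  by (induction I rule: infinite_finite_induct) (auto intro: self_adjoint_add)

lemma self_adjoint_tensor: "self_adjoint (a \<otimes>\<^sub>o a)"
  unfolding self_adjoint_def
proof (intro conjI allI bounded_ops_tensor)
  fix x y
  show "cinner (blinfun_apply (a \<otimes>\<^sub>o a) x) y = cinner x (blinfun_apply (a \<otimes>\<^sub>o a) y)"
    using cinner_commute[of a y] by (simp add: op_simps cinner_simps)
qed

lemma positive_op_zero [simp]: "positive_op 0"
  by (simp add: positive_op_def)

lemma positive_op_add: "positive_op A \<Longrightarrow> positive_op B \<Longrightarrow> positive_op (A + B)"
  by (auto simp: positive_op_def op_simps cinner_simps bounded_ops_add)

lemma positive_op_scaleR: "positive_op A \<Longrightarrow> 0 \<le> a \<Longrightarrow> positive_op (a *\<^sub>R A)"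
  by (auto simp: positive_op_def op_simps cinner_simps bounded_ops_scaleR complex_nonneg_iff)

lemma cinner_tensor_self: "cinner (blinfun_apply (a \<otimes>\<^sub>o a) x) x = of_real ((cmod (cinner a x))\<^sup>2)"
  by (simp add: op_simps cinner_scaleC_left cinner_mult_cnj_self[symmetric] mult.commute del: of_real_power)

lemma positive_op_tensor: "positive_op (a \<otimes>\<^sub>o a)"
  unfolding positive_op_def cinner_tensor_self by (simp add: bounded_ops_tensor complex_nonneg_iff del: of_real_power)

section \<open>Eigenvectors of self-adjoint operators\<close>

text \<open>The Rayleigh quotient attains its maximum on a compact unit sphere, and at a maximum its
  derivative in each direction \<open>y\<close> of the subspace vanishes.\<close>

lemma self_adjoint_eigenvector:
  fixes X :: "'a :: complex_hilbert_space \<Rightarrow>\<^sub>L 'a"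
  assumes X: "self_adjoint X" and W: "complex_vector.subspace W"
    and inv: "\<And>x. x \<in> W \<Longrightarrow> blinfun_apply X x \<in> W"
    and cpt: "compact (W \<inter> sphere 0 1)" and w: "w \<in> W" "w \<noteq> 0"
  shows "\<exists>a\<in>W. \<exists>l. norm a = 1 \<and> blinfun_apply X a = l *\<^sub>R a"
proof -
  have scaleR: "c *\<^sub>R x \<in> W" if "x \<in> W" for c x
    using complex_vector.subspace_scale[OF W that, of "of_real c"] by (simp add: scaleC_of_real)
  note sa = self_adjoint_inner[OF X]
  have "(1 / norm w) *\<^sub>R w \<in> W \<inter> sphere 0 1"
    using w scaleR by simp
  then have ne: "W \<inter> sphere 0 1 \<noteq> {}" by blast
  have "continuous_on (W \<inter> sphere 0 1) (\<lambda>x. inner (blinfun_apply X x) x)"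
    by (intro continuous_intros)
  from continuous_attains_sup[OF cpt ne this]
  obtain a where a: "a \<in> W" "norm a = 1"
    and max: "\<And>x. x \<in> W \<Longrightarrow> norm x = 1 \<Longrightarrow> inner (blinfun_apply X x) x \<le> inner (blinfun_apply X a) a"
    by auto
  define l where "l = inner (blinfun_apply X a) a"
  have le: "inner (blinfun_apply X x) x \<le> l * (norm x)\<^sup>2" if "x \<in> W" for x
  proof (cases "x = 0")
    case False
    have "inner (blinfun_apply X ((1 / norm x) *\<^sub>R x)) ((1 / norm x) *\<^sub>R x) \<le> l"
      unfolding l_def by (rule max) (use that False scaleR in auto)
    then show ?thesis
      using False by (simp add: blinfun.scaleR_right field_simps power2_eq_square)
  qed simp
  have crit: "inner (l *\<^sub>R a - blinfun_apply X a) y = 0" if y: "y \<in> W" for y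
  proof -
    define b where "b = 2 * inner (l *\<^sub>R a - blinfun_apply X a) y"
    define c where "c = l * (norm y)\<^sup>2 - inner (blinfun_apply X y) y"
    have q: "0 \<le> b * e + c * e\<^sup>2" for e
    proof -
      have "a + e *\<^sub>R y \<in> W"
        using a y scaleR complex_vector.subspace_add[OF W] by blast
      from le[OF this] have "0 \<le> l * (norm (a + e *\<^sub>R y))\<^sup>2 - inner (blinfun_apply X (a + e *\<^sub>R y)) (a + e *\<^sub>R y)"
        by simp
      also have "\<dots> = b * e + c * e\<^sup>2"
      proof -
        have "inner a a = 1" using a(2) by (simp add: power2_norm_eq_inner[symmetric])
        then show ?thesis
          unfolding b_def c_def power2_norm_eq_inner
          using sa[of y a] inner_commute[of y a] inner_commute[of y "blinfun_apply X a"]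
          by (simp add: blinfun.add_right blinfun.scaleR_right inner_add_left inner_add_right
              algebra_simps power2_eq_square l_def[symmetric])
      qed
      finally show ?thesis .
    qed
    have "b = 0"
    proof (rule ccontr)
      assume b: "b \<noteq> 0"
      \<comment> \<open>The quadratic polynomial is negative at \<open>- b / d\<close> for every \<open>d\<close> larger than \<open>c\<close>.\<close>
      define d where "d = \<bar>c\<bar> + 1"
      have d: "d > 0" "c < d" by (auto simp: d_def)
      have "b * (- b / d) + c * (- b / d)\<^sup>2 = (b\<^sup>2 / d) * (c / d - 1)"
        using d by (simp add: field_simps power2_eq_square)
      also have "\<dots> < 0"
        using d b by (intro mult_pos_neg) (auto simp: field_simps)
      finally show False using q[of "- b / d"] by simp
    qed
    then show ?thesis by (simp add: b_def)
  qed
  have "l *\<^sub>R a - blinfun_apply X a \<in> W"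
    using a inv scaleR complex_vector.subspace_diff[OF W] by blast
  then have "l *\<^sub>R a - blinfun_apply X a = 0"
    using crit[of "l *\<^sub>R a - blinfun_apply X a"] by simp
  then show ?thesis using a by (intro bexI[of _ a] exI[of _ l]) auto
qed

section \<open>Finite-dimensional subspaces\<close>

text \<open>Iterated sumsets. This gives the compactness of the unit ball of a finite-dimensional subspace
  (sums of multiples of basis vectors) and later that of the set of diagonals of density operators.\<close>

lemma compact_sum_set:
  fixes g :: "nat \<Rightarrow> 'b :: topological_space \<Rightarrow> 'c :: real_normed_vector"
  assumes "compact B" "\<And>i. continuous_on B (g i)"
  shows "compact {\<Sum>i<n. g i (x i) | x. \<forall>i<n. x i \<in> B}"
proof (induction n)
  case (Suc n)
  have "{\<Sum>i<Suc n. g i (x i) | x. \<forall>i<Suc n. x i \<in> B}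
    = {p + q | p q. p \<in> {\<Sum>i<n. g i (x i) | x. \<forall>i<n. x i \<in> B} \<and> q \<in> g n ` B}" (is "?L = ?R")
  proof (intro equalityI subsetI)
    fix y assume "y \<in> ?L"
    then obtain x where x: "\<forall>i<Suc n. x i \<in> B" "y = (\<Sum>i<n. g i (x i)) + g n (x n)" by auto
    then have "(\<Sum>i<n. g i (x i)) \<in> {\<Sum>i<n. g i (x i) | x. \<forall>i<n. x i \<in> B}" "g n (x n) \<in> g n ` B"
      using less_SucI by auto
    then show "y \<in> ?R" using x(2) by blast
  next
    fix y assume "y \<in> ?R"
    then obtain x z where "\<forall>i<n. x i \<in> B" "z \<in> B" "y = (\<Sum>i<n. g i (x i)) + g n z" by auto
    then show "y \<in> ?L"
      by (intro CollectI exI[of _ "x(n := z)"]) (auto simp: less_Suc_eq)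
  qed
  moreover have "compact (g n ` B)"
    by (intro compact_continuous_image assms)
  ultimately show ?case using compact_sums[OF Suc.IH] by simp
qed auto

locale onb_subspace =
  fixes S :: "'a :: complex_hilbert_space set" and r :: nat and s :: "nat \<Rightarrow> 'a"
  assumes onb: "orthonormal_basis_of S r s"
begin

lemma orthonormal: "orthonormal_on {..<r} s" and span_basis: "complex_vector.span (s ` {..<r}) = S"
  using onb by (auto simp: orthonormal_basis_of_def)

lemma subspace: "complex_vector.subspace S"
  using span_basis complex_vector.subspace_span by metis

lemma basis_mem: "i < r \<Longrightarrow> s i \<in> S"
  using span_basis complex_vector.span_base[of "s i" "s ` {..<r}"] by auto

lemma sum_mem: "(\<And>i. i \<in> I \<Longrightarrow> f i \<in> S) \<Longrightarrow> (\<Sum>i\<in>I. c i *\<^sub>C f i) \<in> S"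
  by (intro complex_vector.subspace_sum[OF subspace] complex_vector.subspace_scale[OF subspace])

lemma proj_eq_sum: "proj S = (\<Sum>i<r. s i \<otimes>\<^sub>o s i)"
proof -
  have "(THE y. y \<in> S \<and> (\<forall>z\<in>S. cinner (x - y) z = 0)) = blinfun_apply (\<Sum>i<r. s i \<otimes>\<^sub>o s i) x" for x
  proof (rule the_equality, intro conjI ballI)
    show mem: "blinfun_apply (\<Sum>i<r. s i \<otimes>\<^sub>o s i) x \<in> S"
      by (auto simp: op_simps intro: sum_mem basis_mem)
    show orth: "cinner (x - blinfun_apply (\<Sum>i<r. s i \<otimes>\<^sub>o s i) x) z = 0" if "z \<in> S" for z
    proof -
      have "cinner (x - (\<Sum>i<r. cinner x (s i) *\<^sub>C s i)) (\<Sum>i<r. cinner z (s i) *\<^sub>C s i) = 0"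
        unfolding cinner_sum_right cinner_scaleC_right
        using orthonormal_on_residual[OF orthonormal] by (intro sum.neutral) auto
      then show ?thesis
        by (simp add: orthonormal_basis_expansion[OF onb that] op_simps)
    qed
    fix y assume y: "y \<in> S \<and> (\<forall>z\<in>S. cinner (x - y) z = 0)"
    let ?d = "y - blinfun_apply (\<Sum>i<r. s i \<otimes>\<^sub>o s i) x"
    have "?d \<in> S" using y mem complex_vector.subspace_diff[OF subspace] by blast
    moreover have "cinner ?d ?d = cinner (x - blinfun_apply (\<Sum>i<r. s i \<otimes>\<^sub>o s i) x) ?d - cinner (x - y) ?d"
      by (simp add: cinner_diff_left[symmetric])
    ultimately have "cinner ?d ?d = 0"
      using y orth[of ?d] by simp
    then show "y = blinfun_apply (\<Sum>i<r. s i \<otimes>\<^sub>o s i) x" by simp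
  qed
  then show ?thesis
    unfolding proj_def by (simp only: blinfun_apply_inverse)
qed

lemma proj_apply: "blinfun_apply (proj S) x = (\<Sum>i<r. cinner x (s i) *\<^sub>C s i)"
  by (simp add: proj_eq_sum op_simps)

lemma proj_mem: "blinfun_apply (proj S) x \<in> S"
  by (auto simp: proj_apply intro: sum_mem basis_mem)

lemma proj_id: "x \<in> S \<Longrightarrow> blinfun_apply (proj S) x = x"
  by (simp add: proj_apply orthonormal_basis_expansion[OF onb])

lemma self_adjoint_proj: "self_adjoint (proj S)"
  unfolding proj_eq_sum by (intro self_adjoint_sum self_adjoint_tensor)

lemmas proj_bounded_ops = self_adjointD(2)[OF self_adjoint_proj]
lemmas cinner_proj = self_adjointD(1)[OF self_adjoint_proj]

lemma cinner_residual: "z \<in> S \<Longrightarrow> cinner (x - blinfun_apply (proj S) x) z = 0"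
  by (simp add: cinner_diff_left cinner_proj proj_id)

lemma dim: "complex_vector.dim S = r"
  using complex_vector.dim_span_eq_card_independent[OF orthonormal_on_independent(2)[OF orthonormal]]
    card_image[OF orthonormal_on_independent(1)[OF orthonormal]]
  by (simp add: span_basis)

text \<open>The form in which membership is used: the operator maps into the subspace and does not
  see the orthogonal complement.\<close>

lemma ops_on_iff:
  "A \<in> ops_on S \<longleftrightarrow> A \<in> bounded_ops \<and> (\<forall>x. blinfun_apply A x \<in> S) \<and>
     (\<forall>x. blinfun_apply A (blinfun_apply (proj S) x) = blinfun_apply A x)"
proof
  assume "A \<in> ops_on S"
  then obtain B where "B \<in> bounded_ops" "A = compress S B" by (auto simp: ops_on_def)
  then show "A \<in> bounded_ops \<and> (\<forall>x. blinfun_apply A x \<in> S) \<and>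
     (\<forall>x. blinfun_apply A (blinfun_apply (proj S) x) = blinfun_apply A x)"
    by (auto simp: compress_def op_simps proj_mem proj_id intro!: bounded_ops_compose proj_bounded_ops)
next
  assume *: "A \<in> bounded_ops \<and> (\<forall>x. blinfun_apply A x \<in> S) \<and>
     (\<forall>x. blinfun_apply A (blinfun_apply (proj S) x) = blinfun_apply A x)"
  then have "compress S A = A"
    by (intro blinfun_eqI) (simp add: compress_def op_simps proj_id)
  then show "A \<in> ops_on S" using * unfolding ops_on_def by force
qed

lemma compact_unit_ball: "compact (S \<inter> cball 0 1)"
proof -
  have box: "compact {\<Sum>i<r. c i *\<^sub>C s i | c. \<forall>i<r. c i \<in> cball 0 1}"
    by (intro compact_sum_set compact_cball linear_continuous_on bounded_linear_scaleC_left)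
  have closed: "closed S"
  proof -
    have "S = {x. blinfun_apply (proj S) x = x}"
      using proj_id proj_mem by auto metis
    also have "closed \<dots>" by (intro closed_Collect_eq continuous_intros)
    finally show ?thesis .
  qed
  have "S \<inter> cball 0 1 \<subseteq> {\<Sum>i<r. c i *\<^sub>C s i | c. \<forall>i<r. c i \<in> cball 0 1}"
  proof
    fix x assume x: "x \<in> S \<inter> cball 0 1"
    have "cmod (cinner x (s i)) \<le> 1" if "i < r" for i
      using cmod_cinner_le[of x "s i"] orthonormal_on_norm[OF orthonormal, of i] that x by simp
    then show "x \<in> {\<Sum>i<r. c i *\<^sub>C s i | c. \<forall>i<r. c i \<in> cball 0 1}"
      using orthonormal_basis_expansion[OF onb, of x] x
      by (intro CollectI exI[of _ "\<lambda>i. cinner x (s i)"]) auto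
  qed
  then have "S \<inter> cball 0 1 = {\<Sum>i<r. c i *\<^sub>C s i | c. \<forall>i<r. c i \<in> cball 0 1} \<inter> (S \<inter> cball 0 1)"
    by blast
  also have "compact \<dots>"
    by (rule compact_Int_closed[OF box closed_Int[OF closed closed_cball]])
  finally show ?thesis .
qed

text \<open>A vector outside the span of the family would enlarge it to an independent set with \<open>r + 1\<close>
  members inside the span of \<open>r\<close> vectors.\<close>

lemma orthonormal_basis_if_card:
  assumes a: "orthonormal_on {..<r} a" "a ` {..<r} \<subseteq> S"
  shows "orthonormal_basis_of S r a"
proof -
  note ind = orthonormal_on_independent[OF a(1)]
  have "S \<subseteq> complex_vector.span (a ` {..<r})"
  proof (rule ccontr)
    assume "\<not> S \<subseteq> complex_vector.span (a ` {..<r})"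
    then obtain x where x: "x \<in> S" "x \<notin> complex_vector.span (a ` {..<r})" by blast
    have "complex_vector.independent (insert x (a ` {..<r}))"
      using x(2) ind(2) by (rule complex_vector.independent_insertI)
    moreover have "insert x (a ` {..<r}) \<subseteq> complex_vector.span (s ` {..<r})"
      using x(1) a(2) span_basis by simp
    ultimately have "card (insert x (a ` {..<r})) \<le> card (s ` {..<r})"
      using complex_vector.independent_span_bound[of "s ` {..<r}"] by blast
    moreover have "card (s ` {..<r}) \<le> r" using card_image_le[of "{..<r}" s] by simp
    moreover have "x \<notin> a ` {..<r}" using x(2) complex_vector.span_base[of x "a ` {..<r}"] by metis
    ultimately show False using card_image[OF ind(1)] by simp
  qed
  moreover have "complex_vector.span (a ` {..<r}) \<subseteq> S"
    using a(2) subspace by (rule complex_vector.span_minimal)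
  ultimately show ?thesis using a(1) by (auto simp: orthonormal_basis_of_def)
qed

text \<open>Fewer than \<open>r\<close> vectors do not span the subspace, and the residual of a vector outside their
  span is orthogonal to all of them.\<close>

lemma exists_orthogonal_vector:
  assumes a: "orthonormal_on {..<n} a" "a ` {..<n} \<subseteq> S" and "n < r"
  shows "\<exists>w\<in>S. w \<noteq> 0 \<and> (\<forall>i<n. cinner w (a i) = 0)"
proof -
  have "\<not> S \<subseteq> complex_vector.span (a ` {..<n})"
  proof
    assume "S \<subseteq> complex_vector.span (a ` {..<n})"
    then have "complex_vector.dim S \<le> card (a ` {..<n})"
      by (rule complex_vector.dim_le_card) simp
    also have "\<dots> \<le> n" using card_image_le[of "{..<n}" a] by simp
    finally show False using \<open>n < r\<close> by (simp add: dim)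
  qed
  then obtain x where x: "x \<in> S" "x \<notin> complex_vector.span (a ` {..<n})" by blast
  define w where "w = x - (\<Sum>i<n. cinner x (a i) *\<^sub>C a i)"
  have "(\<Sum>i<n. cinner x (a i) *\<^sub>C a i) \<in> complex_vector.span (a ` {..<n})"
    by (intro complex_vector.span_sum complex_vector.span_scale complex_vector.span_base) auto
  then have "w \<noteq> 0" using x(2) by (auto simp: w_def)
  moreover have "w \<in> S"
    unfolding w_def using a(2) by (intro complex_vector.subspace_diff[OF subspace] x(1) sum_mem) auto
  moreover have "\<forall>i<n. cinner w (a i) = 0"
    unfolding w_def using orthonormal_on_residual[OF a(1)] by auto
  ultimately show ?thesis by blast
qed

text \<open>Eigenvectors are split off one at a time, each from the orthogonal complement of the previous
  ones, which a self-adjoint operator leaves invariant. Eigenvalue \<open>0\<close> is allowed, so there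
  are always exactly \<open>r\<close> eigenvectors.\<close>

lemma spectral_theorem:
  assumes X: "X \<in> pos_ops_on S"
  shows "\<exists>a \<alpha>. orthonormal_on {..<r} a \<and> a ` {..<r} \<subseteq> S \<and> (\<forall>i<r. 0 \<le> \<alpha> i) \<and>
    X = (\<Sum>i<r. \<alpha> i *\<^sub>R (a i \<otimes>\<^sub>o a i))"
proof -
  have pos: "positive_op X" and op: "X \<in> ops_on S" using X by (auto simp: pos_ops_on_def)
  note sa = positive_op_self_adjoint[OF pos]
  have "\<exists>a \<alpha>. orthonormal_on {..<n} a \<and> a ` {..<n} \<subseteq> S \<and>
      (\<forall>i<n. 0 \<le> \<alpha> i \<and> blinfun_apply X (a i) = \<alpha> i *\<^sub>R a i)" if "n \<le> r" for n
    using that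
  proof (induction n)
    case 0
    then show ?case by (simp add: orthonormal_on_def)
  next
    case (Suc n)
    then obtain a \<alpha> where a: "orthonormal_on {..<n} a" "a ` {..<n} \<subseteq> S"
      and \<alpha>: "\<And>i. i < n \<Longrightarrow> 0 \<le> \<alpha> i" "\<And>i. i < n \<Longrightarrow> blinfun_apply X (a i) = \<alpha> i *\<^sub>R a i"
      by auto
    define W where "W = {x\<in>S. \<forall>i<n. cinner x (a i) = 0}"
    have W: "complex_vector.subspace W"
      using subspace unfolding W_def complex_vector.subspace_def
      by (auto simp: cinner_simps)
    have "closed {x. \<forall>i<n. cinner x (a i) = 0}"
    proof -
      have "{x. \<forall>i<n. cinner x (a i) = 0} = (\<Inter>i\<in>{..<n}. {x. cinner x (a i) = 0})" by auto
      also have "closed \<dots>"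
        by (intro closed_INT ballI closed_Collect_eq continuous_intros
            linear_continuous_on bounded_linear_cinner_left)
      finally show ?thesis .
    qed
    then have "closed ({x. \<forall>i<n. cinner x (a i) = 0} \<inter> sphere 0 1)"
    proof (rule closed_Int)
      have "sphere 0 1 = {x :: 'a. norm x = 1}" by auto
      also have "closed \<dots>" by (intro closed_Collect_eq continuous_intros)
      finally show "closed (sphere (0 :: 'a) 1)" .
    qed
    then have "compact ((S \<inter> cball 0 1) \<inter> ({x. \<forall>i<n. cinner x (a i) = 0} \<inter> sphere 0 1))"
      by (rule compact_Int_closed[OF compact_unit_ball])
    moreover have "(S \<inter> cball 0 1) \<inter> ({x. \<forall>i<n. cinner x (a i) = 0} \<inter> sphere 0 1) = W \<inter> sphere 0 1"
      by (auto simp: W_def)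
    ultimately have "compact (W \<inter> sphere 0 1)" by simp
    moreover have "blinfun_apply X x \<in> W" if "x \<in> W" for x
      using that op by (auto simp: W_def ops_on_iff self_adjointD(1)[OF sa] \<alpha>(2) cinner_scaleR_right)
    moreover obtain w where "w \<in> W" "w \<noteq> 0"
      using exists_orthogonal_vector[OF a] Suc.prems by (auto simp: W_def)
    ultimately obtain b l where b: "b \<in> W" "norm b = 1" "blinfun_apply X b = l *\<^sub>R b"
      using self_adjoint_eigenvector[OF sa W] by blast
    have bb: "cinner b b = 1" by (simp add: cinner_self b)
    have "0 \<le> l"
      using positive_opD(1)[OF pos, of b] by (simp add: b cinner_scaleR_left bb)
    moreover have "orthonormal_on {..<Suc n} (a(n := b))"
      using a(1) b(1) bb cinner_zero_commute[of b] by (auto simp: orthonormal_on_def W_def less_Suc_eq)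
    moreover have "(a(n := b)) ` {..<Suc n} \<subseteq> S"
      using a(2) b(1) by (auto simp: W_def less_Suc_eq)
    moreover have "\<forall>i<Suc n. 0 \<le> (\<alpha>(n := l)) i \<and> blinfun_apply X ((a(n := b)) i) = (\<alpha>(n := l)) i *\<^sub>R (a(n := b)) i"
      using \<alpha> b(3) \<open>0 \<le> l\<close> by (auto simp: less_Suc_eq)
    ultimately show ?case by blast
  qed
  from this[OF order_refl] obtain a \<alpha> where a: "orthonormal_on {..<r} a" "a ` {..<r} \<subseteq> S"
    and \<alpha>: "\<And>i. i < r \<Longrightarrow> 0 \<le> \<alpha> i" "\<And>i. i < r \<Longrightarrow> blinfun_apply X (a i) = \<alpha> i *\<^sub>R a i"
    by auto
  interpret a: onb_subspace S r a
    by unfold_locales (rule orthonormal_basis_if_card[OF a])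
  have "X = (\<Sum>i<r. \<alpha> i *\<^sub>R (a i \<otimes>\<^sub>o a i))"
  proof (rule blinfun_eqI)
    fix x
    have "blinfun_apply X x = blinfun_apply X (blinfun_apply (proj S) x)"
      using op by (simp add: ops_on_iff)
    also have "\<dots> = (\<Sum>i<r. cinner x (a i) *\<^sub>C (\<alpha> i *\<^sub>R a i))"
      using \<alpha>(2) by (simp add: a.proj_apply bounded_ops_apply_sum[OF positive_opD(3)[OF pos]])
    also have "\<dots> = blinfun_apply (\<Sum>i<r. \<alpha> i *\<^sub>R (a i \<otimes>\<^sub>o a i)) x"
      by (simp add: op_simps scaleC_scaleR)
    finally show "blinfun_apply X x = blinfun_apply (\<Sum>i<r. \<alpha> i *\<^sub>R (a i \<otimes>\<^sub>o a i)) x" .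
  qed
  then show ?thesis using a \<alpha>(1) by blast
qed

end

section \<open>Matrices of operators on a finite-dimensional subspace\<close>

abbreviation unit_mat_at :: "nat \<Rightarrow> nat \<Rightarrow> nat \<Rightarrow> complex mat" where
  "unit_mat_at r k j \<equiv> mat r r (mat_unit k j)"

definition diag_ones :: "nat \<Rightarrow> nat \<Rightarrow> complex mat" where
  "diag_ones r n = mat r r (\<lambda>(k, j). if k = j \<and> k < n then 1 else 0)"

lemma diag_ones_carrier [simp]: "diag_ones r n \<in> carrier_mat r r"
  by (simp add: diag_ones_def)

text \<open>A scaled diagonal basis matrix is the average of the first \<open>j + 1\<close> diagonal units minus the
  next one. Adding it to the sum of the first \<open>j + 2\<close> units cancels the last of them, so the
  partial identities are obtained from the full identity by descent.\<close>

lemma diag_ones_step: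
  "diag_ones r (Suc j) = (of_nat (Suc j) / of_nat (Suc (Suc j))) \<cdot>\<^sub>m
     (diag_ones r (Suc (Suc j)) + complex_of_real (sqrt (1 + 1 / real (Suc j))) \<cdot>\<^sub>m basis_mat r j j)"
proof (rule eq_matI)
  have "sqrt (1 + 1 / real (Suc j)) \<noteq> 0"
    by (simp add: real_sqrt_eq_zero_cancel_iff add_pos_pos less_imp_neq[symmetric] del: of_nat_Suc)
  then have c: "complex_of_real (sqrt (1 + 1 / real (Suc j))) \<noteq> 0" by (simp del: of_nat_Suc)
  have n: "of_nat (Suc j) \<noteq> (0 :: complex)" "of_nat (Suc (Suc j)) \<noteq> (0 :: complex)"
    by (simp_all del: of_nat_Suc)
  have n2: "of_nat (Suc (Suc j)) = (of_nat (Suc j) + 1 :: complex)" by simp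
  fix k l assume "k < dim_row ((of_nat (Suc j) / of_nat (Suc (Suc j))) \<cdot>\<^sub>m
     (diag_ones r (Suc (Suc j)) + complex_of_real (sqrt (1 + 1 / real (Suc j))) \<cdot>\<^sub>m basis_mat r j j))"
    "l < dim_col ((of_nat (Suc j) / of_nat (Suc (Suc j))) \<cdot>\<^sub>m
     (diag_ones r (Suc (Suc j)) + complex_of_real (sqrt (1 + 1 / real (Suc j))) \<cdot>\<^sub>m basis_mat r j j))"
  then have kl: "k < r" "l < r" by (auto simp: basis_mat_def)
  have sum: "(\<Sum>i\<le>j. mat_unit i i (k, l)) = (if k = l \<and> k \<le> j then 1 else 0)"
  proof -
    have "(\<Sum>i\<le>j. mat_unit i i (k, l)) = (\<Sum>i\<le>j. if i = k then (if k = l then 1 else 0) else 0)"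
      by (intro sum.cong) (auto simp: mat_unit_def)
    then show ?thesis by auto
  qed
  have "diag_ones r (Suc j) $$ (k, l) = (of_nat (Suc j) / of_nat (Suc (Suc j))) *
    (diag_ones r (Suc (Suc j)) $$ (k, l) +
      (1 / of_nat (Suc j) * (\<Sum>i\<le>j. mat_unit i i (k, l)) - mat_unit (Suc j) (Suc j) (k, l)))"
    unfolding sum using kl n by (auto simp: diag_ones_def mat_unit_def field_simps less_Suc_eq_le simp del: of_nat_Suc)
       (simp_all add: n2 field_simps)
  then show "diag_ones r (Suc j) $$ (k, l) = ((of_nat (Suc j) / of_nat (Suc (Suc j))) \<cdot>\<^sub>m
     (diag_ones r (Suc (Suc j)) + complex_of_real (sqrt (1 + 1 / real (Suc j))) \<cdot>\<^sub>m basis_mat r j j)) $$ (k, l)"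
    using kl c by (simp add: basis_mat_def diag_ones_def del: of_nat_Suc)
qed (auto simp: basis_mat_def diag_ones_def)

lemma unit_mat_diag: "j < r \<Longrightarrow> unit_mat_at r j j = diag_ones r (Suc j) + (- 1) \<cdot>\<^sub>m diag_ones r j"
  by (intro eq_matI) (auto simp: diag_ones_def mat_unit_def)

lemma unit_mat_upper:
  assumes "k < j"
  shows "unit_mat_at r k j = (1 / complex_of_real (sqrt 2)) \<cdot>\<^sub>m (basis_mat r k j + \<i> \<cdot>\<^sub>m basis_mat r j k)"
    "unit_mat_at r j k = (1 / complex_of_real (sqrt 2)) \<cdot>\<^sub>m (basis_mat r k j + (- \<i>) \<cdot>\<^sub>m basis_mat r j k)"
proof -
  have "complex_of_real (sqrt 2) * complex_of_real (sqrt 2) = 2"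
    by (simp add: of_real_mult[symmetric] del: of_real_mult)
  then have *: "1 / (complex_of_real (sqrt 2) * complex_of_real (sqrt 2)) = 1 / 2" by simp
  show "unit_mat_at r k j = (1 / complex_of_real (sqrt 2)) \<cdot>\<^sub>m (basis_mat r k j + \<i> \<cdot>\<^sub>m basis_mat r j k)"
    using assms * by (intro eq_matI) (auto simp: basis_mat_def mat_unit_def)
  show "unit_mat_at r j k = (1 / complex_of_real (sqrt 2)) \<cdot>\<^sub>m (basis_mat r k j + (- \<i>) \<cdot>\<^sub>m basis_mat r j k)"
    using assms * by (intro eq_matI) (auto simp: basis_mat_def mat_unit_def)
qed

context onb_subspace
begin

text \<open>The explicit form of the map from matrices to operators; the next definition is its inverse.\<close>

definition mat_op :: "complex mat \<Rightarrow> ('a \<Rightarrow>\<^sub>L 'a)" where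
  "mat_op M = (\<Sum>k<r. \<Sum>j<r. scale_op (M $$ (k, j)) (s k \<otimes>\<^sub>o s j))"

definition op_mat :: "('a \<Rightarrow>\<^sub>L 'a) \<Rightarrow> complex mat" where
  "op_mat X = mat r r (\<lambda>(k, j). cinner (blinfun_apply X (s j)) (s k))"

lemma op_mat_carrier [simp]: "op_mat X \<in> carrier_mat r r"
  by (simp add: op_mat_def)

lemma cinner_basis: "i < r \<Longrightarrow> j < r \<Longrightarrow> cinner (s i) (s j) = (if i = j then 1 else 0)"
  using orthonormal by (auto simp: orthonormal_on_def)

lemma mat_op_apply:
  "blinfun_apply (mat_op M) x = (\<Sum>k<r. (\<Sum>j<r. M $$ (k, j) * cinner x (s j)) *\<^sub>C s k)"
  by (simp add: mat_op_def op_simps scaleC_scaleC complex_vector.scale_sum_left)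

lemma mat_op_in_ops_on: "mat_op M \<in> ops_on S"
  unfolding ops_on_iff
proof (intro conjI allI)
  show "mat_op M \<in> bounded_ops"
    unfolding bounded_ops_def
    by (auto simp: mat_op_apply cinner_scaleC_left scaleC_sum scaleC_scaleC sum_distrib_left mult_ac)
  show "blinfun_apply (mat_op M) x \<in> S" for x
    unfolding mat_op_apply by (auto intro: sum_mem basis_mem)
  show "blinfun_apply (mat_op M) (blinfun_apply (proj S) x) = blinfun_apply (mat_op M) x" for x
    unfolding mat_op_apply by (intro sum.cong refl arg_cong2[of _ _ _ _ scaleC])
       (simp add: cinner_proj proj_id basis_mem)
qed

lemma mat_op_add:
  "M \<in> carrier_mat r r \<Longrightarrow> N \<in> carrier_mat r r \<Longrightarrow> mat_op (M + N) = mat_op M + mat_op N"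
  by (intro blinfun_eqI)
     (simp add: mat_op_apply op_simps sum.distrib[symmetric] scaleC_add_left[symmetric] distrib_right)

lemma mat_op_smult: "M \<in> carrier_mat r r \<Longrightarrow> mat_op (c \<cdot>\<^sub>m M) = scale_op c (mat_op M)"
  by (intro blinfun_eqI)
     (simp add: mat_op_apply op_simps scaleC_sum scaleC_scaleC sum_distrib_left mult.assoc)

lemma mat_op_entry:
  assumes "k < r" "j < r"
  shows "cinner (blinfun_apply (mat_op M) (s j)) (s k) = M $$ (k, j)"
proof -
  have "cinner (blinfun_apply (mat_op M) (s j)) (s k) = (\<Sum>l<r. M $$ (k, l) * cinner (s j) (s l))"
    unfolding mat_op_apply using assms orthonormal_on_cinner_sum[OF orthonormal, of k] by simp
  also have "\<dots> = (\<Sum>l<r. if l = j then M $$ (k, j) else 0)"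
    using assms cinner_basis by (intro sum.cong) auto
  finally show ?thesis using assms by simp
qed

lemma op_mat_mat_op: "M \<in> carrier_mat r r \<Longrightarrow> op_mat (mat_op M) = M"
  by (intro eq_matI) (auto simp: op_mat_def mat_op_entry)

lemma mat_op_op_mat:
  assumes "X \<in> ops_on S"
  shows "mat_op (op_mat X) = X"
proof (rule blinfun_eqI)
  fix x
  note X = assms[unfolded ops_on_iff]
  have "blinfun_apply X x = blinfun_apply X (blinfun_apply (proj S) x)" using X by simp
  also have "\<dots> = (\<Sum>j<r. cinner x (s j) *\<^sub>C blinfun_apply X (s j))"
    unfolding proj_apply by (rule bounded_ops_apply_sum) (use X in simp)
  finally have Xx: "blinfun_apply X x = (\<Sum>j<r. cinner x (s j) *\<^sub>C blinfun_apply X (s j))" .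
  have "blinfun_apply (mat_op (op_mat X)) x = (\<Sum>k<r. cinner (blinfun_apply X x) (s k) *\<^sub>C s k)"
    unfolding mat_op_apply Xx by (simp add: op_mat_def cinner_sum_left cinner_scaleC_left mult.commute)
  also have "\<dots> = blinfun_apply X x"
    using X orthonormal_basis_expansion[OF onb] by blast
  finally show "blinfun_apply (mat_op (op_mat X)) x = blinfun_apply X x" .
qed

lemma mat_op_unit:
  assumes "k < r" "j < r"
  shows "mat_op (unit_mat_at r k j) = s k \<otimes>\<^sub>o s j"
proof (rule blinfun_eqI)
  fix x
  have "(\<Sum>l<r. unit_mat_at r k j $$ (i, l) * cinner x (s l)) = (if i = k then cinner x (s j) else 0)" if "i < r" for i
  proof -
    have "(\<Sum>l<r. unit_mat_at r k j $$ (i, l) * cinner x (s l)) = (\<Sum>l<r. if l = j then (if i = k then cinner x (s j) else 0) else 0)"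
      using that by (intro sum.cong) (auto simp: mat_unit_def)
    then show ?thesis using assms by simp
  qed
  then have "blinfun_apply (mat_op (unit_mat_at r k j)) x = (\<Sum>i<r. if i = k then cinner x (s j) *\<^sub>C s k else 0)"
    unfolding mat_op_apply by (intro sum.cong) auto
  then show "blinfun_apply (mat_op (unit_mat_at r k j)) x = blinfun_apply (s k \<otimes>\<^sub>o s j) x"
    using assms by (simp add: op_simps)
qed

lemma mat_op_diag_ones:
  assumes "n \<le> r"
  shows "mat_op (diag_ones r n) = (\<Sum>i<n. s i \<otimes>\<^sub>o s i)"
proof (rule blinfun_eqI)
  fix x
  have "(\<Sum>l<r. diag_ones r n $$ (i, l) * cinner x (s l)) = (if i < n then cinner x (s i) else 0)" if "i < r" for i
  proof -
    have "(\<Sum>l<r. diag_ones r n $$ (i, l) * cinner x (s l)) = (\<Sum>l<r. if l = i then (if i < n then cinner x (s i) else 0) else 0)"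
      using that by (intro sum.cong) (auto simp: diag_ones_def)
    then show ?thesis using that by simp
  qed
  then have "blinfun_apply (mat_op (diag_ones r n)) x = (\<Sum>i<r. if i < n then cinner x (s i) *\<^sub>C s i else 0)"
    unfolding mat_op_apply by (intro sum.cong) auto
  also have "\<dots> = (\<Sum>i<n. cinner x (s i) *\<^sub>C s i)"
    using assms by (intro sum.mono_neutral_cong_right) auto
  finally show "blinfun_apply (mat_op (diag_ones r n)) x = blinfun_apply (\<Sum>i<n. s i \<otimes>\<^sub>o s i) x"
    by (simp add: op_simps)
qed

lemma mat_op_basis_mat:
  assumes "k < r" "j < r" "k = j \<Longrightarrow> Suc j < r"
  shows "mat_op (basis_mat r k j) = basis_op s k j"
proof -
  consider "k = j" | "k < j" | "j < k" by linarith
  then show ?thesis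
  proof cases
    case 1
    have "basis_mat r j j = (1 / complex_of_real (sqrt (1 + 1 / real (Suc j)))) \<cdot>\<^sub>m
      ((1 / of_nat (Suc j)) \<cdot>\<^sub>m diag_ones r (Suc j) + (- 1) \<cdot>\<^sub>m unit_mat_at r (Suc j) (Suc j))"
    proof (rule eq_matI)
      fix i l assume "i < dim_row ((1 / complex_of_real (sqrt (1 + 1 / real (Suc j)))) \<cdot>\<^sub>m
          ((1 / of_nat (Suc j)) \<cdot>\<^sub>m diag_ones r (Suc j) + (- 1) \<cdot>\<^sub>m unit_mat_at r (Suc j) (Suc j)))"
        "l < dim_col ((1 / complex_of_real (sqrt (1 + 1 / real (Suc j)))) \<cdot>\<^sub>m
          ((1 / of_nat (Suc j)) \<cdot>\<^sub>m diag_ones r (Suc j) + (- 1) \<cdot>\<^sub>m unit_mat_at r (Suc j) (Suc j)))"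
      then have il: "i < r" "l < r" by (auto simp: diag_ones_def)
      have "(\<Sum>p\<le>j. mat_unit p p (i, l)) = (\<Sum>p\<le>j. if p = i then (if i = l then 1 else 0) else 0)"
        by (intro sum.cong) (auto simp: mat_unit_def)
      also have "\<dots> = diag_ones r (Suc j) $$ (i, l)"
        using il by (auto simp: diag_ones_def less_Suc_eq_le)
      finally show "basis_mat r j j $$ (i, l) = ((1 / complex_of_real (sqrt (1 + 1 / real (Suc j)))) \<cdot>\<^sub>m
          ((1 / of_nat (Suc j)) \<cdot>\<^sub>m diag_ones r (Suc j) + (- 1) \<cdot>\<^sub>m unit_mat_at r (Suc j) (Suc j))) $$ (i, l)"
        using il by (simp add: basis_mat_def diag_ones_def del: of_nat_Suc)
    qed (auto simp: basis_mat_def diag_ones_def)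
    moreover have "mat_op (diag_ones r (Suc j)) = (\<Sum>l\<le>j. s l \<otimes>\<^sub>o s l)"
      using assms(2) by (simp only: mat_op_diag_ones Suc_leI lessThan_Suc_atMost)
    ultimately show ?thesis
      using 1 assms
      by (simp add: mat_op_smult mat_op_add mat_op_unit basis_op_def del: of_nat_Suc)
         (intro blinfun_eqI, simp add: op_simps del: of_nat_Suc)
  next
    case 2
    then have "basis_mat r k j = (1 / complex_of_real (sqrt 2)) \<cdot>\<^sub>m (unit_mat_at r k j + unit_mat_at r j k)"
      by (intro eq_matI) (auto simp: basis_mat_def)
    then show ?thesis using 2 assms
      by (simp add: mat_op_smult mat_op_add mat_op_unit basis_op_def)
  next
    case 3
    then have "basis_mat r k j = (\<i> / complex_of_real (sqrt 2)) \<cdot>\<^sub>m (unit_mat_at r k j + (- 1) \<cdot>\<^sub>m unit_mat_at r j k)"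
      by (intro eq_matI) (auto simp: basis_mat_def)
    then show ?thesis using 3 assms
      by (simp add: mat_op_smult mat_op_add mat_op_unit basis_op_def)
         (intro blinfun_eqI, simp add: op_simps)
  qed
qed

text \<open>The matrices on which the two maps agree are closed under linear combinations and contain the
  basis matrices and the identity, hence the diagonal units (by descent), the off-diagonal units
  and finally every matrix.\<close>

lemma matrix_to_op_eq_mat_op:
  assumes U: "matrix_to_op S r s U" and M: "M \<in> carrier_mat r r"
  shows "U M = mat_op M"
proof -
  define G where "G = {M \<in> carrier_mat r r. U M = mat_op M}"
  have add: "A + B \<in> G" if "A \<in> G" "B \<in> G" for A B
    using that U by (auto simp: G_def matrix_to_op_def mat_op_add)
  have smult: "c \<cdot>\<^sub>m A \<in> G" if "A \<in> G" for c A
    using that U by (auto simp: G_def matrix_to_op_def mat_op_smult)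
  have basis: "basis_mat r k j \<in> G" if "k < r" "j < r" "k = j \<Longrightarrow> Suc j < r" for k j
    using that U mat_op_basis_mat[of k j]
    by (auto simp: G_def matrix_to_op_def) (auto simp: basis_mat_def)
  have top: "diag_ones r r \<in> G"
  proof -
    have "1\<^sub>m r = diag_ones r r" by (intro eq_matI) (auto simp: diag_ones_def)
    then show ?thesis
      using U by (auto simp: G_def matrix_to_op_def mat_op_diag_ones proj_eq_sum)
  qed
  have down: "diag_ones r (r - i) \<in> G" for i
  proof (induction i)
    case 0
    show ?case using top by simp
  next
    case (Suc i)
    show ?case
    proof (cases "r - Suc i = 0")
      case True
      have "diag_ones r 0 = 0 \<cdot>\<^sub>m diag_ones r r" by (intro eq_matI) (auto simp: diag_ones_def)
      then show ?thesis using True smult[OF top] by simp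
    next
      case False
      then obtain j where j: "r - Suc i = Suc j" by (cases "r - Suc i") auto
      then have "r - i = Suc (Suc j)" by simp
      then show ?thesis
        unfolding j using Suc.IH by (subst diag_ones_step) (intro smult add basis, auto)
    qed
  qed
  have ones: "diag_ones r n \<in> G" if "n \<le> r" for n
    using down[of "r - n"] that by simp
  have unit: "unit_mat_at r k j \<in> G" if kj: "k < r" "j < r" for k j
  proof -
    consider "k = j" | "k < j" | "j < k" by linarith
    then show ?thesis
    proof cases
      case 1
      then show ?thesis using kj by (simp add: unit_mat_diag del: One_nat_def) (intro add smult ones, auto)
    next
      case 2
      then show ?thesis unfolding unit_mat_upper(1)[OF 2] using kj by (intro add smult basis) auto
    next
      case 3
      then show ?thesis unfolding unit_mat_upper(2)[OF 3] using kj by (intro add smult basis) auto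
    qed
  qed
  have part: "mat r r (\<lambda>p. if p \<in> Q then M $$ p else 0) \<in> G" if "finite Q" "Q \<subseteq> {..<r} \<times> {..<r}" for Q
    using that
  proof (induction Q)
    case empty
    have "mat r r (\<lambda>p. if p \<in> {} then M $$ p else 0) = 0 \<cdot>\<^sub>m diag_ones r r"
      by (intro eq_matI) (auto simp: diag_ones_def)
    then show ?case using smult[OF top] by simp
  next
    case (insert q Q)
    obtain k j where q: "q = (k, j)" "k < r" "j < r" using insert.prems by (cases q) auto
    have "mat r r (\<lambda>p. if p \<in> insert q Q then M $$ p else 0) =
        mat r r (\<lambda>p. if p \<in> Q then M $$ p else 0) + M $$ q \<cdot>\<^sub>m unit_mat_at r k j"
      using insert.hyps q by (intro eq_matI) (auto simp: mat_unit_def)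
    then show ?case using insert.IH insert.prems q by (auto intro: add smult unit)
  qed
  have "mat r r (\<lambda>p. if p \<in> {..<r} \<times> {..<r} then M $$ p else 0) = M"
    using M by (intro eq_matI) auto
  then have "M \<in> G" using part[of "{..<r} \<times> {..<r}"] by simp
  then show ?thesis by (simp add: G_def)
qed

lemma inv_into_matrix_to_op:
  assumes U: "matrix_to_op S r s U" and X: "X \<in> ops_on S"
  shows "inv_into (carrier_mat r r) U X = op_mat X"
proof -
  have eq: "U M = mat_op M" if "M \<in> carrier_mat r r" for M
    using matrix_to_op_eq_mat_op[OF U that] .
  then have inj: "inj_on U (carrier_mat r r)"
    by (intro inj_onI) (metis op_mat_mat_op)
  have "U (op_mat X) = X" using eq[of "op_mat X"] mat_op_op_mat[OF X] by simp
  then show ?thesis using inv_into_f_f[OF inj, of "op_mat X"] by simp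
qed

lemma cinner_mat_op:
  "cinner (blinfun_apply (mat_op M) x) y = (\<Sum>k<r. \<Sum>j<r. M $$ (k, j) * cinner x (s j) * cinner (s k) y)"
  by (simp add: mat_op_apply cinner_sum_left cinner_scaleC_left sum_distrib_right)

lemma mat_form:
  assumes "M \<in> carrier_mat r r" "w \<in> carrier_vec r"
  shows "(M *\<^sub>v w) \<bullet>c w = (\<Sum>k<r. \<Sum>j<r. M $$ (k, j) * w $ j * cnj (w $ k))"
  using assms by (simp add: scalar_prod_def sum_distrib_right atLeast0LessThan)

text \<open>Both conditions speak about the same quadratic form: \<open>w\<close> is the coordinate vector of the
  component of \<open>x\<close> in the subspace.\<close>

lemma psd_mats_iff:
  assumes M: "M \<in> carrier_mat r r"
  shows "M \<in> psd_mats r \<longleftrightarrow> positive_op (mat_op M)"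
proof
  assume psd: "M \<in> psd_mats r"
  have "0 \<le> cinner (blinfun_apply (mat_op M) x) x" for x
  proof -
    define w where "w = vec r (\<lambda>j. cinner x (s j))"
    have "cnj (w $ k) = cinner (s k) x" if "k < r" for k
      using that cinner_commute[of "s k" x] by (simp add: w_def)
    then have "cinner (blinfun_apply (mat_op M) x) x = (M *\<^sub>v w) \<bullet>c w"
      by (subst mat_form[OF M]) (simp_all add: w_def cinner_mat_op)
    moreover have "w \<in> carrier_vec r" by (simp add: w_def)
    ultimately show ?thesis using psd by (simp add: psd_mats_def)
  qed
  then show "positive_op (mat_op M)"
    using mat_op_in_ops_on[of M] by (simp add: positive_op_def ops_on_iff)
next
  assume pos: "positive_op (mat_op M)"
  have "0 \<le> (M *\<^sub>v w) \<bullet>c w" if w: "w \<in> carrier_vec r" for w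
  proof -
    define x where "x = (\<Sum>j<r. w $ j *\<^sub>C s j)"
    have 1: "cinner x (s j) = w $ j" if "j < r" for j
      using orthonormal_on_cinner_sum[OF orthonormal, of j] that by (simp add: x_def)
    have 2: "cinner (s j) x = cnj (w $ j)" if "j < r" for j
      using 1[OF that] cinner_commute by metis
    have "(M *\<^sub>v w) \<bullet>c w = cinner (blinfun_apply (mat_op M) x) x"
      unfolding mat_form[OF M w] cinner_mat_op using 1 2 by simp
    then show ?thesis using pos by (simp add: positive_op_def)
  qed
  then show "M \<in> psd_mats r" using M by (simp add: psd_mats_def)
qed

text \<open>The compressed projection has the entries \<open>cinner (s k) e * cinner e (s j)\<close>, so pairing with it
  evaluates the form of \<open>M\<close> at \<open>e\<close>.\<close>

lemma mat_trace_mult_op_mat: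
  assumes M: "M \<in> carrier_mat r r"
  shows "mat_trace (M * op_mat (compress S (e \<otimes>\<^sub>o e))) = cinner (blinfun_apply (mat_op M) e) e"
proof -
  have entry: "op_mat (compress S (e \<otimes>\<^sub>o e)) $$ (j, k) = cinner (s k) e * cinner e (s j)"
    if "j < r" "k < r" for j k
    using that cinner_proj[of "s k" e, unfolded proj_id[OF basis_mem[OF \<open>k < r\<close>]]]
    by (simp add: op_mat_def compress_def op_simps proj_id basis_mem cinner_proj
        cinner_scaleC_left blinfun.scaleR_right bounded_opsD[OF proj_bounded_ops])
  have "mat_trace (M * op_mat (compress S (e \<otimes>\<^sub>o e))) =
      (\<Sum>k<r. \<Sum>j<r. M $$ (k, j) * op_mat (compress S (e \<otimes>\<^sub>o e)) $$ (j, k))"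
    using M by (simp add: mat_trace_def scalar_prod_def atLeast0LessThan op_mat_def)
  then show ?thesis
    by (simp add: entry cinner_mat_op mult_ac)
qed

end

section \<open>Traces and diagonals\<close>

lemma cinner_eqI: "(\<And>y. cinner a y = cinner b y) \<Longrightarrow> a = (b :: 'a :: complex_hilbert_space)"
  using cinner_eq_zero_self[of "a - b"] by (simp add: cinner_diff_left)

lemma entry_zero [simp]: "entry E 0 n = 0"
  by (simp add: entry_def)

lemma entry_add: "entry E (A + B) n = entry E A n + entry E B n"
  by (simp add: entry_def op_simps cinner_simps)

lemma entry_scaleR: "entry E (a *\<^sub>R A) n = of_real a * entry E A n"
  by (simp add: entry_def op_simps cinner_simps)

lemma entry_scale_op: "entry E (scale_op c A) n = c * entry E A n"
  by (simp add: entry_def op_simps cinner_simps)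

lemma entry_sum: "entry E (\<Sum>i\<in>I. A i) n = (\<Sum>i\<in>I. entry E (A i) n)"
  by (simp add: entry_def op_simps cinner_simps)

lemma entry_tensor_sums: "hilbert_basis E \<Longrightarrow> entry E (a \<otimes>\<^sub>o b) sums cinner a b"
  using parseval[of E a b] by (simp add: entry_def[abs_def] op_simps cinner_scaleC_left mult.commute)

lemma entry_tensor_self: "entry E (a \<otimes>\<^sub>o a) n = of_real ((cmod (cinner a (E n)))\<^sup>2)"
  unfolding entry_def by (rule cinner_tensor_self)

lemma trace_sums: "entry E A sums c \<Longrightarrow> trace E A = c"
  by (simp add: trace_def sums_iff)

lemma positive_entry: "positive_op A \<Longrightarrow> entry E A n = of_real (Re (entry E A n))"
  using positive_opD(2) by (simp add: entry_def complex_eq_iff)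

lemma trace_zero [simp]: "trace E 0 = 0"
  by (simp add: trace_def)

text \<open>A positive operator is its own absolute value.\<close>

lemma trace_class_positive: "positive_op A \<Longrightarrow> summable (entry E A) \<Longrightarrow> trace_class E A"
  unfolding trace_class_def by (auto simp: positive_op_def)

lemma compose_tensor: "A \<in> bounded_ops \<Longrightarrow> A o\<^sub>L (a \<otimes>\<^sub>o b) = blinfun_apply A a \<otimes>\<^sub>o b"
  by (rule blinfun_eqI) (simp add: op_simps bounded_opsD)

lemma tensor_compose: "self_adjoint A \<Longrightarrow> (a \<otimes>\<^sub>o b) o\<^sub>L A = a \<otimes>\<^sub>o blinfun_apply A b"
  by (rule blinfun_eqI) (simp add: op_simps self_adjointD)

lemma entry_spectral:
  "entry E (\<Sum>i\<in>I. \<alpha> i *\<^sub>R (a i \<otimes>\<^sub>o a i)) n = of_real (\<Sum>i\<in>I. \<alpha> i * (cmod (cinner (a i) (E n)))\<^sup>2)"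
  by (simp add: entry_sum entry_scaleR entry_tensor_self)

lemma entry_spectral_sums:
  assumes "hilbert_basis E" "orthonormal_on I a"
  shows "entry E (\<Sum>i\<in>I. \<alpha> i *\<^sub>R (a i \<otimes>\<^sub>o a i)) sums of_real (\<Sum>i\<in>I. \<alpha> i)"
proof -
  have "(\<lambda>n. \<Sum>i\<in>I. of_real (\<alpha> i) * entry E (a i \<otimes>\<^sub>o a i) n) sums (\<Sum>i\<in>I. of_real (\<alpha> i) * cinner (a i) (a i))"
    by (intro sums_sum sums_mult entry_tensor_sums assms)
  also have "(\<Sum>i\<in>I. of_real (\<alpha> i) * cinner (a i) (a i)) = complex_of_real (\<Sum>i\<in>I. \<alpha> i)"
    using assms(2) by (simp add: orthonormal_on_def)
  finally show ?thesis by (simp add: entry_sum[abs_def] entry_scaleR)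
qed

locale onb_subspace_trace = onb_subspace S r s
  for S :: "'a :: complex_hilbert_space set" and r :: nat and s :: "nat \<Rightarrow> 'a" +
  fixes E :: "nat \<Rightarrow> 'a"
  assumes hilbert_basis: "hilbert_basis E"
begin

lemma pos_ops_onD: "X \<in> pos_ops_on S \<Longrightarrow> positive_op X" "X \<in> pos_ops_on S \<Longrightarrow> X \<in> ops_on S"
  by (auto simp: pos_ops_on_def)

lemma pos_ops_on_zero [simp]: "0 \<in> pos_ops_on S"
  using complex_vector.subspace_0[OF subspace] by (auto simp: pos_ops_on_def ops_on_iff)

lemma pos_ops_on_scaleR:
  assumes "X \<in> pos_ops_on S" "0 \<le> c"
  shows "c *\<^sub>R X \<in> pos_ops_on S"
  using assms complex_vector.subspace_scale[OF subspace, of _ "of_real c"]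
  by (auto simp: pos_ops_on_def ops_on_iff op_simps positive_op_scaleR bounded_ops_scaleR scaleC_of_real)

lemma pos_ops_on_add:
  assumes "X \<in> pos_ops_on S" "Y \<in> pos_ops_on S"
  shows "X + Y \<in> pos_ops_on S"
  using assms complex_vector.subspace_add[OF subspace]
  by (auto simp: pos_ops_on_def ops_on_iff op_simps positive_op_add bounded_ops_add)

lemma tensor_ops_on: "x \<in> S \<Longrightarrow> x \<otimes>\<^sub>o x \<in> ops_on S"
  using complex_vector.subspace_scale[OF subspace, of x]
  by (auto simp: ops_on_iff op_simps bounded_ops_tensor cinner_proj proj_id)

lemma tensor_pos_ops_on: "x \<in> S \<Longrightarrow> x \<otimes>\<^sub>o x \<in> pos_ops_on S"
  by (simp add: pos_ops_on_def tensor_ops_on positive_op_tensor)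

lemma sum_pos_ops_on: "(\<And>i. i \<in> I \<Longrightarrow> X i \<in> pos_ops_on S) \<Longrightarrow> (\<Sum>i\<in>I. X i) \<in> pos_ops_on S"
  by (induction I rule: infinite_finite_induct) (auto intro: pos_ops_on_add)

text \<open>The trace is the sum of the eigenvalues, which are nonnegative.\<close>

lemma pos_ops_on_trace:
  assumes "X \<in> pos_ops_on S"
  obtains \<tau> where "0 \<le> \<tau>" "entry E X sums of_real \<tau>" "\<tau> = 0 \<Longrightarrow> X = 0"
proof -
  obtain a \<alpha> where a: "orthonormal_on {..<r} a" "\<forall>i<r. 0 \<le> \<alpha> i"
    and X: "X = (\<Sum>i<r. \<alpha> i *\<^sub>R (a i \<otimes>\<^sub>o a i))"
    using spectral_theorem[OF assms] by blast
  show ?thesis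
  proof (rule that[of "\<Sum>i<r. \<alpha> i"])
    show "0 \<le> (\<Sum>i<r. \<alpha> i)" using a(2) by (intro sum_nonneg) auto
    show "entry E X sums of_real (\<Sum>i<r. \<alpha> i)"
      unfolding X by (rule entry_spectral_sums[OF hilbert_basis a(1)])
    show "X = 0" if "(\<Sum>i<r. \<alpha> i) = 0"
    proof -
      have "\<forall>i\<in>{..<r}. \<alpha> i = 0"
        using that a(2) by (subst sum_nonneg_eq_0_iff[symmetric]) auto
      then show ?thesis by (simp add: X)
    qed
  qed
qed

lemma pos_ops_on_eq_zero:
  assumes "X \<in> pos_ops_on S" "\<And>n. entry E X n = 0"
  shows "X = 0"
proof -
  obtain \<tau> where \<tau>: "entry E X sums of_real \<tau>" "\<tau> = 0 \<Longrightarrow> X = 0"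
    using pos_ops_on_trace[OF assms(1)] by blast
  have "entry E X = (\<lambda>_. 0)" using assms(2) by auto
  then have "complex_of_real \<tau> = 0" using \<tau>(1) sums_zero sums_unique2 by metis
  then have "\<tau> = 0" by simp
  then show ?thesis by (rule \<tau>(2))
qed

text \<open>Taking adjoints in \<open>P Y = Y\<close> gives \<open>Y P = Y\<close>. Conversely, the spectral decomposition shows
  that the diagonal is summable.\<close>

lemma density_ops_eq: "density_ops E S = {Y \<in> pos_ops_on S. trace E Y = 1}"
proof (intro equalityI subsetI)
  fix Y assume "Y \<in> density_ops E S"
  then have Y: "proj S o\<^sub>L Y = Y" "positive_op Y" "trace E Y = 1" by (auto simp: density_ops_def)
  have PY: "blinfun_apply (proj S) (blinfun_apply Y x) = blinfun_apply Y x" for x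
    using Y(1) by (metis blinfun_apply_blinfun_compose)
  note sa = positive_op_self_adjoint[OF Y(2)]
  have "blinfun_apply Y (blinfun_apply (proj S) x) = blinfun_apply Y x" for x
    by (rule cinner_eqI) (simp add: self_adjointD(1)[OF sa] cinner_proj PY)
  then show "Y \<in> {Y \<in> pos_ops_on S. trace E Y = 1}"
    using Y PY proj_mem by (auto simp: pos_ops_on_def ops_on_iff positive_opD(3)) metis
next
  fix Y assume Y: "Y \<in> {Y \<in> pos_ops_on S. trace E Y = 1}"
  then obtain \<tau> where "entry E Y sums of_real \<tau>" using pos_ops_on_trace[of Y] by blast
  then have "trace_class E Y"
    using Y pos_ops_onD(1) by (auto intro: trace_class_positive sums_summable)
  moreover have "proj S o\<^sub>L Y = Y"
    using Y pos_ops_onD(2) by (intro blinfun_eqI) (auto simp: op_simps ops_on_iff proj_id)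
  ultimately show "Y \<in> density_ops E S"
    using Y pos_ops_onD(1) by (auto simp: density_ops_def)
qed

lemma compress_tensor: "compress S (e \<otimes>\<^sub>o e) = blinfun_apply (proj S) e \<otimes>\<^sub>o blinfun_apply (proj S) e"
  unfolding compress_def
  by (simp add: compose_tensor[OF proj_bounded_ops] tensor_compose[OF self_adjoint_proj])

lemma compress_tensor_ops_on: "compress S (e \<otimes>\<^sub>o e) \<in> ops_on S"
  unfolding compress_tensor by (rule tensor_ops_on) (rule proj_mem)

text \<open>The composition has rank one, so Parseval's identity sums its diagonal.\<close>

lemma entry_compose_compress_sums:
  assumes "A \<in> bounded_ops"
  shows "entry E (A o\<^sub>L compress S (E n \<otimes>\<^sub>o E n)) sums entry E (compress S A) n"
proof -
  have "entry E (compress S A) n =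
      cinner (blinfun_apply A (blinfun_apply (proj S) (E n))) (blinfun_apply (proj S) (E n))"
    by (simp add: entry_def compress_def op_simps cinner_proj)
  then show ?thesis
    by (simp only: compress_tensor compose_tensor[OF assms] entry_tensor_sums[OF hilbert_basis])
qed

lemma compress_ops_on: "A \<in> ops_on S \<Longrightarrow> compress S A = A"
  by (intro blinfun_eqI) (simp add: ops_on_iff compress_def op_simps proj_id)

lemma compress_pos_ops_on:
  assumes "positive_op A"
  shows "compress S A \<in> pos_ops_on S"
proof -
  have "positive_op (compress S A)"
    using assms unfolding positive_op_def
    by (auto simp: compress_def op_simps cinner_proj intro!: bounded_ops_compose proj_bounded_ops)
  then show ?thesis
    using assms by (auto simp: pos_ops_on_def ops_on_def positive_opD(3))
qed

text \<open>Testing against \<open>x \<otimes>\<^sub>o x\<close> with \<open>x\<close> in the subspace determines the quadratic form of the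
  representing operator, so it is unique.\<close>

lemma diag_rep_eq: "diag_rep E S n = compress S (E n \<otimes>\<^sub>o E n)"
  unfolding diag_rep_def
proof (rule the_equality, intro conjI ballI)
  let ?T = "compress S (E n \<otimes>\<^sub>o E n)"
  show T: "?T \<in> sa_ops_on S"
    using compress_tensor_ops_on by (simp add: sa_ops_on_def compress_tensor self_adjoint_tensor)
  show tr: "trace E (A o\<^sub>L ?T) = entry E A n" if "A \<in> sa_ops_on S" for A
    using that entry_compose_compress_sums[of A n] compress_ops_on[of A]
    by (intro trace_sums) (auto simp: sa_ops_on_def self_adjointD)
  fix T assume T': "T \<in> sa_ops_on S \<and> (\<forall>A\<in>sa_ops_on S. trace E (A o\<^sub>L T) = entry E A n)"
  have test: "cinner x (blinfun_apply T x) = cinner x (blinfun_apply ?T x)" if "x \<in> S" for x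
  proof -
    have x: "x \<otimes>\<^sub>o x \<in> sa_ops_on S"
      using that by (simp add: sa_ops_on_def tensor_ops_on self_adjoint_tensor)
    have "trace E ((x \<otimes>\<^sub>o x) o\<^sub>L Z) = cinner x (blinfun_apply Z x)" if "Z \<in> sa_ops_on S" for Z
      using that entry_tensor_sums[OF hilbert_basis]
      by (intro trace_sums) (auto simp: tensor_compose sa_ops_on_def)
    then show ?thesis using x T' T tr by metis
  qed
  have "cinner (blinfun_apply (T - ?T) x) x = 0" for x
  proof -
    let ?p = "blinfun_apply (proj S) x"
    have D: "T - ?T \<in> ops_on S" "self_adjoint (T - ?T)"
      using T T' complex_vector.subspace_diff[OF subspace]
      by (auto simp: sa_ops_on_def ops_on_iff op_simps bounded_ops_diff self_adjoint_diff)
    have "cinner (blinfun_apply (T - ?T) x) x = cinner ?p (blinfun_apply (T - ?T) ?p)"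
      using D by (metis ops_on_iff cinner_proj proj_id self_adjointD(1))
    also have "\<dots> = 0"
      using test[OF proj_mem, of x] by (simp add: blinfun.diff_left cinner_diff_right)
    finally show ?thesis .
  qed
  moreover have "T - ?T \<in> ops_on S"
    using T T' complex_vector.subspace_diff[OF subspace]
    by (auto simp: sa_ops_on_def ops_on_iff op_simps bounded_ops_diff)
  ultimately have "T - ?T \<in> pos_ops_on S" "entry E (T - ?T) k = 0" for k
    by (auto simp: pos_ops_on_def positive_op_def ops_on_iff entry_def)
  then have "T - ?T = 0" by (rule pos_ops_on_eq_zero)
  then show "T = ?T" by simp
qed

lemma entry_sums_mat_trace:
  assumes "M \<in> carrier_mat r r"
  shows "entry E (mat_op M) sums mat_trace M"
proof -
  have "entry E (mat_op M) sums (\<Sum>k<r. \<Sum>j<r. M $$ (k, j) * cinner (s k) (s j))"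
    unfolding mat_op_def entry_sum[abs_def] entry_scale_op
    by (intro sums_sum sums_mult entry_tensor_sums hilbert_basis)
  also have "(\<Sum>k<r. \<Sum>j<r. M $$ (k, j) * cinner (s k) (s j)) = (\<Sum>k<r. \<Sum>j<r. if j = k then M $$ (k, k) else 0)"
    using cinner_basis by (intro sum.cong) auto
  also have "\<dots> = mat_trace M"
    using assms by (simp add: mat_trace_def)
  finally show ?thesis .
qed

lemma psd_image: "mat_op ` {\<rho> \<in> psd_mats r. mat_trace \<rho> = 1} = density_ops E S"
proof (intro equalityI subsetI)
  fix X assume "X \<in> mat_op ` {\<rho> \<in> psd_mats r. mat_trace \<rho> = 1}"
  then obtain \<rho> where \<rho>: "\<rho> \<in> psd_mats r" "mat_trace \<rho> = 1" "X = mat_op \<rho>" by auto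
  then have c: "\<rho> \<in> carrier_mat r r" by (simp add: psd_mats_def)
  show "X \<in> density_ops E S"
    using \<rho> psd_mats_iff[OF c] mat_op_in_ops_on trace_sums[OF entry_sums_mat_trace[OF c]]
    by (simp add: density_ops_eq pos_ops_on_def)
next
  fix X assume "X \<in> density_ops E S"
  then have X: "positive_op X" "X \<in> ops_on S" "trace E X = 1"
    by (auto simp: density_ops_eq pos_ops_onD)
  then have "op_mat X \<in> psd_mats r" "mat_trace (op_mat X) = 1"
    using psd_mats_iff[of "op_mat X"] mat_op_op_mat trace_sums[OF entry_sums_mat_trace[of "op_mat X"]] by auto
  then show "X \<in> mat_op ` {\<rho> \<in> psd_mats r. mat_trace \<rho> = 1}"
    using mat_op_op_mat[OF X(2)] by (intro image_eqI[of _ _ "op_mat X"]) auto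
qed

lemma mat_joint_range_eq:
  assumes U: "matrix_to_op S r s U"
  shows "mat_joint_range r m (\<lambda>j. inv_into (carrier_mat r r) U (compress S (E j \<otimes>\<^sub>o E j))) =
    (\<lambda>X. vec m (entry E X)) ` density_ops E S"
proof -
  have "vec m (\<lambda>j. mat_trace (\<rho> * inv_into (carrier_mat r r) U (compress S (E j \<otimes>\<^sub>o E j)))) =
      vec m (entry E (mat_op \<rho>))" if "\<rho> \<in> psd_mats r" for \<rho>
    using that by (intro eq_vecI)
      (auto simp: inv_into_matrix_to_op[OF U compress_tensor_ops_on] mat_trace_mult_op_mat psd_mats_def entry_def)
  note eq = this
  let ?D = "{\<rho> \<in> psd_mats r. mat_trace \<rho> = 1}"
  have "mat_joint_range r m (\<lambda>j. inv_into (carrier_mat r r) U (compress S (E j \<otimes>\<^sub>o E j))) =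
      (\<lambda>\<rho>. vec m (\<lambda>j. mat_trace (\<rho> * inv_into (carrier_mat r r) U (compress S (E j \<otimes>\<^sub>o E j))))) ` ?D"
    by (auto simp: mat_joint_range_def)
  also have "\<dots> = (\<lambda>\<rho>. vec m (entry E (mat_op \<rho>))) ` ?D"
    by (rule image_cong[OF refl]) (rule eq, simp)
  also have "\<dots> = (\<lambda>X. vec m (entry E X)) ` density_ops E S"
    by (simp only: psd_image[symmetric] image_image)
  finally show ?thesis .
qed

text \<open>The whole space is infinite dimensional, so it contains a unit vector orthogonal to the
  subspace; the state of that vector gives \<open>0\<close> throughout.\<close>

lemma zero_in_joint_range: "0\<^sub>v m \<in> joint_range E m (\<lambda>j. compress S (E j \<otimes>\<^sub>o E j))"
proof -
  have "S \<noteq> UNIV"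
  proof
    assume UNIV: "S = UNIV"
    have on: "orthonormal_on {..<Suc r} E"
      using hilbert_basis by (auto simp: hilbert_basis_def orthonormal_on_def)
    have "card (E ` {..<Suc r}) \<le> card (s ` {..<r})"
      using complex_vector.independent_span_bound[of "s ` {..<r}" "E ` {..<Suc r}"]
        orthonormal_on_independent(2)[OF on] UNIV span_basis by simp
    also have "\<dots> \<le> r" using card_image_le[of "{..<r}" s] by simp
    finally show False using card_image[OF orthonormal_on_independent(1)[OF on]] by simp
  qed
  then obtain x where x: "x \<notin> S" by blast
  define y where "y = x - blinfun_apply (proj S) x"
  have "y \<noteq> 0" using x proj_mem[of x] by (auto simp: y_def)
  define w where "w = (1 / norm y) *\<^sub>R y"
  have w: "cinner w w = 1" using \<open>y \<noteq> 0\<close> by (simp add: cinner_self w_def)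
  have orth: "cinner w z = 0" if "z \<in> S" for z
    using cinner_residual[OF that, of x] by (simp add: w_def y_def cinner_scaleR_left)
  have "entry E (w \<otimes>\<^sub>o w) sums 1"
    using entry_tensor_sums[OF hilbert_basis, of w w] w by simp
  then have 1: "trace_class E (w \<otimes>\<^sub>o w)" "trace E (w \<otimes>\<^sub>o w) = 1"
    by (auto intro: trace_class_positive positive_op_tensor sums_summable trace_sums)
  have "trace E ((w \<otimes>\<^sub>o w) o\<^sub>L compress S (E j \<otimes>\<^sub>o E j)) = 0" for j
  proof -
    have "trace E ((w \<otimes>\<^sub>o w) o\<^sub>L compress S (E j \<otimes>\<^sub>o E j)) = entry E (compress S (w \<otimes>\<^sub>o w)) j"
      by (intro trace_sums entry_compose_compress_sums bounded_ops_tensor)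
    also have "\<dots> = 0"
      using orth[OF proj_mem] by (simp add: entry_def compress_tensor op_simps cinner_scaleC_left cinner_proj)
    finally show ?thesis .
  qed
  then have "vec m (\<lambda>j. trace E ((w \<otimes>\<^sub>o w) o\<^sub>L compress S (E j \<otimes>\<^sub>o E j))) = 0\<^sub>v m"
    by (intro eq_vecI) auto
  then show ?thesis
    unfolding joint_range_def using 1 positive_op_tensor[of w]
    by (intro CollectI exI[of _ "w \<otimes>\<^sub>o w"]) simp
qed

text \<open>The compression of a state of the whole space carries the same numbers as the state, but its
  trace may be smaller than \<open>1\<close>.\<close>

lemma joint_range_memD:
  assumes "x \<in> joint_range E m (\<lambda>j. compress S (E j \<otimes>\<^sub>o E j))"
  obtains X where "X \<in> pos_ops_on S" "x = vec m (entry E X)"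
proof -
  obtain \<rho> where \<rho>: "positive_op \<rho>" "x = vec m (\<lambda>j. trace E (\<rho> o\<^sub>L compress S (E j \<otimes>\<^sub>o E j)))"
    using assms by (auto simp: joint_range_def)
  have "trace E (\<rho> o\<^sub>L compress S (E j \<otimes>\<^sub>o E j)) = entry E (compress S \<rho>) j" for j
    by (intro trace_sums entry_compose_compress_sums positive_opD(3)[OF \<rho>(1)])
  then have "x = vec m (entry E (compress S \<rho>))" by (simp add: \<rho>(2))
  then show ?thesis using that compress_pos_ops_on[OF \<rho>(1)] by blast
qed

lemma density_in_joint_range:
  assumes "X \<in> density_ops E S"
  shows "vec m (entry E X) \<in> joint_range E m (\<lambda>j. compress S (E j \<otimes>\<^sub>o E j))"
proof -
  have X: "positive_op X" "X \<in> ops_on S" "trace E X = 1" "trace_class E X"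
    using assms pos_ops_onD density_ops_eq unfolding density_ops_def by auto
  have "trace E (X o\<^sub>L compress S (E j \<otimes>\<^sub>o E j)) = entry E X j" for j
    using entry_compose_compress_sums[OF positive_opD(3)[OF X(1)], of j] compress_ops_on[OF X(2)]
    by (intro trace_sums) simp
  then show ?thesis
    unfolding joint_range_def using X by (intro CollectI exI[of _ X]) simp
qed

end

section \<open>Comparing the diagonals of two subspaces\<close>

locale subspace_pair = S: onb_subspace_trace S r s E + V: onb_subspace_trace V t v E
  for S V :: "'a :: complex_hilbert_space set" and r t :: nat and s v E :: "nat \<Rightarrow> 'a" +
  fixes m :: nat
  assumes perp: "\<forall>x\<in>S. \<forall>y\<in>V. cinner x y = 0"
    and span: "span ((\<lambda>n. (diag_rep E S n, diag_rep E V n)) ` {..<m}) =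
       span (range (\<lambda>n. (diag_rep E S n, diag_rep E V n)))"
begin

text \<open>On the pair of operators representing the \<open>n\<close>-th entry, the real-linear functional
  \<open>(T, L) \<mapsto> tr (X T) - tr (Y L)\<close> takes the difference of the \<open>n\<close>-th entries of \<open>X\<close> and \<open>Y\<close>. It
  vanishes on all pairs once it vanishes on a spanning set. The set \<open>Z\<close> below is its kernel,
  written with convergent sums so that the traces in question exist.\<close>

lemma diagonals_agree:
  assumes X: "X \<in> pos_ops_on S" and Y: "Y \<in> pos_ops_on V"
    and eq: "\<And>j. j < m \<Longrightarrow> entry E X j = entry E Y j"
  shows "entry E X n = entry E Y n"
proof -
  define Z where "Z = {p. \<exists>c. entry E (X o\<^sub>L fst p) sums c \<and> entry E (Y o\<^sub>L snd p) sums c}"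
  have "subspace Z"
    unfolding subspace_def
  proof (intro conjI ballI allI)
    show "0 \<in> Z" by (auto simp: Z_def entry_def[abs_def])
    fix p q c assume p: "p \<in> Z"
    show "c *\<^sub>R p \<in> Z"
    proof -
      obtain d where "entry E (X o\<^sub>L fst p) sums d" "entry E (Y o\<^sub>L snd p) sums d" using p by (auto simp: Z_def)
      then have "(\<lambda>n. of_real c * entry E (X o\<^sub>L fst p) n) sums (of_real c * d)"
        "(\<lambda>n. of_real c * entry E (Y o\<^sub>L snd p) n) sums (of_real c * d)"
        by (auto intro: sums_mult)
      then show ?thesis
        unfolding Z_def by (auto simp: entry_def[abs_def] op_simps cinner_simps blinfun.scaleR_right)
    qed
    assume q: "q \<in> Z"
    show "p + q \<in> Z"
    proof -
      obtain d d' where "entry E (X o\<^sub>L fst p) sums d" "entry E (Y o\<^sub>L snd p) sums d"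
        "entry E (X o\<^sub>L fst q) sums d'" "entry E (Y o\<^sub>L snd q) sums d'" using p q by (auto simp: Z_def)
      then have "(\<lambda>n. entry E (X o\<^sub>L fst p) n + entry E (X o\<^sub>L fst q) n) sums (d + d')"
        "(\<lambda>n. entry E (Y o\<^sub>L snd p) n + entry E (Y o\<^sub>L snd q) n) sums (d + d')"
        by (auto intro: sums_add)
      then show ?thesis
        unfolding Z_def by (auto simp: entry_def[abs_def] op_simps cinner_simps blinfun.add_right)
    qed
  qed
  moreover have XT: "entry E (X o\<^sub>L diag_rep E S j) sums entry E X j" for j
    using S.entry_compose_compress_sums[of X j] X S.compress_ops_on[of X]
    by (simp add: S.diag_rep_eq S.pos_ops_onD positive_opD(3))
  have YL: "entry E (Y o\<^sub>L diag_rep E V j) sums entry E Y j" for j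
    using V.entry_compose_compress_sums[of Y j] Y V.compress_ops_on[of Y]
    by (simp add: V.diag_rep_eq V.pos_ops_onD positive_opD(3))
  have "(\<lambda>n. (diag_rep E S n, diag_rep E V n)) ` {..<m} \<subseteq> Z"
  proof (intro image_subsetI)
    fix j assume "j \<in> {..<m}"
    then show "(diag_rep E S j, diag_rep E V j) \<in> Z"
      using XT[of j] YL[of j] eq[of j] by (auto simp: Z_def)
  qed
  ultimately have "span ((\<lambda>n. (diag_rep E S n, diag_rep E V n)) ` {..<m}) \<subseteq> Z"
    using span_minimal by blast
  then have "(diag_rep E S n, diag_rep E V n) \<in> Z"
    using span span_base[of "(diag_rep E S n, diag_rep E V n)" "range (\<lambda>n. (diag_rep E S n, diag_rep E V n))"]
    by blast
  then obtain c where "entry E (X o\<^sub>L diag_rep E S n) sums c" "entry E (Y o\<^sub>L diag_rep E V n) sums c"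
    by (auto simp: Z_def)
  then show ?thesis using XT[of n] YL[of n] sums_unique2 by metis
qed

lemma moments_meet_iff_density:
  "moment E S \<inter> moment E V \<noteq> {} \<longleftrightarrow>
    (\<exists>X\<in>density_ops E S. \<exists>Y\<in>density_ops E V. \<forall>j<m. entry E X j = entry E Y j)"
proof
  assume "moment E S \<inter> moment E V \<noteq> {}"
  then obtain X Y where XY: "X \<in> density_ops E S" "Y \<in> density_ops E V"
    "\<And>n. Re (entry E X n) = Re (entry E Y n)"
    by (auto simp: moment_def dest: fun_cong)
  then have "entry E X n = entry E Y n" for n
    using positive_entry[of X E n] positive_entry[of Y E n] by (simp add: density_ops_def)
  then show "\<exists>X\<in>density_ops E S. \<exists>Y\<in>density_ops E V. \<forall>j<m. entry E X j = entry E Y j"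
    using XY by blast
next
  assume "\<exists>X\<in>density_ops E S. \<exists>Y\<in>density_ops E V. \<forall>j<m. entry E X j = entry E Y j"
  then obtain X Y where XY: "X \<in> density_ops E S" "Y \<in> density_ops E V" "\<forall>j<m. entry E X j = entry E Y j"
    by blast
  have "entry E X n = entry E Y n" for n
    by (rule diagonals_agree[of X Y]) (use XY in \<open>auto simp: S.density_ops_eq V.density_ops_eq\<close>)
  then have "(\<lambda>n. Re (entry E X n)) = (\<lambda>n. Re (entry E Y n))" by simp
  moreover have "(\<lambda>n. Re (entry E X n)) \<in> moment E S" "(\<lambda>n. Re (entry E Y n)) \<in> moment E V"
    unfolding moment_def using XY by blast+
  ultimately have "(\<lambda>n. Re (entry E X n)) \<in> moment E S" "(\<lambda>n. Re (entry E X n)) \<in> moment E V"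
    by simp_all
  then show "moment E S \<inter> moment E V \<noteq> {}" by blast
qed

text \<open>Equal diagonals give equal traces, so two positive operators that are not both zero can be
  normalised by the same factor.\<close>

lemma moments_meet_iff_positive:
  "moment E S \<inter> moment E V \<noteq> {} \<longleftrightarrow>
    (\<exists>X\<in>pos_ops_on S. \<exists>Y\<in>pos_ops_on V. (X \<noteq> 0 \<or> Y \<noteq> 0) \<and> (\<forall>j<m. entry E X j = entry E Y j))"
proof
  assume "moment E S \<inter> moment E V \<noteq> {}"
  then obtain X Y where XY: "X \<in> density_ops E S" "Y \<in> density_ops E V" "\<forall>j<m. entry E X j = entry E Y j"
    unfolding moments_meet_iff_density by blast
  moreover have "X \<noteq> 0" using XY(1) by (auto simp: density_ops_def)
  ultimately show "\<exists>X\<in>pos_ops_on S. \<exists>Y\<in>pos_ops_on V. (X \<noteq> 0 \<or> Y \<noteq> 0) \<and> (\<forall>j<m. entry E X j = entry E Y j)"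
    unfolding S.density_ops_eq V.density_ops_eq by blast
next
  assume "\<exists>X\<in>pos_ops_on S. \<exists>Y\<in>pos_ops_on V. (X \<noteq> 0 \<or> Y \<noteq> 0) \<and> (\<forall>j<m. entry E X j = entry E Y j)"
  then obtain X Y where XY: "X \<in> pos_ops_on S" "Y \<in> pos_ops_on V" "X \<noteq> 0 \<or> Y \<noteq> 0"
    "\<And>j. j < m \<Longrightarrow> entry E X j = entry E Y j" by blast
  obtain \<tau> where \<tau>: "0 \<le> \<tau>" "entry E X sums of_real \<tau>" "\<tau> = 0 \<Longrightarrow> X = 0"
    using S.pos_ops_on_trace[OF XY(1)] by metis
  obtain \<tau>' where \<tau>': "entry E Y sums of_real \<tau>'" "\<tau>' = 0 \<Longrightarrow> Y = 0"
    using V.pos_ops_on_trace[OF XY(2)] by blast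
  have "entry E X = entry E Y"
    by (rule ext) (rule diagonals_agree[OF XY(1,2,4)])
  then have "complex_of_real \<tau> = of_real \<tau>'"
    using \<tau>(2) \<tau>'(1) sums_unique2 by metis
  then have pos: "\<tau> > 0" using XY(3) \<tau> \<tau>' by force
  have tr: "trace E ((1 / \<tau>) *\<^sub>R Z) = 1" if "entry E Z sums of_real \<tau>" for Z
  proof (rule trace_sums)
    have "(\<lambda>n. of_real (1 / \<tau>) * entry E Z n) sums (of_real (1 / \<tau>) * of_real \<tau>)"
      using that by (rule sums_mult)
    then show "entry E ((1 / \<tau>) *\<^sub>R Z) sums 1"
      using pos by (simp add: entry_scaleR[abs_def])
  qed
  have "(1 / \<tau>) *\<^sub>R X \<in> density_ops E S" "(1 / \<tau>) *\<^sub>R Y \<in> density_ops E V"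
    using XY pos tr[OF \<tau>(2)] tr[of Y] \<tau>(2) \<open>entry E X = entry E Y\<close>
    by (auto simp: S.density_ops_eq V.density_ops_eq intro!: S.pos_ops_on_scaleR V.pos_ops_on_scaleR)
  moreover have "\<forall>j<m. entry E ((1 / \<tau>) *\<^sub>R X) j = entry E ((1 / \<tau>) *\<^sub>R Y) j"
    using XY(4) by (simp add: entry_scaleR)
  ultimately show "moment E S \<inter> moment E V \<noteq> {}"
    unfolding moments_meet_iff_density by blast
qed

text \<open>Comparison with the zero operator on the other subspace: the first \<open>m\<close> entries already detect
  whether a positive operator is zero.\<close>

lemma first_entries_eq_zero:
  assumes "X \<in> pos_ops_on S" "\<And>j. j < m \<Longrightarrow> entry E X j = 0"
  shows "X = 0"
proof (rule S.pos_ops_on_eq_zero[OF assms(1)])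
  fix n
  show "entry E X n = 0"
    using diagonals_agree[OF assms(1) V.pos_ops_on_zero, of n] assms(2) by simp
qed

lemma moments_meet_iff_first_terms:
  "moment E S \<inter> moment E V \<noteq> {} \<longleftrightarrow> first_terms m ` moment E S \<inter> first_terms m ` moment E V \<noteq> {}"
proof
  assume "moment E S \<inter> moment E V \<noteq> {}"
  then show "first_terms m ` moment E S \<inter> first_terms m ` moment E V \<noteq> {}" by blast
next
  assume "first_terms m ` moment E S \<inter> first_terms m ` moment E V \<noteq> {}"
  then obtain X Y where XY: "X \<in> density_ops E S" "Y \<in> density_ops E V"
    and eq: "vec m (\<lambda>n. Re (entry E X n)) = vec m (\<lambda>n. Re (entry E Y n))"
    by (auto simp: moment_def first_terms_def)
  have "entry E X j = entry E Y j" if "j < m" for j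
  proof -
    have "Re (entry E X j) = Re (entry E Y j)"
      using arg_cong[OF eq, of "\<lambda>w. w $ j"] that by simp
    then show ?thesis
      using positive_entry[of X E j] positive_entry[of Y E j] XY by (simp add: density_ops_def)
  qed
  then show "moment E S \<inter> moment E V \<noteq> {}"
    unfolding moments_meet_iff_density using XY by blast
qed

lemma moments_meet_iff_psd_matrices:
  assumes US: "matrix_to_op S r s US" and UV: "matrix_to_op V t v UV"
  shows "moment E S \<inter> moment E V \<noteq> {} \<longleftrightarrow>
        (\<exists>M N. \<exists>X\<in>pos_ops_on S. \<exists>Y\<in>pos_ops_on V.
           (M, N) = (inv_into (carrier_mat r r) US X, inv_into (carrier_mat t t) UV Y) \<and>
           (M, N) \<in> psd_mats r \<times> psd_mats t \<and> (M, N) \<noteq> (0\<^sub>m r r, 0\<^sub>m t t) \<and>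
           (\<forall>j<m. entry E X j = entry E Y j))"
proof -
  have psdS: "S.op_mat X \<in> psd_mats r" and zS: "S.op_mat X = 0\<^sub>m r r \<longleftrightarrow> X = 0" if "X \<in> pos_ops_on S" for X
  proof -
    note X = S.pos_ops_onD[OF that]
    show "S.op_mat X \<in> psd_mats r"
      using X S.psd_mats_iff[of "S.op_mat X"] S.mat_op_op_mat by simp
    have "S.mat_op (0\<^sub>m r r) = 0" by (rule blinfun_eqI) (simp add: S.mat_op_apply)
    moreover have "S.op_mat 0 = 0\<^sub>m r r" by (intro eq_matI) (auto simp: S.op_mat_def)
    ultimately show "S.op_mat X = 0\<^sub>m r r \<longleftrightarrow> X = 0" using S.mat_op_op_mat[OF X(2)] by metis
  qed
  have psdV: "V.op_mat X \<in> psd_mats t" and zV: "V.op_mat X = 0\<^sub>m t t \<longleftrightarrow> X = 0" if "X \<in> pos_ops_on V" for X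
  proof -
    note X = V.pos_ops_onD[OF that]
    show "V.op_mat X \<in> psd_mats t"
      using X V.psd_mats_iff[of "V.op_mat X"] V.mat_op_op_mat by simp
    have "V.mat_op (0\<^sub>m t t) = 0" by (rule blinfun_eqI) (simp add: V.mat_op_apply)
    moreover have "V.op_mat 0 = 0\<^sub>m t t" by (intro eq_matI) (auto simp: V.op_mat_def)
    ultimately show "V.op_mat X = 0\<^sub>m t t \<longleftrightarrow> X = 0" using V.mat_op_op_mat[OF X(2)] by metis
  qed
  have inv: "inv_into (carrier_mat r r) US X = S.op_mat X" "inv_into (carrier_mat t t) UV Y = V.op_mat Y"
    if "X \<in> pos_ops_on S" "Y \<in> pos_ops_on V" for X Y
    using that S.inv_into_matrix_to_op[OF US] V.inv_into_matrix_to_op[OF UV]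
    by (auto simp: S.pos_ops_onD V.pos_ops_onD)
  have eqv: "(X \<noteq> 0 \<or> Y \<noteq> 0) \<and> (\<forall>j<m. entry E X j = entry E Y j) \<longleftrightarrow>
      (\<exists>M N. (M, N) = (inv_into (carrier_mat r r) US X, inv_into (carrier_mat t t) UV Y) \<and>
           (M, N) \<in> psd_mats r \<times> psd_mats t \<and> (M, N) \<noteq> (0\<^sub>m r r, 0\<^sub>m t t) \<and>
           (\<forall>j<m. entry E X j = entry E Y j))"
    if "X \<in> pos_ops_on S" "Y \<in> pos_ops_on V" for X Y
    using psdS[OF that(1)] psdV[OF that(2)] zS[OF that(1)] zV[OF that(2)] by (simp add: inv[OF that])
  have "moment E S \<inter> moment E V \<noteq> {} \<longleftrightarrow> (\<exists>X\<in>pos_ops_on S. \<exists>Y\<in>pos_ops_on V.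
      (\<exists>M N. (M, N) = (inv_into (carrier_mat r r) US X, inv_into (carrier_mat t t) UV Y) \<and>
           (M, N) \<in> psd_mats r \<times> psd_mats t \<and> (M, N) \<noteq> (0\<^sub>m r r, 0\<^sub>m t t) \<and>
           (\<forall>j<m. entry E X j = entry E Y j)))"
    unfolding moments_meet_iff_positive by (intro bex_cong refl eqv)
  then show ?thesis by blast
qed

text \<open>Both ranges contain \<open>0\<close>, so the right-hand side asks for a common nonzero vector, that is, for
  two nonzero positive operators with the same first entries.\<close>

lemma moments_meet_iff_joint_range:
  "moment E S \<inter> moment E V \<noteq> {} \<longleftrightarrow>
        joint_range E m (\<lambda>j. compress S (E j \<otimes>\<^sub>o E j)) \<inter>
        joint_range E m (\<lambda>j. compress V (E j \<otimes>\<^sub>o E j)) \<noteq> {0\<^sub>v m}" (is "_ \<longleftrightarrow> ?A \<inter> ?B \<noteq> _")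
proof
  assume "moment E S \<inter> moment E V \<noteq> {}"
  then obtain X Y where XY: "X \<in> density_ops E S" "Y \<in> density_ops E V" "\<forall>j<m. entry E X j = entry E Y j"
    unfolding moments_meet_iff_density by blast
  have "vec m (entry E X) = vec m (entry E Y)" using XY(3) by (intro eq_vecI) auto
  then have mem: "vec m (entry E X) \<in> ?A \<inter> ?B"
    using S.density_in_joint_range[OF XY(1), of m] V.density_in_joint_range[OF XY(2), of m] by simp
  have "X \<noteq> 0" using XY(1) by (auto simp: density_ops_def)
  then obtain j where "j < m" "entry E X j \<noteq> 0"
    using first_entries_eq_zero XY(1) S.density_ops_eq by auto
  then have "vec m (entry E X) \<noteq> 0\<^sub>v m" by (metis index_vec index_zero_vec(1))
  then show "?A \<inter> ?B \<noteq> {0\<^sub>v m}" using mem by blast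
next
  assume "?A \<inter> ?B \<noteq> {0\<^sub>v m}"
  then obtain x where x: "x \<in> ?A" "x \<in> ?B" "x \<noteq> 0\<^sub>v m"
    using S.zero_in_joint_range[of m] V.zero_in_joint_range[of m] by blast
  obtain X where X: "X \<in> pos_ops_on S" "x = vec m (entry E X)" using S.joint_range_memD[OF x(1)] by metis
  obtain Y where Y: "Y \<in> pos_ops_on V" "x = vec m (entry E Y)" using V.joint_range_memD[OF x(2)] by metis
  have "X \<noteq> 0" using x(3) X(2) by auto
  moreover have "entry E X j = entry E Y j" if "j < m" for j
    using X(2) Y(2) that by (metis index_vec)
  ultimately show "moment E S \<inter> moment E V \<noteq> {}"
    unfolding moments_meet_iff_positive using X(1) Y(1) by blast
qed

lemma moments_meet_iff_mat_joint_range: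
  assumes US: "matrix_to_op S r s US" and UV: "matrix_to_op V t v UV"
  shows "moment E S \<inter> moment E V \<noteq> {} \<longleftrightarrow>
        \<not> mat_joint_range r m (\<lambda>j. inv_into (carrier_mat r r) US (compress S (E j \<otimes>\<^sub>o E j))) \<inter>
          mat_joint_range t m (\<lambda>j. inv_into (carrier_mat t t) UV (compress V (E j \<otimes>\<^sub>o E j)))
            \<subseteq> {0\<^sub>v m}"
  unfolding S.mat_joint_range_eq[OF US] V.mat_joint_range_eq[OF UV]
proof
  assume "moment E S \<inter> moment E V \<noteq> {}"
  then obtain X Y where XY: "X \<in> density_ops E S" "Y \<in> density_ops E V" "\<forall>j<m. entry E X j = entry E Y j"
    unfolding moments_meet_iff_density by blast
  have "vec m (entry E X) = vec m (entry E Y)" using XY(3) by (intro eq_vecI) auto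
  then have mem: "vec m (entry E X) \<in> (\<lambda>X. vec m (entry E X)) ` density_ops E S \<inter> (\<lambda>X. vec m (entry E X)) ` density_ops E V"
    using imageI[OF XY(1), of "\<lambda>X. vec m (entry E X)"] imageI[OF XY(2), of "\<lambda>X. vec m (entry E X)"] by simp
  have "X \<noteq> 0" using XY(1) by (auto simp: density_ops_def)
  then obtain j where "j < m" "entry E X j \<noteq> 0"
    using first_entries_eq_zero XY(1) S.density_ops_eq by auto
  then have "vec m (entry E X) \<noteq> 0\<^sub>v m" by (metis index_vec index_zero_vec(1))
  then show "\<not> (\<lambda>X. vec m (entry E X)) ` density_ops E S \<inter> (\<lambda>X. vec m (entry E X)) ` density_ops E V \<subseteq> {0\<^sub>v m}"
    using mem by blast
next
  assume "\<not> (\<lambda>X. vec m (entry E X)) ` density_ops E S \<inter> (\<lambda>X. vec m (entry E X)) ` density_ops E V \<subseteq> {0\<^sub>v m}"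
  then obtain X Y where "X \<in> density_ops E S" "Y \<in> density_ops E V" "vec m (entry E X) = vec m (entry E Y)"
    by blast
  then show "moment E S \<inter> moment E V \<noteq> {}"
    unfolding moments_meet_iff_density by (metis index_vec)
qed

text \<open>The spectral decompositions of two density operators with the same diagonal are the required
  orthonormal families and weights.\<close>

lemma moments_meet_iff_forms_support: "moment E S \<inter> moment E V \<noteq> {} \<longleftrightarrow> forms_support E S V"
proof
  assume "moment E S \<inter> moment E V \<noteq> {}"
  then obtain X Y where XY: "X \<in> density_ops E S" "Y \<in> density_ops E V" "\<forall>j<m. entry E X j = entry E Y j"
    unfolding moments_meet_iff_density by blast
  then have X: "X \<in> pos_ops_on S" "trace E X = 1" and Y: "Y \<in> pos_ops_on V" "trace E Y = 1"
    by (auto simp: S.density_ops_eq V.density_ops_eq)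
  obtain a \<alpha> where a: "orthonormal_on {..<r} a" "a ` {..<r} \<subseteq> S" "\<forall>i<r. 0 \<le> \<alpha> i"
    and Xa: "X = (\<Sum>i<r. \<alpha> i *\<^sub>R (a i \<otimes>\<^sub>o a i))"
    using S.spectral_theorem[OF X(1)] by blast
  obtain b \<beta> where b: "orthonormal_on {..<t} b" "b ` {..<t} \<subseteq> V" "\<forall>i<t. 0 \<le> \<beta> i"
    and Yb: "Y = (\<Sum>i<t. \<beta> i *\<^sub>R (b i \<otimes>\<^sub>o b i))"
    using V.spectral_theorem[OF Y(1)] by blast
  have "complex_of_real (\<Sum>i<r. \<alpha> i) = 1"
    using trace_sums[OF entry_spectral_sums[OF S.hilbert_basis a(1), of \<alpha>]] X(2) Xa by simp
  then have "(\<Sum>i<r. \<alpha> i) = 1" by (simp only: of_real_eq_1_iff)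
  moreover have "complex_of_real (\<Sum>i<t. \<beta> i) = 1"
    using trace_sums[OF entry_spectral_sums[OF S.hilbert_basis b(1), of \<beta>]] Y(2) Yb by simp
  then have "(\<Sum>i<t. \<beta> i) = 1" by (simp only: of_real_eq_1_iff)
  moreover have "(\<Sum>i<r. \<alpha> i * (cmod (cinner (a i) (E n)))\<^sup>2) =
             (\<Sum>j<t. \<beta> j * (cmod (cinner (b j) (E n)))\<^sup>2)" for n
    using diagonals_agree[OF X(1) Y(1), of n] XY(3)
    by (simp only: Xa Yb entry_spectral of_real_eq_iff)
  ultimately show "forms_support E S V"
    unfolding forms_support_def Let_def S.dim V.dim using a b by blast
next
  assume "forms_support E S V"
  then obtain a b \<alpha> \<beta> where a: "orthonormal_on {..<r} a" "a ` {..<r} \<subseteq> S" "\<forall>i<r. 0 \<le> \<alpha> i" "(\<Sum>i<r. \<alpha> i) = 1"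
    and b: "orthonormal_on {..<t} b" "b ` {..<t} \<subseteq> V" "\<forall>i<t. 0 \<le> \<beta> i" "(\<Sum>i<t. \<beta> i) = 1"
    and eq: "\<forall>n. (\<Sum>i<r. \<alpha> i * (cmod (cinner (a i) (E n)))\<^sup>2) =
             (\<Sum>j<t. \<beta> j * (cmod (cinner (b j) (E n)))\<^sup>2)"
    unfolding forms_support_def Let_def S.dim V.dim by blast
  define X where "X = (\<Sum>i<r. \<alpha> i *\<^sub>R (a i \<otimes>\<^sub>o a i))"
  define Y where "Y = (\<Sum>i<t. \<beta> i *\<^sub>R (b i \<otimes>\<^sub>o b i))"
  have "X \<in> density_ops E S"
    unfolding S.density_ops_eq X_def
    using a trace_sums[OF entry_spectral_sums[OF S.hilbert_basis a(1), of \<alpha>]]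
    by (auto intro!: S.sum_pos_ops_on S.pos_ops_on_scaleR S.tensor_pos_ops_on)
  moreover have "Y \<in> density_ops E V"
    unfolding V.density_ops_eq Y_def
    using b trace_sums[OF entry_spectral_sums[OF S.hilbert_basis b(1), of \<beta>]]
    by (auto intro!: V.sum_pos_ops_on V.pos_ops_on_scaleR V.tensor_pos_ops_on)
  moreover have "entry E X n = entry E Y n" for n
    using eq by (simp add: X_def Y_def entry_spectral)
  ultimately show "moment E S \<inter> moment E V \<noteq> {}"
    unfolding moments_meet_iff_density by blast
qed

end

section \<open>Minimality from equal diagonals\<close>

lemma diagonal_op_basis:
  assumes E: "hilbert_basis E" and D: "diagonal_op E D"
  shows "blinfun_apply D (E n) = entry E D n *\<^sub>C E n"
proof -
  have "(\<lambda>k. cinner (blinfun_apply D (E n)) (E k) *\<^sub>C E k) sums blinfun_apply D (E n)"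
    by (rule hilbert_basis_expansion[OF E])
  moreover have "(\<lambda>k. cinner (blinfun_apply D (E n)) (E k) *\<^sub>C E k) = (\<lambda>k. if k = n then entry E D n *\<^sub>C E n else 0)"
    using D by (auto simp: diagonal_op_def entry_def)
  ultimately show ?thesis
    using sums_single[of n "\<lambda>_. entry E D n *\<^sub>C E n"] sums_unique2 by metis
qed

lemma diagonal_op_form_sums:
  assumes E: "hilbert_basis E" and D: "diagonal_op E D"
  shows "(\<lambda>n. entry E D n * of_real ((cmod (cinner x (E n)))\<^sup>2)) sums cinner (blinfun_apply D x) x"
proof -
  have "(\<lambda>n. blinfun_apply D (cinner x (E n) *\<^sub>C E n)) sums blinfun_apply D x"
    by (rule bounded_linear.sums[OF blinfun.bounded_linear_right hilbert_basis_expansion[OF E]])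
  from bounded_linear.sums[OF bounded_linear_cinner_left this]
  have "(\<lambda>n. cinner (blinfun_apply D (cinner x (E n) *\<^sub>C E n)) x) sums cinner (blinfun_apply D x) x" .
  moreover have "cinner (blinfun_apply D (cinner x (E n) *\<^sub>C E n)) x = entry E D n * of_real ((cmod (cinner x (E n)))\<^sup>2)" for n
  proof -
    have "cinner (blinfun_apply D (cinner x (E n) *\<^sub>C E n)) x = entry E D n * (cinner x (E n) * cinner (E n) x)"
      using D by (simp add: diagonal_op_def bounded_opsD diagonal_op_basis[OF E D] cinner_scaleC_left)
    then show ?thesis by (simp only: cinner_mult_cnj_self)
  qed
  ultimately show ?thesis by simp
qed

text \<open>Each side is the trace of \<open>D\<close> against a weighted sum of operators \<open>a i \<otimes>\<^sub>o a i\<close>, and for diagonal \<open>D\<close>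
  this trace depends only on the diagonal of that sum.\<close>

lemma diagonal_op_mean_eq:
  fixes \<alpha> \<beta> :: "nat \<Rightarrow> real" and r t :: nat
  assumes E: "hilbert_basis E" and D: "diagonal_op E D"
    and eq: "\<forall>n. (\<Sum>i<r. \<alpha> i * (cmod (cinner (a i) (E n)))\<^sup>2) =
             (\<Sum>j<t. \<beta> j * (cmod (cinner (b j) (E n)))\<^sup>2)"
  shows "(\<Sum>i<r. of_real (\<alpha> i) * cinner (blinfun_apply D (a i)) (a i)) =
    (\<Sum>j<t. of_real (\<beta> j) * cinner (blinfun_apply D (b j)) (b j))"
proof -
  have form: "(\<lambda>n. entry E D n * of_real (\<Sum>i<k. \<gamma> i * (cmod (cinner (c i) (E n)))\<^sup>2)) sums
      (\<Sum>i<k. of_real (\<gamma> i) * cinner (blinfun_apply D (c i)) (c i))"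
    for \<gamma> :: "nat \<Rightarrow> real" and c and k :: nat
  proof -
    have "(\<lambda>n. \<Sum>i<k. of_real (\<gamma> i) * (entry E D n * of_real ((cmod (cinner (c i) (E n)))\<^sup>2))) sums
      (\<Sum>i<k. of_real (\<gamma> i) * cinner (blinfun_apply D (c i)) (c i))"
      by (intro sums_sum sums_mult diagonal_op_form_sums E D)
    then show ?thesis by (simp add: sum_distrib_left mult_ac)
  qed
  show ?thesis
    by (rule sums_unique2[OF form[of \<alpha> a r, unfolded eq[rule_format]] form[of \<beta> b t]])
qed

lemma Re_cinner_le: "Re (cinner (blinfun_apply B x) y) \<le> norm B * norm x * norm y"
proof -
  have "Re (cinner (blinfun_apply B x) y) \<le> norm (blinfun_apply B x) * norm y"
    using complex_Re_le_cmod cmod_cinner_le order_trans by blast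
  also have "\<dots> \<le> norm B * norm x * norm y"
    by (intro mult_right_mono norm_blinfun) simp
  finally show ?thesis .
qed

context subspace_pair
begin

lemma proj_V_S: "x \<in> S \<Longrightarrow> blinfun_apply (proj V) x = 0"
  using perp V.basis_mem by (simp add: V.proj_apply)

lemma proj_S_V: "x \<in> V \<Longrightarrow> blinfun_apply (proj S) x = 0"
proof -
  assume "x \<in> V"
  then have "cinner x (s i) = 0" if "i < r" for i
    using perp S.basis_mem[OF that] cinner_zero_commute by blast
  then show ?thesis by (simp add: S.proj_apply)
qed

text \<open>The two projections and \<open>R\<close> act on mutually orthogonal parts of a vector and have mutually
  orthogonal ranges, so the norm is at most the largest of the three norms.\<close>

lemma norm_pair_le:
  assumes R: "self_adjoint R" "R o\<^sub>L proj S = 0" "R o\<^sub>L proj V = 0" and l: "l > 0" "norm R \<le> l"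
  shows "norm (l *\<^sub>R (proj S - proj V) + R) \<le> l"
proof (rule norm_blinfun_bound)
  show "0 \<le> l" using l by simp
  fix x
  let ?p = "blinfun_apply (proj S) x" and ?q = "blinfun_apply (proj V) x"
  define z where "z = x - ?p - ?q"
  have R0: "blinfun_apply R y = 0" if "y \<in> S \<or> y \<in> V" for y
    using that R(2,3) S.proj_id V.proj_id by (metis blinfun_apply_blinfun_compose zero_blinfun.rep_eq)
  have pq: "?p \<in> S" "?q \<in> V" by (rule S.proj_mem, rule V.proj_mem)
  have Rz: "blinfun_apply R x = blinfun_apply R z"
    using pq by (simp add: z_def blinfun.diff_right R0)
  have perp_pq: "cinner ?p ?q = 0" using perp pq by blast
  have perp_z: "cinner (?p + ?q) z = 0"
  proof -
    have "cinner z y = 0" if "y \<in> S" for y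
      using S.cinner_residual[OF that, of x] perp that pq cinner_zero_commute[of y ?q]
      by (simp add: z_def cinner_diff_left)
    moreover have "cinner z y = 0" if "y \<in> V" for y
      using V.cinner_residual[OF that, of x] perp that pq
      by (simp add: z_def cinner_diff_left)
    ultimately have "cinner z (?p + ?q) = 0" using pq by (simp add: cinner_add_right)
    then show ?thesis by (subst cinner_zero_commute)
  qed
  have "x = (?p + ?q) + z" by (simp add: z_def)
  then have nx: "(norm x)\<^sup>2 = (norm ?p)\<^sup>2 + (norm ?q)\<^sup>2 + (norm z)\<^sup>2"
    using pythagoras[OF perp_z] pythagoras[OF perp_pq] by metis
  have perp_R: "cinner (l *\<^sub>R ?p - l *\<^sub>R ?q) (blinfun_apply R x) = 0"
    using pq by (simp add: self_adjointD(1)[OF R(1), symmetric] R0 blinfun.diff_right blinfun.scaleR_right)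
  have "blinfun_apply (l *\<^sub>R (proj S - proj V) + R) x = (l *\<^sub>R ?p - l *\<^sub>R ?q) + blinfun_apply R x"
    by (simp add: op_simps scaleR_diff_right)
  then have "(norm (blinfun_apply (l *\<^sub>R (proj S - proj V) + R) x))\<^sup>2 =
      (norm (l *\<^sub>R ?p - l *\<^sub>R ?q))\<^sup>2 + (norm (blinfun_apply R x))\<^sup>2"
    using pythagoras[OF perp_R] by simp
  also have "(norm (l *\<^sub>R ?p - l *\<^sub>R ?q))\<^sup>2 = l\<^sup>2 * (norm ?p)\<^sup>2 + l\<^sup>2 * (norm ?q)\<^sup>2"
    using pythagoras[of "l *\<^sub>R ?p" "- (l *\<^sub>R ?q)"] perp_pq
    by (simp add: cinner_simps power_mult_distrib)
  also have "(norm (blinfun_apply R x))\<^sup>2 \<le> (l * norm z)\<^sup>2"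
    unfolding Rz
    by (intro power_mono order_trans[OF norm_blinfun] mult_right_mono l) auto
  finally have "(norm (blinfun_apply (l *\<^sub>R (proj S - proj V) + R) x))\<^sup>2 \<le> (l * norm x)\<^sup>2"
    by (simp add: power_mult_distrib nx algebra_simps)
  then show "norm (blinfun_apply (l *\<^sub>R (proj S - proj V) + R) x) \<le> l * norm x"
    by (rule power2_le_imp_le) (use l in simp)
qed

text \<open>Let \<open>X\<close> and \<open>Y\<close> be the two density operators of the support. Then \<open>tr ((A + D) (X - Y))\<close> is
  \<open>2 l\<close> for every diagonal \<open>D\<close>, because \<open>D\<close> cancels, while it is at most twice the norm of
  \<open>A + D\<close>.\<close>

lemma minimal_if_support:
  assumes supp: "forms_support E S V"
    and R: "self_adjoint R" "R o\<^sub>L proj S = 0" "R o\<^sub>L proj V = 0" and l: "l > 0" "norm R \<le> l"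
  shows "minimal_op E (l *\<^sub>R (proj S - proj V) + R)" (is "minimal_op E ?A")
  unfolding minimal_op_def
proof (intro conjI allI impI)
  show A: "?A \<in> bounded_ops"
    by (intro bounded_ops_add bounded_ops_scaleR bounded_ops_diff S.proj_bounded_ops V.proj_bounded_ops
        self_adjointD(2)[OF R(1)])
  fix D assume D: "diagonal_op E D"
  obtain a b \<alpha> \<beta> where a: "orthonormal_on {..<r} a" "a ` {..<r} \<subseteq> S" "\<forall>i<r. 0 \<le> \<alpha> i" "(\<Sum>i<r. \<alpha> i) = 1"
    and b: "orthonormal_on {..<t} b" "b ` {..<t} \<subseteq> V" "\<forall>i<t. 0 \<le> \<beta> i" "(\<Sum>i<t. \<beta> i) = 1"
    and eq: "\<forall>n. (\<Sum>i<r. \<alpha> i * (cmod (cinner (a i) (E n)))\<^sup>2) =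
             (\<Sum>j<t. \<beta> j * (cmod (cinner (b j) (E n)))\<^sup>2)"
    using supp unfolding forms_support_def Let_def S.dim V.dim by blast
  define N where "N = norm (?A + D)"
  have R0: "blinfun_apply R y = 0" if "y \<in> S \<or> y \<in> V" for y
    using that R(2,3) S.proj_id V.proj_id by (metis blinfun_apply_blinfun_compose zero_blinfun.rep_eq)
  have SA: "l + Re (cinner (blinfun_apply D (a i)) (a i)) \<le> N" if "i < r" for i
  proof -
    have ai: "a i \<in> S" "norm (a i) = 1" using a that orthonormal_on_norm[OF a(1)] by auto
    have "cinner (blinfun_apply (?A + D) (a i)) (a i) = l + cinner (blinfun_apply D (a i)) (a i)"
      using ai by (simp add: op_simps S.proj_id proj_V_S R0 cinner_simps cinner_self)
    then show ?thesis using Re_cinner_le[of "?A + D" "a i" "a i"] ai by (simp add: N_def)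
  qed
  have VA: "l - Re (cinner (blinfun_apply D (b i)) (b i)) \<le> N" if "i < t" for i
  proof -
    have bi: "b i \<in> V" "norm (b i) = 1" using b that orthonormal_on_norm[OF b(1)] by auto
    have "cinner (blinfun_apply (?A + D) (b i)) (- b i) = l - cinner (blinfun_apply D (b i)) (b i)"
      using bi by (simp add: op_simps V.proj_id proj_S_V R0 cinner_simps cinner_self)
    then show ?thesis using Re_cinner_le[of "?A + D" "b i" "- b i"] bi by (simp add: N_def)
  qed
  define T where "T = Re (\<Sum>i<r. of_real (\<alpha> i) * cinner (blinfun_apply D (a i)) (a i))"
  have T': "T = Re (\<Sum>i<t. of_real (\<beta> i) * cinner (blinfun_apply D (b i)) (b i))"
    unfolding T_def using diagonal_op_mean_eq[OF S.hilbert_basis D eq] by simp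
  have "(\<Sum>i<r. \<alpha> i * (l + Re (cinner (blinfun_apply D (a i)) (a i)))) \<le> (\<Sum>i<r. \<alpha> i * N)"
    using a(3) SA by (intro sum_mono mult_left_mono) auto
  then have "l + T \<le> N"
    using a(4) by (simp add: T_def distrib_left sum.distrib sum_distrib_right[symmetric])
  moreover have "(\<Sum>i<t. \<beta> i * (l - Re (cinner (blinfun_apply D (b i)) (b i)))) \<le> (\<Sum>i<t. \<beta> i * N)"
    using b(3) VA by (intro sum_mono mult_left_mono) auto
  then have "l - T \<le> N"
    using b(4) by (simp add: T' right_diff_distrib sum_subtractf sum_distrib_right[symmetric])
  ultimately have "l \<le> N" by simp
  then show "norm ?A \<le> norm (?A + D)"
    using norm_pair_le[OF R l] by (simp add: N_def)
qed

end

section \<open>Decreasing the norm by a diagonal perturbation\<close>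

text \<open>Polarization: \<open>4 inner (B u) y\<close> is the difference of the quadratic form at \<open>u + y\<close> and
  \<open>u - y\<close>, and for \<open>y = B x\<close> the vector \<open>u\<close> is \<open>x\<close> rescaled to the length of \<open>y\<close>.\<close>

lemma self_adjoint_norm_le:
  assumes B: "self_adjoint B" and k: "0 \<le> k" and bound: "\<And>x. \<bar>inner (blinfun_apply B x) x\<bar> \<le> k * (norm x)\<^sup>2"
  shows "norm B \<le> k"
proof (rule norm_blinfun_bound[OF k])
  fix x
  define y where "y = blinfun_apply B x"
  show "norm (blinfun_apply B x) \<le> k * norm x"
  proof (cases "y = 0")
    case True
    then show ?thesis using k by (simp add: y_def)
  next
    case False
    then have "x \<noteq> 0" by (auto simp: y_def)
    define u where "u = (norm y / norm x) *\<^sub>R x"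
    have Bu: "blinfun_apply B u = (norm y / norm x) *\<^sub>R y" and nu: "norm u = norm y"
      using \<open>x \<noteq> 0\<close> by (simp_all add: u_def y_def blinfun.scaleR_right)
    have sym: "inner (blinfun_apply B y) u = inner (blinfun_apply B u) y"
      by (simp only: self_adjoint_inner[OF B, of y u] inner_commute[of y])
    have "4 * inner (blinfun_apply B u) y =
        inner (blinfun_apply B (u + y)) (u + y) - inner (blinfun_apply B (u - y)) (u - y)"
      using sym by (simp add: blinfun.add_right blinfun.diff_right inner_add_left inner_add_right
          inner_diff_left inner_diff_right)
    also have "\<dots> \<le> k * (norm (u + y))\<^sup>2 + k * (norm (u - y))\<^sup>2"
      using bound[of "u + y"] bound[of "u - y"] by linarith
    also have "\<dots> = k * (2 * ((norm u)\<^sup>2 + (norm y)\<^sup>2))"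
      by (simp add: power2_norm_eq_inner inner_add_left inner_add_right inner_diff_left inner_diff_right algebra_simps)
    also have "\<dots> = 4 * (k * (norm y)\<^sup>2)" by (simp add: nu)
    finally have "inner (blinfun_apply B u) y \<le> k * (norm y)\<^sup>2" by simp
    moreover have "inner (blinfun_apply B u) y = norm y / norm x * (norm y)\<^sup>2"
      by (simp add: Bu power2_norm_eq_inner)
    ultimately have "norm y / norm x * (norm y)\<^sup>2 \<le> k * (norm y)\<^sup>2" by simp
    then have "norm y / norm x \<le> k" by (rule mult_right_le_imp_le) (use False in simp)
    then show ?thesis using \<open>x \<noteq> 0\<close> by (simp add: y_def field_simps)
  qed
qed

lemma one_le_norm_if_form:
  assumes "\<bar>inner (blinfun_apply B x) x\<bar> = (norm x)\<^sup>2" "x \<noteq> (0 :: 'a :: complex_hilbert_space)"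
  shows "1 \<le> norm B"
proof -
  have "(norm x)\<^sup>2 \<le> norm (blinfun_apply B x) * norm x"
    using Cauchy_Schwarz_ineq2[of "blinfun_apply B x" x] assms(1) by simp
  also have "\<dots> \<le> norm B * norm x * norm x"
    by (intro mult_right_mono norm_blinfun) simp
  finally show ?thesis using assms(2) by (simp add: power2_eq_square)
qed

text \<open>On the subspace, where the projection attains its norm, the form of \<open>D\<close> is negative; on the
  orthogonal complement a small multiple of \<open>D\<close> stays well below \<open>1\<close>. The mixed term
  \<open>2 K |p| |w|\<close> is split by the inequality between the means so that half of the gain
  \<open>\<delta> |p|^2\<close> survives; the remaining terms determine the bound on \<open>\<epsilon>\<close>.\<close>

lemma (in onb_subspace) form_upper_bound:
  assumes D: "self_adjoint D" "norm D \<le> K" and \<delta>: "0 < \<delta>"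
    and neg: "\<And>x. x \<in> S \<Longrightarrow> inner (blinfun_apply D x) x \<le> - \<delta> * (norm x)\<^sup>2"
    and \<epsilon>: "0 < \<epsilon>" "\<epsilon> * (K + 2 * K\<^sup>2 / \<delta> + \<delta> / 2) \<le> 1"
  shows "(norm (blinfun_apply (proj S) x))\<^sup>2 + \<epsilon> * inner (blinfun_apply D x) x \<le> (1 - \<epsilon> * \<delta> / 2) * (norm x)\<^sup>2"
proof -
  define p where "p = blinfun_apply (proj S) x"
  define w where "w = x - p"
  have K: "0 \<le> K" using D(2) norm_ge_zero order_trans by blast
  have p: "p \<in> S" by (simp add: p_def proj_mem)
  have "cinner w p = 0" using cinner_residual[OF p, of x] by (simp add: w_def p_def)
  from pythagoras[OF this] have nx: "(norm x)\<^sup>2 = (norm w)\<^sup>2 + (norm p)\<^sup>2" by (simp add: w_def)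
  have le: "inner (blinfun_apply D y) z \<le> K * norm y * norm z" for y z
    using Re_cinner_le[of D y z] D(2) by (simp add: inner_eq_Re_cinner)
      (meson mult_right_mono norm_ge_zero order_trans)
  have sym: "inner (blinfun_apply D w) p = inner (blinfun_apply D p) w"
    by (simp only: self_adjoint_inner[OF D(1), of w p] inner_commute[of w])
  have "x = p + w" by (simp add: w_def)
  then have "inner (blinfun_apply D x) x =
      inner (blinfun_apply D p) p + 2 * inner (blinfun_apply D p) w + inner (blinfun_apply D w) w"
    by (simp add: blinfun.add_right inner_add_left inner_add_right sym)
  also have "\<dots> \<le> - \<delta> * (norm p)\<^sup>2 + 2 * (K * norm p * norm w) + K * norm w * norm w"
    using neg[OF p] le[of p w] le[of w w] by linarith
  also have "2 * (K * norm p * norm w) \<le> \<delta> / 2 * (norm p)\<^sup>2 + 2 * K\<^sup>2 / \<delta> * (norm w)\<^sup>2"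
  proof -
    have "0 \<le> (\<delta> * norm p - 2 * K * norm w)\<^sup>2 / (2 * \<delta>)" using \<delta> by simp
    also have "\<dots> = \<delta> / 2 * (norm p)\<^sup>2 + 2 * K\<^sup>2 / \<delta> * (norm w)\<^sup>2 - 2 * (K * norm p * norm w)"
      using \<delta> by (simp add: field_simps power2_eq_square)
    finally show ?thesis by simp
  qed
  finally have form: "inner (blinfun_apply D x) x \<le> - (\<delta> / 2) * (norm p)\<^sup>2 + (K + 2 * K\<^sup>2 / \<delta>) * (norm w)\<^sup>2"
    by (simp add: algebra_simps power2_eq_square)
  have "(norm p)\<^sup>2 + \<epsilon> * inner (blinfun_apply D x) x \<le>
      (norm p)\<^sup>2 + \<epsilon> * (- (\<delta> / 2) * (norm p)\<^sup>2 + (K + 2 * K\<^sup>2 / \<delta>) * (norm w)\<^sup>2)"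
    using form \<epsilon>(1) by simp
  also have "\<dots> = (1 - \<epsilon> * \<delta> / 2) * (norm p)\<^sup>2 + (\<epsilon> * (K + 2 * K\<^sup>2 / \<delta> + \<delta> / 2) - \<epsilon> * \<delta> / 2) * (norm w)\<^sup>2"
    by (simp add: algebra_simps)
  also have "\<dots> \<le> (1 - \<epsilon> * \<delta> / 2) * (norm p)\<^sup>2 + (1 - \<epsilon> * \<delta> / 2) * (norm w)\<^sup>2"
    using \<epsilon>(2) by (intro add_left_mono mult_right_mono) auto
  also have "\<dots> = (1 - \<epsilon> * \<delta> / 2) * (norm x)\<^sup>2"
    by (simp add: nx algebra_simps)
  finally show ?thesis by (simp add: p_def)
qed

lemma (in onb_subspace) inner_proj: "inner (blinfun_apply (proj S) x) x = (norm (blinfun_apply (proj S) x))\<^sup>2"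
proof -
  have "inner (blinfun_apply (proj S) x) x = inner (blinfun_apply (proj S) x) (blinfun_apply (proj S) x)"
    using cinner_proj[of x "blinfun_apply (proj S) x"] proj_id[OF proj_mem] cinner_proj[of x x]
    by (simp add: inner_eq_Re_cinner)
  then show ?thesis by (simp add: power2_norm_eq_inner)
qed

context subspace_pair
begin

text \<open>A small multiple of \<open>D\<close> pushes the form of the difference of the projections down on \<open>S\<close> and up
  on \<open>V\<close>. The bound from above is \<open>form_upper_bound\<close> for \<open>S\<close> and \<open>D\<close>, the bound from below
  is the same estimate for \<open>V\<close> and \<open>- D\<close>.\<close>

lemma not_minimal_if_separated:
  assumes D: "self_adjoint D" "diagonal_op E D" and \<delta>: "0 < \<delta>"
    and neg: "\<And>x. x \<in> S \<Longrightarrow> inner (blinfun_apply D x) x \<le> - \<delta> * (norm x)\<^sup>2"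
    and pos: "\<And>x. x \<in> V \<Longrightarrow> inner (blinfun_apply D x) x \<ge> \<delta> * (norm x)\<^sup>2"
    and x0: "x0 \<in> S \<or> x0 \<in> V" "x0 \<noteq> 0"
  shows "\<not> minimal_op E (proj S - proj V)"
proof -
  define K where "K = norm D"
  define c where "c = K + 2 * K\<^sup>2 / \<delta> + \<delta> / 2"
  have c: "c > 0" using \<delta> by (auto simp: c_def K_def intro!: add_nonneg_pos)
  define \<epsilon> where "\<epsilon> = 1 / c"
  have \<epsilon>: "0 < \<epsilon>" "\<epsilon> * (K + 2 * K\<^sup>2 / \<delta> + \<delta> / 2) \<le> 1"
    using c by (auto simp: \<epsilon>_def c_def[symmetric])
  define k where "k = 1 - \<epsilon> * \<delta> / 2"
  have k: "0 \<le> k" "k < 1"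
  proof -
    have "\<epsilon> * (\<delta> / 2) \<le> \<epsilon> * (K + 2 * K\<^sup>2 / \<delta> + \<delta> / 2)"
      using \<epsilon>(1) \<delta> by (intro mult_left_mono) (auto simp: K_def)
    from order_trans[OF this \<epsilon>(2)] show "0 \<le> k" by (simp add: k_def)
    show "k < 1" using \<epsilon>(1) \<delta> by (simp add: k_def)
  qed
  let ?B = "proj S - proj V + \<epsilon> *\<^sub>R D"
  have form: "inner (blinfun_apply ?B x) x = (norm (blinfun_apply (proj S) x))\<^sup>2
      - (norm (blinfun_apply (proj V) x))\<^sup>2 + \<epsilon> * inner (blinfun_apply D x) x" for x
    by (simp add: op_simps inner_add_left inner_diff_left S.inner_proj V.inner_proj)
  have "norm ?B \<le> k"
  proof (rule self_adjoint_norm_le[OF _ k(1)])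
    show "self_adjoint ?B"
      by (intro self_adjoint_add self_adjoint_diff self_adjoint_scaleR S.self_adjoint_proj V.self_adjoint_proj D(1))
    fix x
    have "(norm (blinfun_apply (proj S) x))\<^sup>2 + \<epsilon> * inner (blinfun_apply D x) x \<le> k * (norm x)\<^sup>2"
      unfolding k_def using S.form_upper_bound[OF D(1) _ \<delta> neg \<epsilon>] by (simp add: K_def)
    moreover have "(norm (blinfun_apply (proj V) x))\<^sup>2 + \<epsilon> * inner (blinfun_apply (- D) x) x \<le> k * (norm x)\<^sup>2"
      unfolding k_def
    proof (rule V.form_upper_bound[OF _ _ \<delta> _ \<epsilon>])
      show "self_adjoint (- D)" using self_adjoint_scaleR[OF D(1), of "- 1"] by simp
    qed (use pos in \<open>auto simp: K_def op_simps\<close>)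
    then have "(norm (blinfun_apply (proj V) x))\<^sup>2 - \<epsilon> * inner (blinfun_apply D x) x \<le> k * (norm x)\<^sup>2"
      by (simp add: op_simps)
    ultimately show "\<bar>inner (blinfun_apply ?B x) x\<bar> \<le> k * (norm x)\<^sup>2"
      unfolding form abs_le_iff
      using zero_le_power2[of "norm (blinfun_apply (proj S) x)"] zero_le_power2[of "norm (blinfun_apply (proj V) x)"]
      by linarith
  qed
  also have "k < 1" by (rule k(2))
  also have "1 \<le> norm (proj S - proj V)"
    by (rule one_le_norm_if_form[OF _ x0(2)])
       (use x0(1) in \<open>auto simp: op_simps S.proj_id V.proj_id proj_S_V proj_V_S power2_norm_eq_inner\<close>)
  finally have "norm (proj S - proj V + \<epsilon> *\<^sub>R D) < norm (proj S - proj V)" .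
  moreover have "diagonal_op E (\<epsilon> *\<^sub>R D)"
    using D(2) by (auto simp: diagonal_op_def op_simps cinner_simps bounded_ops_scaleR)
  ultimately show ?thesis unfolding minimal_op_def by force
qed

end

text \<open>The operator is itself diagonal and nonzero, so its negative is a better diagonal correction
  than \<open>0\<close>.\<close>

lemma not_minimal_rank_one:
  assumes E: "hilbert_basis E"
  shows "\<not> minimal_op E (E 0 \<otimes>\<^sub>o E 0)"
proof
  assume min: "minimal_op E (E 0 \<otimes>\<^sub>o E 0)"
  have e0: "cinner (E 0) (E 0) = 1"
    using E by (simp add: hilbert_basis_def orthonormal_on_def)
  have "diagonal_op E (- 1 *\<^sub>R (E 0 \<otimes>\<^sub>o E 0))"
    using E
    by (auto simp: diagonal_op_def op_simps cinner_simps hilbert_basis_def orthonormal_on_def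
        intro!: bounded_ops_scaleR[of _ "- 1", simplified] bounded_ops_tensor)
  then have "norm (E 0 \<otimes>\<^sub>o E 0) \<le> norm (E 0 \<otimes>\<^sub>o E 0 + (- 1 *\<^sub>R (E 0 \<otimes>\<^sub>o E 0)))"
    using min unfolding minimal_op_def by blast
  then have "E 0 \<otimes>\<^sub>o E 0 = 0" by simp
  then have "blinfun_apply (E 0 \<otimes>\<^sub>o E 0) (E 0) = 0" by simp
  then have "E 0 = 0" by (simp add: op_simps e0 scaleC_one)
  then show False using e0 by simp
qed

lemma compact_op_tensor: "compact_op (a \<otimes>\<^sub>o (b :: 'a :: complex_hilbert_space))"
proof -
  have "blinfun_apply (a \<otimes>\<^sub>o b) ` cball 0 1 \<subseteq> (\<lambda>c. c *\<^sub>C a) ` cball 0 (norm b)"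
  proof (intro image_subsetI)
    fix x :: 'a assume "x \<in> cball 0 1"
    then have "cmod (cinner x b) \<le> norm b"
      using order_trans[OF cmod_cinner_le[of x b]] mult_right_mono[of "norm x" 1 "norm b"] by simp
    then show "blinfun_apply (a \<otimes>\<^sub>o b) x \<in> (\<lambda>c. c *\<^sub>C a) ` cball 0 (norm b)"
      by (auto simp: op_simps)
  qed
  moreover have K: "compact ((\<lambda>c. c *\<^sub>C a) ` cball 0 (norm b))"
    by (intro compact_continuous_image linear_continuous_on bounded_linear_scaleC_left compact_cball)
  ultimately have "compact (closure (blinfun_apply (a \<otimes>\<^sub>o b) ` cball 0 1))"
    using compact_Int_closed[OF K closed_closure] closure_minimal compact_imp_closed[OF K]
    by (metis inf.absorb_iff2)
  then show ?thesis by (simp add: compact_op_def bounded_ops_tensor)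
qed

section \<open>Separating the diagonals\<close>

text \<open>The point of least norm of a compact convex set separates the set from the origin.\<close>

lemma compact_convex_separation:
  fixes C :: "'b :: real_inner set"
  assumes C: "compact C" "C \<noteq> {}" "0 \<notin> C"
    and conv: "\<And>x y u. x \<in> C \<Longrightarrow> y \<in> C \<Longrightarrow> 0 \<le> u \<Longrightarrow> u \<le> 1 \<Longrightarrow> (1 - u) *\<^sub>R x + u *\<^sub>R y \<in> C"
  shows "\<exists>z \<delta>. \<delta> > 0 \<and> (\<forall>c\<in>C. \<delta> \<le> inner z c)"
proof -
  have "continuous_on C norm" by (intro continuous_intros)
  from continuous_attains_inf[OF C(1,2) this]
  obtain z where z: "z \<in> C" "\<And>c. c \<in> C \<Longrightarrow> norm z \<le> norm c" by blast
  have "(norm z)\<^sup>2 \<le> inner z c" if c: "c \<in> C" for c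
  proof (rule ccontr)
    define d where "d = c - z"
    assume "\<not> (norm z)\<^sup>2 \<le> inner z c"
    then have neg: "inner z d < 0" by (simp add: d_def inner_diff_right power2_norm_eq_inner)
    then have "d \<noteq> 0" by auto
    \<comment> \<open>The step along \<open>d\<close> that minimises the norm, cut off at the end of the segment.\<close>
    define u where "u = min 1 (- inner z d / (norm d)\<^sup>2)"
    have u: "0 < u" "u \<le> 1" using neg \<open>d \<noteq> 0\<close> by (auto simp: u_def divide_neg_pos)
    have "u \<le> - inner z d / (norm d)\<^sup>2" by (simp add: u_def)
    then have u2: "u * (norm d)\<^sup>2 \<le> - inner z d" using \<open>d \<noteq> 0\<close> by (simp add: field_simps)
    have "norm z \<le> norm ((1 - u) *\<^sub>R z + u *\<^sub>R c)"
      using u by (intro z(2) conv z(1) c) auto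
    also have "(1 - u) *\<^sub>R z + u *\<^sub>R c = z + u *\<^sub>R d" by (simp add: d_def algebra_simps)
    finally have "(norm z)\<^sup>2 \<le> (norm (z + u *\<^sub>R d))\<^sup>2" by (intro power_mono) auto
    also have "\<dots> = (norm z)\<^sup>2 + u * (2 * inner z d + u * (norm d)\<^sup>2)"
      by (simp add: power2_norm_eq_inner inner_add_left inner_add_right inner_commute algebra_simps)
    finally have "0 \<le> u * (2 * inner z d + u * (norm d)\<^sup>2)" by simp
    moreover have "2 * inner z d + u * (norm d)\<^sup>2 < 0" using u2 neg by simp
    ultimately show False using u(1) mult_pos_neg[of u] by (meson not_le)
  qed
  moreover have "(norm z)\<^sup>2 > 0" using z(1) C(3) by auto
  ultimately show ?thesis by blast
qed

text \<open>The first \<open>m\<close> diagonal entries, placed in the Hilbert space itself so that its inner product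
  can be used to separate them.\<close>

definition diag_vec :: "nat \<Rightarrow> (nat \<Rightarrow> 'a) \<Rightarrow> ('a :: complex_hilbert_space \<Rightarrow>\<^sub>L 'a) \<Rightarrow> 'a" where
  "diag_vec m E X = (\<Sum>j<m. Re (entry E X j) *\<^sub>R E j)"

lemma diag_vec_zero [simp]: "diag_vec m E 0 = 0"
  by (simp add: diag_vec_def)

lemma diag_vec_add: "diag_vec m E (X + Y) = diag_vec m E X + diag_vec m E Y"
  by (simp add: diag_vec_def entry_add scaleR_add_left sum.distrib)

lemma diag_vec_scaleR: "diag_vec m E (c *\<^sub>R X) = c *\<^sub>R diag_vec m E X"
  by (simp add: diag_vec_def entry_scaleR scaleR_sum_right)

lemma diag_vec_sum: "diag_vec m E (\<Sum>i\<in>I. X i) = (\<Sum>i\<in>I. diag_vec m E (X i))"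
  by (induction I rule: infinite_finite_induct) (auto simp: diag_vec_add)

lemma tensor_scaleR: "(c *\<^sub>R x) \<otimes>\<^sub>o (c *\<^sub>R x) = c\<^sup>2 *\<^sub>R (x \<otimes>\<^sub>o x)"
proof (rule blinfun_eqI)
  fix y
  have "(of_real c * k) *\<^sub>C x = c *\<^sub>R (k *\<^sub>C x)" for k
    by (simp add: scaleC_of_real[symmetric] scaleC_scaleC)
  then show "blinfun_apply ((c *\<^sub>R x) \<otimes>\<^sub>o (c *\<^sub>R x)) y = blinfun_apply (c\<^sup>2 *\<^sub>R (x \<otimes>\<^sub>o x)) y"
    by (simp add: op_simps cinner_scaleR_right scaleC_scaleR power2_eq_square)
qed

context onb_subspace_trace
begin

lemma density_convex:
  assumes "X \<in> density_ops E S" "Y \<in> density_ops E S" "0 \<le> u" "u \<le> 1"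
  shows "(1 - u) *\<^sub>R X + u *\<^sub>R Y \<in> density_ops E S"
proof -
  have pos: "X \<in> pos_ops_on S" "Y \<in> pos_ops_on S" and tr: "trace E X = 1" "trace E Y = 1"
    using assms by (auto simp: density_ops_eq)
  have "entry E X sums 1" "entry E Y sums 1"
    using pos_ops_on_trace[OF pos(1)] pos_ops_on_trace[OF pos(2)] tr trace_sums by metis+
  then have "(\<lambda>n. of_real (1 - u) * entry E X n + of_real u * entry E Y n) sums (of_real (1 - u) * 1 + of_real u * 1)"
    by (intro sums_add sums_mult)
  then have "entry E ((1 - u) *\<^sub>R X + u *\<^sub>R Y) sums 1"
    by (simp add: entry_add[abs_def] entry_scaleR)
  then have "trace E ((1 - u) *\<^sub>R X + u *\<^sub>R Y) = 1" by (rule trace_sums)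
  then show ?thesis
    using assms(3,4) by (simp add: density_ops_eq pos_ops_on_add pos_ops_on_scaleR pos)
qed

text \<open>A density operator is a sum of \<open>r\<close> operators \<open>x \<otimes>\<^sub>o x\<close> with total trace \<open>1\<close>: the weights of the
  spectral decomposition are absorbed into the vectors, which then range over a compact set.\<close>

lemma density_ops_eq_sums:
  "density_ops E S = {\<Sum>i<r. x i \<otimes>\<^sub>o x i | x. (\<forall>i<r. x i \<in> S \<inter> cball 0 1) \<and> (\<Sum>i<r. (norm (x i))\<^sup>2) = 1}"
proof (intro equalityI subsetI)
  fix X assume "X \<in> density_ops E S"
  then have X: "X \<in> pos_ops_on S" "trace E X = 1" by (auto simp: density_ops_eq)
  obtain a \<alpha> where a: "orthonormal_on {..<r} a" "a ` {..<r} \<subseteq> S" "\<forall>i<r. 0 \<le> \<alpha> i"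
    and Xa: "X = (\<Sum>i<r. \<alpha> i *\<^sub>R (a i \<otimes>\<^sub>o a i))"
    using spectral_theorem[OF X(1)] by blast
  have "complex_of_real (\<Sum>i<r. \<alpha> i) = 1"
    using trace_sums[OF entry_spectral_sums[OF hilbert_basis a(1), of \<alpha>]] X(2) Xa by simp
  then have sum: "(\<Sum>i<r. \<alpha> i) = 1" by (simp only: of_real_eq_1_iff)
  define x where "x i = sqrt (\<alpha> i) *\<^sub>R a i" for i
  have n: "(norm (x i))\<^sup>2 = \<alpha> i" if "i < r" for i
    using that a orthonormal_on_norm[OF a(1)] by (simp add: x_def power_mult_distrib)
  have "\<alpha> i \<le> 1" if "i < r" for i
    using member_le_sum[of i "{..<r}" \<alpha>] that a(3) sum by auto
  then have "norm (x i) \<le> 1" if "i < r" for i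
    using n[OF that] that power_le_one_iff[of "norm (x i)" 2] by simp
  moreover have "x i \<in> S" if "i < r" for i
    using complex_vector.subspace_scale[OF subspace, of "a i" "of_real (sqrt (\<alpha> i))"] that a(2)
    by (auto simp: x_def scaleC_of_real)
  moreover have "(\<Sum>i<r. (norm (x i))\<^sup>2) = 1" using n sum by simp
  moreover have "X = (\<Sum>i<r. x i \<otimes>\<^sub>o x i)"
    unfolding Xa x_def tensor_scaleR using a(3) by (intro sum.cong) auto
  ultimately show "X \<in> {\<Sum>i<r. x i \<otimes>\<^sub>o x i | x. (\<forall>i<r. x i \<in> S \<inter> cball 0 1) \<and> (\<Sum>i<r. (norm (x i))\<^sup>2) = 1}"
    by (intro CollectI exI[of _ x]) auto
next
  fix X assume "X \<in> {\<Sum>i<r. x i \<otimes>\<^sub>o x i | x. (\<forall>i<r. x i \<in> S \<inter> cball 0 1) \<and> (\<Sum>i<r. (norm (x i))\<^sup>2) = 1}"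
  then obtain x where x: "\<And>i. i < r \<Longrightarrow> x i \<in> S" "(\<Sum>i<r. (norm (x i))\<^sup>2) = 1" "X = (\<Sum>i<r. x i \<otimes>\<^sub>o x i)"
    by auto
  have "entry E X sums (\<Sum>i<r. cinner (x i) (x i))"
    unfolding x(3) entry_sum[abs_def] by (intro sums_sum entry_tensor_sums hilbert_basis)
  also have "(\<Sum>i<r. cinner (x i) (x i)) = of_real (\<Sum>i<r. (norm (x i))\<^sup>2)"
    by (simp only: cinner_self of_real_sum)
  finally have "trace E X = 1" by (simp add: x(2) trace_sums)
  then show "X \<in> density_ops E S"
    unfolding density_ops_eq x(3) by (auto intro!: sum_pos_ops_on tensor_pos_ops_on x(1))
qed

lemma compact_diag_vec: "compact (diag_vec m E ` density_ops E S)"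
proof -
  define g where "g x = (diag_vec m E (x \<otimes>\<^sub>o x), (norm x)\<^sup>2)" for x
  have "continuous_on (S \<inter> cball 0 1) g"
    unfolding g_def diag_vec_def entry_tensor_self Re_complex_of_real
    by (intro continuous_intros linear_continuous_on bounded_linear_cinner_left)
  then have "compact {\<Sum>i<r. g (x i) | x. \<forall>i<r. x i \<in> S \<inter> cball 0 1}"
    by (intro compact_sum_set[of _ "\<lambda>_. g"] compact_unit_ball)
  moreover have "closed {p :: 'a \<times> real. snd p = 1}"
    by (intro closed_Collect_eq continuous_intros)
  ultimately have "compact ({\<Sum>i<r. g (x i) | x. \<forall>i<r. x i \<in> S \<inter> cball 0 1} \<inter> {p. snd p = 1})"
    by (rule compact_Int_closed)
  then have "compact (fst ` ({\<Sum>i<r. g (x i) | x. \<forall>i<r. x i \<in> S \<inter> cball 0 1} \<inter> {p. snd p = 1}))"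
    by (intro compact_continuous_image continuous_intros)
  also have "fst ` ({\<Sum>i<r. g (x i) | x. \<forall>i<r. x i \<in> S \<inter> cball 0 1} \<inter> {p. snd p = 1}) =
      diag_vec m E ` density_ops E S" (is "?L = ?R")
  proof -
    have fst: "fst (\<Sum>i<r. g (x i)) = diag_vec m E (\<Sum>i<r. x i \<otimes>\<^sub>o x i)" for x
      by (simp add: fst_sum g_def diag_vec_sum)
    have snd: "snd (\<Sum>i<r. g (x i)) = (\<Sum>i<r. (norm (x i))\<^sup>2)" for x
      by (simp add: snd_sum g_def)
    show ?thesis
    proof (intro equalityI subsetI)
      fix y assume "y \<in> ?L"
      then obtain x where "\<forall>i<r. x i \<in> S \<inter> cball 0 1" "snd (\<Sum>i<r. g (x i)) = 1" "y = fst (\<Sum>i<r. g (x i))"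
        by blast
      then show "y \<in> ?R" unfolding fst snd density_ops_eq_sums by blast
    next
      fix y assume "y \<in> ?R"
      then obtain x where "\<forall>i<r. x i \<in> S \<inter> cball 0 1" "(\<Sum>i<r. (norm (x i))\<^sup>2) = 1"
        "y = diag_vec m E (\<Sum>i<r. x i \<otimes>\<^sub>o x i)"
        unfolding density_ops_eq_sums by blast
      then show "y \<in> ?L"
        unfolding fst[symmetric] snd[symmetric] by blast
    qed
  qed
  finally show ?thesis .
qed

lemma unit_tensor_density:
  assumes "x \<in> S" "norm x = 1"
  shows "x \<otimes>\<^sub>o x \<in> density_ops E S"
proof -
  have "trace E (x \<otimes>\<^sub>o x) = 1"
    using trace_sums[OF entry_tensor_sums[OF hilbert_basis, of x x]] assms(2) by (simp add: cinner_self)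
  then show ?thesis using assms(1) by (simp add: density_ops_eq tensor_pos_ops_on)
qed

text \<open>A linear bound on the diagonals of density operators is a bound on a quadratic form.\<close>

lemma inner_diag_vec_tensor:
  assumes "x \<in> S" "\<And>X. X \<in> density_ops E S \<Longrightarrow> c \<le> inner z (diag_vec m E X)"
  shows "c * (norm x)\<^sup>2 \<le> inner z (diag_vec m E (x \<otimes>\<^sub>o x))"
proof (cases "x = 0")
  case True
  have "diag_vec m E (0 \<otimes>\<^sub>o 0) = 0" by (simp add: diag_vec_def entry_tensor_self)
  then show ?thesis using True by simp
next
  case False
  define y where "y = (1 / norm x) *\<^sub>R x"
  have "y \<in> S"
    using complex_vector.subspace_scale[OF subspace assms(1), of "of_real (1 / norm x)"]
    by (simp add: y_def scaleC_of_real del: of_real_divide)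
  moreover have "norm y = 1" using False by (simp add: y_def)
  ultimately have "c \<le> inner z (diag_vec m E (y \<otimes>\<^sub>o y))"
    by (intro assms(2) unit_tensor_density)
  moreover have "x = norm x *\<^sub>R y" using False by (simp add: y_def)
  then have "x \<otimes>\<^sub>o x = (norm x)\<^sup>2 *\<^sub>R (y \<otimes>\<^sub>o y)" using tensor_scaleR by metis
  ultimately show ?thesis
    by (simp add: diag_vec_scaleR mult.commute[of c] mult_left_mono)
qed

end

context subspace_pair
begin

text \<open>The diagonals of the density operators on \<open>S\<close> and on \<open>V\<close> form disjoint compact convex sets. A
  linear functional separating them is a real diagonal operator; shifting it by a multiple of
  the identity puts the value \<open>0\<close> between the two sets. If one of the subspaces is zero, then plus or
  minus the identity has the required signs.\<close>

lemma separating_diagonal: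
  assumes no: "moment E S \<inter> moment E V = {}"
  shows "\<exists>D \<delta>. self_adjoint D \<and> diagonal_op E D \<and> 0 < \<delta> \<and>
    (\<forall>x\<in>S. inner (blinfun_apply D x) x \<le> - \<delta> * (norm x)\<^sup>2) \<and>
    (\<forall>x\<in>V. inner (blinfun_apply D x) x \<ge> \<delta> * (norm x)\<^sup>2)"
proof -
  have id: "self_adjoint id_blinfun" "diagonal_op E (c *\<^sub>R id_blinfun)" for c
    using S.hilbert_basis
    by (auto simp: self_adjoint_def bounded_ops_def diagonal_op_def op_simps cinner_simps scaleC_scaleR
        hilbert_basis_def orthonormal_on_def)
  consider "S = {0}" | "V = {0}" | "S \<noteq> {0}" "V \<noteq> {0}" by blast
  then show ?thesis
  proof cases
    case 1
    then show ?thesis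
      using id(1) id(2)[of 1] by (intro exI[of _ id_blinfun] exI[of _ 1]) (auto simp: power2_norm_eq_inner)
  next
    case 2
    then show ?thesis
      using self_adjoint_scaleR[OF id(1), of "- 1"] id(2)[of "- 1"]
      by (intro exI[of _ "- id_blinfun"] exI[of _ 1]) (auto simp: power2_norm_eq_inner op_simps)
  next
    case 3
    let ?A = "diag_vec m E ` density_ops E S" and ?B = "diag_vec m E ` density_ops E V"
    have unit: "\<exists>x\<in>W. norm x = 1" if W: "complex_vector.subspace W" "W \<noteq> {0}" for W :: "'a set"
    proof -
      obtain x where x: "x \<in> W" "x \<noteq> 0" using W complex_vector.subspace_0 by blast
      then have "of_real (1 / norm x) *\<^sub>C x \<in> W" using complex_vector.subspace_scale W by blast
      moreover have "norm (complex_of_real (1 / norm x) *\<^sub>C x) = 1" using x(2) by (simp add: norm_scaleC norm_divide)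
      ultimately show ?thesis by blast
    qed
    have neA: "?A \<noteq> {}" using unit[OF S.subspace 3(1)] S.unit_tensor_density by blast
    have neB: "?B \<noteq> {}" using unit[OF V.subspace 3(2)] V.unit_tensor_density by blast
    define C where "C = {a - b | a b. a \<in> ?A \<and> b \<in> ?B}"
    have "compact C" unfolding C_def by (intro compact_differences S.compact_diag_vec V.compact_diag_vec)
    moreover have "C \<noteq> {}" using neA neB by (auto simp: C_def)
    moreover have "0 \<notin> C"
    proof
      assume "0 \<in> C"
      then obtain X Y where XY: "X \<in> density_ops E S" "Y \<in> density_ops E V" "diag_vec m E X = diag_vec m E Y"
        by (auto simp: C_def)
      have on: "orthonormal_on {..<m} E"
        using S.hilbert_basis by (auto simp: hilbert_basis_def orthonormal_on_def)
      have "Re (entry E X j) = Re (entry E Y j)" if "j < m" for j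
      proof -
        have "cinner (diag_vec m E Z) (E j) = of_real (Re (entry E Z j))" for Z
          using orthonormal_on_cinner_sum[OF on, of j "\<lambda>i. of_real (Re (entry E Z i))"] that
          by (simp add: diag_vec_def scaleC_of_real)
        then show ?thesis using XY(3) by (metis of_real_eq_iff)
      qed
      then have "entry E X j = entry E Y j" if "j < m" for j
        using positive_entry[of X E j] positive_entry[of Y E j] XY that by (simp add: density_ops_def)
      then show False using no XY moments_meet_iff_density by blast
    qed
    moreover have "(1 - u) *\<^sub>R x + u *\<^sub>R y \<in> C" if x: "x \<in> C" and y: "y \<in> C" and u: "0 \<le> u" "u \<le> 1" for x y u
    proof -
      obtain X Y where X: "X \<in> density_ops E S" "Y \<in> density_ops E V" "x = diag_vec m E X - diag_vec m E Y"
        using x by (auto simp: C_def)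
      obtain X' Y' where Y: "X' \<in> density_ops E S" "Y' \<in> density_ops E V" "y = diag_vec m E X' - diag_vec m E Y'"
        using y by (auto simp: C_def)
      have "(1 - u) *\<^sub>R x + u *\<^sub>R y = diag_vec m E ((1 - u) *\<^sub>R X + u *\<^sub>R X') - diag_vec m E ((1 - u) *\<^sub>R Y + u *\<^sub>R Y')"
        unfolding X(3) Y(3) diag_vec_add diag_vec_scaleR by (simp add: algebra_simps)
      then show ?thesis
        unfolding C_def using S.density_convex[OF X(1) Y(1) u] V.density_convex[OF X(2) Y(2) u] by blast
    qed
    ultimately obtain z \<delta> where \<delta>: "\<delta> > 0" and z: "\<And>c. c \<in> C \<Longrightarrow> \<delta> \<le> inner z c"
      using compact_convex_separation[of C] by blast
    have "continuous_on ?B (inner z)" by (intro continuous_intros)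
    from continuous_attains_sup[OF V.compact_diag_vec neB this]
    obtain b0 where b0: "b0 \<in> ?B" "\<And>b. b \<in> ?B \<Longrightarrow> inner z b \<le> inner z b0" by blast
    define \<beta> where "\<beta> = inner z b0"
    have upper: "\<beta> + \<delta> \<le> inner z (diag_vec m E X)" if "X \<in> density_ops E S" for X
    proof -
      have "diag_vec m E X - b0 \<in> C" using that b0(1) by (auto simp: C_def)
      from z[OF this] show ?thesis by (simp add: inner_diff_right \<beta>_def)
    qed
    have lower: "- \<beta> \<le> inner (- z) (diag_vec m E Y)" if "Y \<in> density_ops E V" for Y
      using b0(2)[of "diag_vec m E Y"] that by (simp add: \<beta>_def)
    \<comment> \<open>The functional is at least \<open>\<beta> + \<delta>\<close> on one set and at most \<open>\<beta>\<close> on the other; the threshold is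
      put halfway.\<close>
    define D where "D = (\<beta> + \<delta> / 2) *\<^sub>R id_blinfun - (\<Sum>j<m. inner z (E j) *\<^sub>R (E j \<otimes>\<^sub>o E j))"
    have "self_adjoint D"
      unfolding D_def by (intro self_adjoint_diff self_adjoint_scaleR self_adjoint_sum self_adjoint_tensor id)
    moreover have "diagonal_op E D"
    proof -
      have "cinner (blinfun_apply D (E i)) (E j) = 0" if "i \<noteq> j" for i j
        using S.hilbert_basis that
        by (auto simp: D_def op_simps cinner_simps hilbert_basis_def orthonormal_on_def intro!: sum.neutral)
      then show ?thesis using \<open>self_adjoint D\<close> by (simp add: diagonal_op_def self_adjointD)
    qed
    moreover have form: "inner (blinfun_apply D x) x = (\<beta> + \<delta> / 2) * (norm x)\<^sup>2 - inner z (diag_vec m E (x \<otimes>\<^sub>o x))" for x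
    proof -
      have "inner (blinfun_apply (E j \<otimes>\<^sub>o E j) x) x = (cmod (cinner x (E j)))\<^sup>2" for j
        unfolding inner_eq_Re_cinner cinner_tensor_self by (simp add: cmod_cinner_commute)
      then show ?thesis
        by (simp add: D_def diag_vec_def entry_tensor_self op_simps(3-) inner_diff_left inner_sum_left inner_sum_right
            power2_norm_eq_inner mult.commute)
    qed
    moreover have "inner (blinfun_apply D x) x \<le> - (\<delta> / 2) * (norm x)\<^sup>2" if "x \<in> S" for x
      using S.inner_diag_vec_tensor[OF that upper] by (simp add: form algebra_simps)
    moreover have "inner (blinfun_apply D x) x \<ge> (\<delta> / 2) * (norm x)\<^sup>2" if "x \<in> V" for x
      using V.inner_diag_vec_tensor[OF that lower] by (simp add: form algebra_simps)
    ultimately show ?thesis using \<delta> by (intro exI[of _ D] exI[of _ "\<delta> / 2"]) auto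
  qed
qed

text \<open>If the moments are disjoint, then \<open>R = 0\<close> is a counterexample unless both subspaces are zero. In
  that case the difference of the projections is zero, and a diagonal \<open>R\<close> of rank one serves.\<close>

lemma moments_meet_iff_minimal:
  "moment E S \<inter> moment E V \<noteq> {} \<longleftrightarrow>
        (\<forall>R l. R \<in> trace_orthogonal E S V \<and> self_adjoint R \<and> compact_op R \<and>
               R o\<^sub>L proj S = 0 \<and> R o\<^sub>L proj V = 0 \<and> l > 0 \<and> norm R \<le> l \<longrightarrow>
             minimal_op E (l *\<^sub>R (proj S - proj V) + R))" (is "_ \<longleftrightarrow> ?min")
proof
  assume "moment E S \<inter> moment E V \<noteq> {}"
  then show ?min using minimal_if_support unfolding moments_meet_iff_forms_support by blast
next
  assume min: ?min
  show "moment E S \<inter> moment E V \<noteq> {}"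
  proof
    assume no: "moment E S \<inter> moment E V = {}"
    show False
    proof (cases "S = {0} \<and> V = {0}")
      case True
      let ?R = "E 0 \<otimes>\<^sub>o E 0"
      have P0: "proj S = 0" "proj V = 0"
        using True S.proj_mem V.proj_mem by (auto intro!: blinfun_eqI)
      have "A = 0" if "A \<in> sa_ops_on S \<or> A \<in> sa_ops_on V" for A
        using that by (auto simp: sa_ops_on_def ops_on_def compress_def P0)
      then have "trace E (?R o\<^sub>L A) = 0" if "A \<in> sa_ops_on S \<or> A \<in> sa_ops_on V" for A
        using that by (metis trace_zero bounded_bilinear.zero_right[OF bounded_bilinear_blinfun_compose])
      then have "?R \<in> trace_orthogonal E S V"
        by (auto simp: trace_orthogonal_def bounded_ops_tensor)
      moreover have "norm ?R \<le> norm ?R + 1" "norm ?R + 1 > 0"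
        using norm_ge_zero[of ?R] by linarith+
      ultimately have "minimal_op E ((norm ?R + 1) *\<^sub>R (proj S - proj V) + ?R)"
        by (intro min[rule_format] conjI) (simp_all add: P0 compact_op_tensor self_adjoint_tensor)
      then show False using not_minimal_rank_one[OF S.hilbert_basis] by (simp add: P0)
    next
      case False
      then obtain x0 where x0: "x0 \<in> S \<or> x0 \<in> V" "x0 \<noteq> 0"
        using complex_vector.subspace_0[OF S.subspace] complex_vector.subspace_0[OF V.subspace] by blast
      have "(0 :: 'a \<Rightarrow>\<^sub>L 'a) \<in> trace_orthogonal E S V" by (simp add: trace_orthogonal_def)
      moreover have "compact_op (0 :: 'a \<Rightarrow>\<^sub>L 'a)"
      proof -
        have "blinfun_apply (0 :: 'a \<Rightarrow>\<^sub>L 'a) ` cball 0 1 \<subseteq> {0}" by auto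
        then have "closure (blinfun_apply (0 :: 'a \<Rightarrow>\<^sub>L 'a) ` cball 0 1) \<subseteq> {0}" by (intro closure_minimal) auto
        then have "compact (closure (blinfun_apply (0 :: 'a \<Rightarrow>\<^sub>L 'a) ` cball 0 1))"
          by (intro finite_imp_compact) (rule finite_subset, auto)
        then show ?thesis by (simp add: compact_op_def)
      qed
      ultimately have "minimal_op E (1 *\<^sub>R (proj S - proj V) + 0)"
        by (intro min[rule_format] conjI) simp_all
      then show False
        using separating_diagonal[OF no] not_minimal_if_separated[OF _ _ _ _ _ x0] by auto
    qed
  qed
qed

end

section \<open>The equivalent conditions\<close>

theorem theorem4:
  fixes E :: "nat \<Rightarrow> 'a :: complex_hilbert_space"
    and S V :: "'a set"
    and s v :: "nat \<Rightarrow> 'a"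
    and US UV :: "complex mat \<Rightarrow> ('a \<Rightarrow>\<^sub>L 'a)"
    and r t m :: nat
  assumes E: "hilbert_basis E"
    and S: "complex_vector.subspace S" "complex_vector.dim S = r"
    and V: "complex_vector.subspace V" "complex_vector.dim V = t"
    and perp: "\<forall>x\<in>S. \<forall>y\<in>V. cinner x y = 0"
    and s: "orthonormal_basis_of S r s"
    and v: "orthonormal_basis_of V t v"
    and US: "matrix_to_op S r s US"
    and UV: "matrix_to_op V t v UV"
    and m: "inj_on (\<lambda>n. (diag_rep E S n, diag_rep E V n)) {..<m}"
      "independent ((\<lambda>n. (diag_rep E S n, diag_rep E V n)) ` {..<m})"
      "span ((\<lambda>n. (diag_rep E S n, diag_rep E V n)) ` {..<m}) =
       span (range (\<lambda>n. (diag_rep E S n, diag_rep E V n)))"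
  shows
    "(moment E S \<inter> moment E V \<noteq> {} \<longleftrightarrow>
        first_terms m ` moment E S \<inter> first_terms m ` moment E V \<noteq> {}) \<and>
     (moment E S \<inter> moment E V \<noteq> {} \<longleftrightarrow>
        (\<exists>M N. \<exists>X\<in>pos_ops_on S. \<exists>Y\<in>pos_ops_on V.
           (M, N) = (inv_into (carrier_mat r r) US X, inv_into (carrier_mat t t) UV Y) \<and>
           (M, N) \<in> psd_mats r \<times> psd_mats t \<and> (M, N) \<noteq> (0\<^sub>m r r, 0\<^sub>m t t) \<and>
           (\<forall>j<m. entry E X j = entry E Y j))) \<and>
     (moment E S \<inter> moment E V \<noteq> {} \<longleftrightarrow>
        joint_range E m (\<lambda>j. compress S (E j \<otimes>\<^sub>o E j)) \<inter>
        joint_range E m (\<lambda>j. compress V (E j \<otimes>\<^sub>o E j)) \<noteq> {0\<^sub>v m}) \<and>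
     (moment E S \<inter> moment E V \<noteq> {} \<longleftrightarrow>
        \<not> mat_joint_range r m (\<lambda>j. inv_into (carrier_mat r r) US (compress S (E j \<otimes>\<^sub>o E j))) \<inter>
          mat_joint_range t m (\<lambda>j. inv_into (carrier_mat t t) UV (compress V (E j \<otimes>\<^sub>o E j)))
            \<subseteq> {0\<^sub>v m}) \<and>
     (moment E S \<inter> moment E V \<noteq> {} \<longleftrightarrow> forms_support E S V) \<and>
     (moment E S \<inter> moment E V \<noteq> {} \<longleftrightarrow>
        (\<forall>R l. R \<in> trace_orthogonal E S V \<and> self_adjoint R \<and> compact_op R \<and>
               R o\<^sub>L proj S = 0 \<and> R o\<^sub>L proj V = 0 \<and> l > 0 \<and> norm R \<le> l \<longrightarrow>
             minimal_op E (l *\<^sub>R (proj S - proj V) + R)))"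
proof -
  interpret subspace_pair S V r t s v E m
    by unfold_locales (fact s E v perp m(3))+
  show ?thesis
    using moments_meet_iff_first_terms moments_meet_iff_psd_matrices[OF US UV] moments_meet_iff_joint_range moments_meet_iff_mat_joint_range[OF US UV] moments_meet_iff_forms_support moments_meet_iff_minimal
    by (intro conjI)
qed

end
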